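(* Let $\beta\in(0,1]$, $R>0$, and let $p\ge 1$ be a real number. Let $\hat T=\big(\max(\hat F_p,0)\big)^{1/p}$. Then for all $n\in\mathbb{N}$ $$\sup_{g\in \mathcal{C}^\beta(R)}\mathbb{E}_g\big[|\hat{T}-\|g\|_p|\big]\le Cn^{-\frac{\beta+1/(2p)}{\beta+1}}$$ with a constant $C>0$ depending only on $R$, $\beta$ and $p$. On the other hand, $$\liminf_{n\to\infty}\,n^{\frac{\beta+1/(2p)}{\beta+1}}\inf_{\tilde T_n}\sup_{g\in \mathcal{C}^\beta(R)}\mathbb{E}_g\big[|\tilde{T}_n-\|g\|_p|\big]>0,$$ where the infimum is taken over all estimators $\tilde T_n$ (real-valued measurable functions of the observations) in the PPP model with intensity $\lambda_g(x,y)=n\mathbf{1}(y\ge g(x))$. In particular, the minimax rate of estimation of $\|g\|_p$ over $\mathcal{C}^\beta(R)$ is $n^{-(\beta+1/(2p))/(\beta+1)}$.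
   Context: Model (PPP model): for each $n\in\mathbb{N}$ one observes the support points $(X_j,Y_j)_{j\ge1}$ of a Poisson point process on $[0,1]\times\mathbb{R}$ with intensity function $\lambda_g(x,y)=n\mathbf{1}(y\ge g(x))$, $x\in[0,1]$, $y\in\mathbb{R}$, where $g$ is an unknown support boundary curve. $\mathbb{E}_g$ denotes expectation under this law. Hölder ball: $\mathcal{C}^\beta(R)=\{g:[0,1]\to\mathbb{R}: |g(x)-g(y)|\le R|x-y|^\beta\ \forall x,y\in[0,1]\}$. $\|\cdot\|_p$ is the norm of $L^p([0,1])$. The maximum-likelihood estimator over $\mathcal{C}^\beta(R)$ is $\hat g^{MLE}(x)=\min_{k\ge 1}\big(Y_k+R|x-X_k|^{\beta}\big)$, $x\in[0,1]$, and the estimator $\hat F_p$ of $\|g\|_p^p$ is $$\hat F_p=\int_0^1|\hat{g}^{MLE}(x)|^p\,dx-\frac{1}{n}\sum_{j\ge 1}p|Y_j|^{p-1}\operatorname{sgn}(Y_j)\mathbf{1}\big(\hat{g}^{MLE}(X_j)\ge Y_j\big).$$ *)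

theory Defs
  imports "HOL-Probability.Probability"
begin

(* A Poisson point process with intensity n * 1(y >= g(x)) on [0,1] x R, g bounded, is almost
   surely simple and has only finitely many points below any given level y = c.  An observation is
   therefore encoded as the set of support points (no enumeration is chosen), and the observation
   space consists of the subsets of [0,1] x R that are finite below every level. *)

definition configs :: "(real \<times> real) set set" where
  "configs = {S. S \<subseteq> {0..1} \<times> UNIV \<and> (\<forall>c. finite {z \<in> S. snd z \<le> c})}"

definition point_count :: "(real \<times> real) set \<Rightarrow> (real \<times> real) set \<Rightarrow> ennreal" where
  "point_count A S = emeasure (count_space UNIV) (S \<inter> A)"

definition config_space :: "(real \<times> real) set measure" where
  "config_space = sigma configs
     {point_count A -` B \<inter> configs | A B. A \<in> sets borel \<and> B \<in> sets borel}"

definition is_ppp_law :: "(real \<times> real) measure \<Rightarrow> (real \<times> real) set measure \<Rightarrow> bool" where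
  "is_ppp_law \<mu> Q \<longleftrightarrow>
     prob_space Q \<and> sets Q = sets config_space \<and>
     (\<forall>A \<in> sets borel. emeasure \<mu> A < \<infinity> \<longrightarrow>
        (\<forall>k. measure Q {S \<in> space Q. point_count A S = of_nat k}
               = exp (- measure \<mu> A) * measure \<mu> A ^ k / fact k)) \<and>
     (\<forall>m (A :: nat \<Rightarrow> (real \<times> real) set).
        (\<forall>i<m. A i \<in> sets borel) \<and> disjoint_family_on A {..<m} \<longrightarrow>
        prob_space.indep_vars Q (\<lambda>_. borel) (\<lambda>i S. point_count (A i) S) {..<m})"

definition intensity :: "nat \<Rightarrow> (real \<Rightarrow> real) \<Rightarrow> (real \<times> real) measure" where
  "intensity n g = density lborel
     (\<lambda>z. of_nat n * indicator {(x, y). x \<in> {0..1} \<and> y \<ge> g x} z)"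

(* Curves on [0,1] are represented by functions on the reals; their values off [0,1] play no role
   here, in intensity or in Lp_norm. *)

definition hoelder_ball :: "real \<Rightarrow> real \<Rightarrow> (real \<Rightarrow> real) set" where
  "hoelder_ball \<beta> R =
     {g. \<forall>x\<in>{0..1}. \<forall>y\<in>{0..1}. \<bar>g x - g y\<bar> \<le> R * \<bar>x - y\<bar> powr \<beta>}"

definition Lp_norm :: "real \<Rightarrow> (real \<Rightarrow> real) \<Rightarrow> real" where
  "Lp_norm p g = (LINT x:{0..1}|lborel. \<bar>g x\<bar> powr p) powr (1 / p)"

(* P n g is the law of the observations (written with expectation E_g) at sample size n. *)

definition ppp_model ::
    "real \<Rightarrow> real \<Rightarrow> (nat \<Rightarrow> (real \<Rightarrow> real) \<Rightarrow> (real \<times> real) set measure) \<Rightarrow> bool" where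
  "ppp_model \<beta> R P \<longleftrightarrow>
     (\<forall>n\<ge>1. \<forall>g \<in> hoelder_ball \<beta> R. is_ppp_law (intensity n g) (P n g))"

(* On a nonempty configuration the infimum is attained, because only finitely many points lie
   below any level; the empty configuration has probability zero. *)

definition g_mle :: "real \<Rightarrow> real \<Rightarrow> (real \<times> real) set \<Rightarrow> real \<Rightarrow> real" where
  "g_mle \<beta> R S x = (INF z\<in>S. snd z + R * \<bar>x - fst z\<bar> powr \<beta>)"

(* The indicator in the sum over all points is rendered by restricting the index set, which is
   finite since g_mle is bounded on [0,1]. *)

definition F_hat :: "real \<Rightarrow> real \<Rightarrow> real \<Rightarrow> nat \<Rightarrow> (real \<times> real) set \<Rightarrow> real" where
  "F_hat \<beta> R p n S =
     (LINT x:{0..1}|lborel. \<bar>g_mle \<beta> R S x\<bar> powr p)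
     - 1 / real n * (\<Sum>z \<in> {z \<in> S. g_mle \<beta> R S (fst z) \<ge> snd z}.
                       p * \<bar>snd z\<bar> powr (p - 1) * sgn (snd z))"

definition T_hat :: "real \<Rightarrow> real \<Rightarrow> real \<Rightarrow> nat \<Rightarrow> (real \<times> real) set \<Rightarrow> real" where
  "T_hat \<beta> R p n S = (max (F_hat \<beta> R p n S) 0) powr (1 / p)"

(* The risk is an ennreal-valued integral, so that no integrability has to be presupposed. *)

definition max_risk ::
    "real \<Rightarrow> real \<Rightarrow> real \<Rightarrow> ((real \<Rightarrow> real) \<Rightarrow> (real \<times> real) set measure)
      \<Rightarrow> ((real \<times> real) set \<Rightarrow> real) \<Rightarrow> ennreal" where
  "max_risk \<beta> R p Pn T =
     (SUP g \<in> hoelder_ball \<beta> R. \<integral>\<^sup>+ S. ennreal \<bar>T S - Lp_norm p g\<bar> \<partial>Pn g)"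

definition minimax_risk ::
    "real \<Rightarrow> real \<Rightarrow> real \<Rightarrow> ((real \<Rightarrow> real) \<Rightarrow> (real \<times> real) set measure) \<Rightarrow> ennreal" where
  "minimax_risk \<beta> R p Pn =
     (INF T \<in> borel_measurable config_space. max_risk \<beta> R p Pn T)"

definition is_rate :: "(nat \<Rightarrow> ennreal) \<Rightarrow> (nat \<Rightarrow> real) \<Rightarrow> bool" where
  "is_rate \<rho> r \<longleftrightarrow>
     (\<exists>c>0. \<exists>C>0. \<forall>\<^sub>F n in sequentially. ennreal (c * r n) \<le> \<rho> n \<and> \<rho> n \<le> ennreal (C * r n))"

end

theory Submission
  imports Defs
begin

text \<open>
  Upper bound: the estimator lies above \<open>g\<close>, and a point of the process enters the sum in \<open>F_hat\<close>
  iff no other point dominates it.  By Mecke's formula the sum has the compensator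
  \<open>n * (\<integral>\<bar>g_mle\<bar> powr p - \<integral>\<bar>g\<bar> powr p)\<close>, and since two points never dominate each other mutually, the
  variance of the compensated sum is the expected integral of the squared summand.  With
  \<open>\<epsilon> = n powr (- \<beta> / (\<beta> + 1))\<close>, the order of \<open>g_mle - g\<close>, the mean square error of \<open>F_hat\<close> is therefore of
  order \<open>(\<epsilon> * \<integral>\<bar>g\<bar> powr (2 * p - 2) + \<epsilon> powr (2 * p - 1)) / n\<close>.  Taking the \<open>p\<close>-th root costs the claimed rate:
  the Hoelder condition forces a curve with a high peak to have a large norm.

  Lower bound: the zero curve is tested against a uniform mixture of curves with \<open>k\<close> bumps of height
  \<open>k powr (- 2 * \<beta>)\<close> in \<open>k\<close> of \<open>k\<^sup>2\<close> cells, where \<open>k\<close> is of order \<open>n powr (1 / (2 * (\<beta> + 1)))\<close>.  The law under a nonnegative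
  curve has the density \<open>exp (\<mu> B)\<close> on the event that the region \<open>B\<close> between the curves contains
  no points, so the second moment of the mixture likelihood ratio is an exponential moment of
  the overlap of two random selections of cells and stays bounded.
\<close>

section \<open>Measurability on the space of configurations\<close>

text \<open>The laws are not constructed; they are known only through Poisson counts and the
  independence of counts in disjoint sets. Mecke's formula and the likelihood ratio must both be
  recovered from finitely many disjoint counts, and this is why configurations are discretised into
  dyadic squares. The obstacle in the upper bound is that the variance contains
  \<open>\<bar>g\<bar> powr (2 * p - 2)\<close>, while the slope of the root is governed by the
  integral of \<open>\<bar>g\<bar> powr p\<close>. For \<open>p < 2\<close> the latter controls the
  former. For \<open>p \<ge> 2\<close> a tall narrow peak could produce a large variance at a small
  norm, and only the minimal width that the Hoelder condition forces on a peak excludes this. Near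
  norm 0 the root cannot be linearised, and its own Hoelder continuity takes over. In the lower
  bound the height is the largest one that the ball admits over cells of width
  \<open>1 / k\<^sup>2\<close>, up to constants, and \<open>n\<close> is matched so that one bump
  has mass of order one. Among \<open>k\<^sup>2\<close> cells, \<open>k\<close> is the largest order
  of selected cells for which two random selections have bounded expected overlap.\<close>

lemma space_config_space [simp]: "space config_space = configs"
  unfolding config_space_def by (rule space_measure_of) auto

lemma sets_config_space:
  "sets config_space = sigma_sets configs
     {point_count A -` B \<inter> configs | A B. A \<in> sets borel \<and> B \<in> sets borel}"
  unfolding config_space_def by (rule sets_measure_of) auto

lemma measurable_point_count [measurable]:
  assumes "A \<in> sets borel"
  shows "point_count A \<in> borel_measurable config_space"
proof (rule measurableI)
  fix B :: "ennreal set" assume "B \<in> sets borel"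
  with assms show "point_count A -` B \<inter> space config_space \<in> sets config_space"
    unfolding sets_config_space by (auto intro!: sigma_sets.Basic)
qed auto

lemma measurable_config_spaceI:
  assumes "\<And>x. x \<in> space M \<Longrightarrow> T x \<in> configs"
    and "\<And>A. A \<in> sets borel \<Longrightarrow> (\<lambda>x. point_count A (T x)) \<in> borel_measurable M"
  shows "T \<in> M \<rightarrow>\<^sub>M config_space"
  unfolding config_space_def
proof (rule measurable_measure_of)
  fix y assume "y \<in> {point_count A -` B \<inter> configs | A B. A \<in> sets borel \<and> B \<in> sets borel}"
  then obtain A B where y: "y = point_count A -` B \<inter> configs"
    and AB: "A \<in> sets borel" "B \<in> sets borel"
    by auto
  have "T -` y \<inter> space M = (\<lambda>x. point_count A (T x)) -` B \<inter> space M"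
    unfolding y using assms(1) by auto
  also have "\<dots> \<in> sets M" using assms(2)[OF AB(1)] AB(2) by measurable
  finally show "T -` y \<inter> space M \<in> sets M" .
qed (use assms(1) in auto)

lemma nn_integral_count_space_eq_point_count:
  "(\<integral>\<^sup>+z. indicator A z \<partial>count_space S) = point_count A S"
  unfolding point_count_def
  by (subst nn_integral_indicator') (auto simp: emeasure_count_space Int_commute)

lemma point_count_finite: "finite (S \<inter> A) \<Longrightarrow> point_count A S = of_nat (card (S \<inter> A))"
  unfolding point_count_def by (subst emeasure_count_space) auto

lemma configs_finite_Int: "S \<in> configs \<Longrightarrow> finite (S \<inter> (A \<inter> {z. snd z \<le> c}))"
  unfolding configs_def by (auto intro: finite_subset[rotated])

lemma ennreal_eq_minusI: "a + b = c \<Longrightarrow> b \<noteq> \<top> \<Longrightarrow> a = c - b" for a b c :: ennreal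
  by auto

text \<open>Truncation at the level \<open>c\<close> leaves finitely many points, so that the
  complement step of the induction over rectangles may subtract.\<close>

lemma borel_measurable_points_indicator:
  assumes T [measurable]: "T \<in> M \<rightarrow>\<^sub>M config_space"
    and E: "E \<in> sets (M \<Otimes>\<^sub>M (borel :: (real \<times> real) measure))"
  shows "(\<lambda>x. \<integral>\<^sup>+z. indicator E (x, z) * indicator {z. snd z \<le> c} z \<partial>count_space (T x))
           \<in> borel_measurable M"
    (is "?F E \<in> _")
proof -
  have C [measurable]: "{z :: real \<times> real. snd z \<le> c} \<in> sets borel"
    by (intro borel_closed closed_Collect_le continuous_intros)
  have conf: "T x \<in> configs" if "x \<in> space M" for x
    using measurable_space[OF T that] by simp
  have fin: "?F E x < \<infinity>" if "x \<in> space M" for x E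
  proof -
    have "?F E x \<le> (\<integral>\<^sup>+z. indicator {z. snd z \<le> c} z \<partial>count_space (T x))"
      by (intro nn_integral_mono) (auto simp: indicator_def)
    also have "\<dots> < \<infinity>"
      unfolding nn_integral_count_space_eq_point_count
      using configs_finite_Int[OF conf[OF that], of UNIV c] by (subst point_count_finite) (auto simp: of_nat_less_top)
    finally show ?thesis .
  qed
  have E': "E \<in> sigma_sets (space M \<times> space borel) {a \<times> b |a b. a \<in> sets M \<and> b \<in> sets borel}"
    using E by (simp add: sets_pair_measure)
  from Int_stable_pair_measure_generator[of M "borel :: (real \<times> real) measure"]
    pair_measure_closed[of M "borel :: (real \<times> real) measure"] E'
  show ?thesis
  proof (induction rule: sigma_sets_induct_disjoint)
    case (basic A)
    then obtain a b where A: "A = a \<times> b" and [measurable]: "a \<in> sets M" "b \<in> sets borel" by auto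
    have "?F A x = indicator a x * point_count (b \<inter> {z. snd z \<le> c}) (T x)" for x
      unfolding A nn_integral_count_space_eq_point_count[symmetric]
      by (subst nn_integral_cmult[symmetric]) (auto intro!: nn_integral_cong simp: indicator_def)
    then show ?case by simp
  next
    case empty
    then show ?case by simp
  next
    case (compl A)
    let ?U = "space M \<times> (UNIV :: (real \<times> real) set)"
    have "?F (?U - A) x = point_count {z. snd z \<le> c} (T x) - ?F A x" if "x \<in> space M" for x
    proof -
      have "?F (?U - A) x + ?F A x = point_count {z. snd z \<le> c} (T x)"
        unfolding nn_integral_count_space_eq_point_count[symmetric]
        using that by (subst nn_integral_add[symmetric])
          (auto intro!: nn_integral_cong simp: indicator_def)
      moreover have "?F A x \<noteq> \<top>" using fin[OF that, of A] by simp
      ultimately show ?thesis by (rule ennreal_eq_minusI)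
    qed
    then have "(?F (?U - A) \<in> borel_measurable M) \<longleftrightarrow>
        ((\<lambda>x. point_count {z. snd z \<le> c} (T x) - ?F A x) \<in> borel_measurable M)"
      by (intro measurable_cong) auto
    moreover have "(\<lambda>x. point_count {z. snd z \<le> c} (T x) - ?F A x) \<in> borel_measurable M"
      using compl by measurable
    ultimately show ?case by simp
  next
    case (union A)
    have "?F (\<Union>i. A i) x = (\<Sum>i. ?F (A i) x)" for x
    proof -
      have "indicator (\<Union>i. A i) (x, z) = (\<Sum>i. indicator (A i) (x, z) :: ennreal)" for z
        using union by (intro suminf_indicator[symmetric]) auto
      then show ?thesis
        by (subst nn_integral_suminf[symmetric]) auto
    qed
    then show ?case using union by simp
  qed
qed

text \<open>Functions are reached from indicators at a fixed truncation; the truncation is removed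
  last, as a supremum over integer levels.\<close>

lemma borel_measurable_points_nn_integral:
  fixes f :: "'a \<times> real \<times> real \<Rightarrow> ennreal"
  assumes T [measurable]: "T \<in> M \<rightarrow>\<^sub>M config_space"
    and f: "f \<in> borel_measurable (M \<Otimes>\<^sub>M borel)"
  shows "(\<lambda>x. \<integral>\<^sup>+z. f (x, z) \<partial>count_space (T x)) \<in> borel_measurable M"
proof -
  let ?C = "\<lambda>c. indicator {z :: real \<times> real. snd z \<le> c} :: _ \<Rightarrow> ennreal"
  have trunc: "(\<lambda>x. \<integral>\<^sup>+z. f (x, z) * ?C c z \<partial>count_space (T x)) \<in> borel_measurable M" for c
    using f
  proof (induction rule: borel_measurable_induct)
    case (cong f g)
    have "(\<integral>\<^sup>+z. f (x, z) * ?C c z \<partial>count_space (T x)) = (\<integral>\<^sup>+z. g (x, z) * ?C c z \<partial>count_space (T x))"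
      if "x \<in> space M" for x
      using cong(3) that by (intro nn_integral_cong) (auto simp: space_pair_measure)
    with cong show ?case by (simp cong: measurable_cong)
  next
    case (set A)
    then show ?case by (rule borel_measurable_points_indicator[OF T])
  next
    case (mult u d)
    then show ?case by (simp add: mult.assoc nn_integral_cmult)
  next
    case (add u v)
    then show ?case by (simp add: distrib_right nn_integral_add)
  next
    case (seq U)
    have "(\<integral>\<^sup>+z. (SUP i. U i) (x, z) * ?C c z \<partial>count_space (T x))
        = (SUP i. \<integral>\<^sup>+z. U i (x, z) * ?C c z \<partial>count_space (T x))" for x
      unfolding SUP_apply SUP_mult_right_ennreal
      using \<open>incseq U\<close> by (intro nn_integral_monotone_convergence_SUP)
        (auto simp: incseq_def le_fun_def intro!: mult_right_mono)
    then show ?case using seq by simp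
  qed
  have sup: "f (x, z) = (SUP i::nat. f (x, z) * ?C (real i) z)" for x z
  proof -
    obtain i :: nat where i: "snd z \<le> real i" using real_arch_simple by blast
    show ?thesis
    proof (rule antisym)
      show "f (x, z) \<le> (SUP i::nat. f (x, z) * ?C (real i) z)"
        using i by (intro SUP_upper2[of i]) (auto simp: indicator_def)
    qed (auto intro!: SUP_least simp: indicator_def)
  qed
  have "(\<integral>\<^sup>+z. f (x, z) \<partial>count_space (T x))
      = (SUP i::nat. \<integral>\<^sup>+z. f (x, z) * ?C (real i) z \<partial>count_space (T x))" for x
    by (subst sup, intro nn_integral_monotone_convergence_SUP)
      (auto simp: incseq_def le_fun_def indicator_def intro!: mult_left_mono)
  then show ?thesis using trunc by (simp only:) measurable
qed

text \<open>In Mecke's formula the integrand sees the configuration without the point at which it is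
  evaluated. Removal amounts to giving weight 0 to the diagonal, the zero set of the
  distance.\<close>

lemma measurable_remove_point [measurable]:
  "(\<lambda>x. snd x - {fst x}) \<in> borel \<Otimes>\<^sub>M config_space \<rightarrow>\<^sub>M config_space"
proof (rule measurable_config_spaceI)
  fix A :: "(real \<times> real) set" assume A [measurable]: "A \<in> sets borel"
  have "point_count A (snd x - {fst x}) = (\<integral>\<^sup>+z. indicator A z * (if z = fst x then 0 else 1) \<partial>count_space (snd x))" for x
    unfolding nn_integral_count_space_eq_point_count[symmetric]
    by (subst (1 2) nn_integral_count_space_indicator) (auto intro!: nn_integral_cong simp: indicator_def)
  moreover have "(\<lambda>x. \<integral>\<^sup>+z. (case (x, z) of (x, z) \<Rightarrow> indicator A z * (if z = fst x then 0 else 1))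
      \<partial>count_space (snd x)) \<in> borel_measurable (borel \<Otimes>\<^sub>M config_space)"
  proof (rule borel_measurable_points_nn_integral[OF measurable_snd])
    have "{x \<in> space ((borel \<Otimes>\<^sub>M config_space) \<Otimes>\<^sub>M borel). snd x = (fst (fst x) :: real \<times> real)}
        \<in> sets ((borel \<Otimes>\<^sub>M config_space) \<Otimes>\<^sub>M borel)"
      by (subst dist_eq_0_iff[symmetric]) measurable
    then show "(\<lambda>(x, z). indicator A z * (if z = fst x then 0 else 1 :: ennreal))
        \<in> borel_measurable ((borel \<Otimes>\<^sub>M config_space) \<Otimes>\<^sub>M (borel :: (real \<times> real) measure))"
      unfolding split_beta by - (intro borel_measurable_times_ennreal measurable_If, simp_all)
  qed
  ultimately show "(\<lambda>x. point_count A (snd x - {fst x})) \<in> borel_measurable (borel \<Otimes>\<^sub>M config_space)"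
    by (simp only: split)
next
  fix x :: "(real \<times> real) \<times> (real \<times> real) set" assume "x \<in> space (borel \<Otimes>\<^sub>M config_space)"
  then have "snd x \<in> configs" by (auto simp: space_pair_measure)
  then show "snd x - {fst x} \<in> configs" unfolding configs_def by (auto intro: finite_subset[rotated])
qed

section \<open>A tree of cells generating the configurations\<close>

definition dyad :: "nat \<Rightarrow> int \<times> int \<Rightarrow> (real \<times> real) set" where
  "dyad l c = {z. \<lfloor>2 ^ l * fst z\<rfloor> = fst c \<and> \<lfloor>2 ^ l * snd z\<rfloor> = snd c}"

text \<open>The window reaches from -2^l to 2^l in both coordinates. Being finite, it lets a cell
  prescribe only finitely many counts; growing with \<open>l\<close>, it exhausts the plane.\<close>

definition dyads :: "nat \<Rightarrow> (int \<times> int) set" where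
  "dyads l = {- (4 ^ l)..<4 ^ l} \<times> {- (4 ^ l)..<4 ^ l}"

text \<open>The cells of all levels form a tree under inclusion (two cells are nested or disjoint), so
  together with the empty set they are stable under intersection.\<close>

definition cell :: "nat \<Rightarrow> (int \<times> int \<Rightarrow> nat) \<Rightarrow> (real \<times> real) set set" where
  "cell l \<kappa> = {S \<in> configs. \<forall>c\<in>dyads l. point_count (dyad l c) S = of_nat (\<kappa> c)}"

lemma finite_dyads [simp, intro]: "finite (dyads l)"
  by (simp add: dyads_def)

lemma sets_dyad [measurable]: "dyad l c \<in> sets borel"
proof -
  have "{z \<in> space (borel \<Otimes>\<^sub>M borel). \<lfloor>2 ^ l * fst z :: real\<rfloor> = fst c \<and> \<lfloor>2 ^ l * snd z :: real\<rfloor> = snd c}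
      \<in> sets (borel \<Otimes>\<^sub>M borel)"
    by measurable
  then show ?thesis unfolding borel_prod[symmetric] dyad_def by (simp add: space_pair_measure)
qed

lemma disjoint_dyad: "disjoint_family_on (dyad l) C"
  unfolding disjoint_family_on_def dyad_def by (auto simp: prod_eq_iff)

lemma dyad_levels:
  assumes "z \<in> dyad (l + d) c'"
  shows "z \<in> dyad l c \<longleftrightarrow> c = (fst c' div 2 ^ d, snd c' div 2 ^ d)"
proof -
  have "\<lfloor>2 ^ l * x\<rfloor> = \<lfloor>2 ^ (l + d) * x\<rfloor> div 2 ^ d" for x :: real
    using floor_divide_real_eq_div[of "2 ^ d" "2 ^ (l + d) * x"] by (simp add: power_add)
  with assms show ?thesis unfolding dyad_def by (auto simp: prod_eq_iff)
qed

lemma dyad_nested: "dyad l c \<inter> dyad (l + d) c' \<in> {{}, dyad (l + d) c'}"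
  using dyad_levels[of _ l d c' c] by blast

lemma dyads_subdivide:
  assumes "c \<in> dyads l"
  shows "\<exists>C\<subseteq>dyads (l + d). dyad l c = (\<Union>c'\<in>C. dyad (l + d) c')"
proof (intro exI conjI)
  let ?C = "{c' \<in> dyads (l + d). c = (fst c' div 2 ^ d, snd c' div 2 ^ d)}"
  show "?C \<subseteq> dyads (l + d)" by auto
  show "dyad l c = (\<Union>c'\<in>?C. dyad (l + d) c')"
  proof (intro equalityI subsetI)
    fix z assume z: "z \<in> dyad l c"
    let ?c' = "(\<lfloor>2 ^ (l + d) * fst z\<rfloor>, \<lfloor>2 ^ (l + d) * snd z\<rfloor>)"
    have z': "z \<in> dyad (l + d) ?c'" by (simp add: dyad_def)
    from z have c: "c = (fst ?c' div 2 ^ d, snd ?c' div 2 ^ d)" unfolding dyad_levels[OF z'] .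
    \<comment> \<open>Descendants of indices below \<open>4 ^ l\<close> end at
      \<open>2 ^ d * 4 ^ l - 1\<close>, which the finer window admits because
      \<open>2 ^ d * 4 ^ l \<le> 4 ^ (l + d)\<close>.\<close>
    have bd: "- (4 ^ (l + d)) \<le> i \<and> i < 4 ^ (l + d)"
      if "- (4 ^ l) \<le> i div 2 ^ d" "i div 2 ^ d < 4 ^ l" for i :: int
    proof -
      have i: "i = 2 ^ d * (i div 2 ^ d) + i mod 2 ^ d" by simp
      have m: "0 \<le> i mod 2 ^ d" "i mod 2 ^ d < 2 ^ d" by simp_all
      have p: "(2::int) ^ d * 4 ^ l \<le> 4 ^ (l + d)"
        using power_mono[of "2::int" 4 d] by (simp add: power_add mult.commute)
      have "- (2 ^ d * 4 ^ l) \<le> 2 ^ d * (i div 2 ^ d)"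
        using mult_left_mono[OF that(1), of "2 ^ d"] by simp
      moreover have "2 ^ d * (i div 2 ^ d) \<le> 2 ^ d * 4 ^ l - 2 ^ d"
        using mult_left_mono[of "i div 2 ^ d" "4 ^ l - 1" "2 ^ d"] that(2) by (simp add: algebra_simps)
      ultimately show ?thesis using i m p by linarith
    qed
    from assms c have "?c' \<in> dyads (l + d)"
      using bd[of "fst ?c'"] bd[of "snd ?c'"] unfolding dyads_def by auto
    with c z' show "z \<in> (\<Union>c'\<in>?C. dyad (l + d) c')" by blast
  qed (use dyad_levels in blast)
qed

lemma finite_Int_dyad:
  assumes "S \<in> configs" shows "finite (S \<inter> dyad l c)"
proof (rule finite_subset)
  have "snd z \<le> (of_int (snd c) + 1) / 2 ^ l" if "z \<in> dyad l c" for z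
  proof -
    have "2 ^ l * snd z < of_int (snd c) + 1" using that unfolding dyad_def by auto linarith
    then show ?thesis by (simp add: field_simps)
  qed
  then show "S \<inter> dyad l c \<subseteq> S \<inter> (UNIV \<inter> {z. snd z \<le> (of_int (snd c) + 1) / 2 ^ l})" by auto
  show "finite (S \<inter> (UNIV \<inter> {z. snd z \<le> (of_int (snd c) + 1) / 2 ^ l}))"
    using configs_finite_Int[OF assms] .
qed

lemma point_count_UN:
  assumes "finite C" "disjoint_family_on A C"
  shows "point_count (\<Union>c\<in>C. A c) S = (\<Sum>c\<in>C. point_count (A c) S)"
  unfolding point_count_def Int_UN_distrib
  using assms by (intro sum_emeasure[symmetric]) (auto simp: disjoint_family_on_def)

text \<open>A coarse square of the window is a disjoint union of fine ones, so the fine counts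
  determine the coarse ones, and a coarse cell cannot separate two configurations of one fine
  cell.\<close>

lemma cell_nested: "cell l \<kappa> \<inter> cell (l + d) \<kappa>' \<in> {{}, cell (l + d) \<kappa>'}"
proof -
  have "S' \<in> cell l \<kappa>" if "S \<in> cell l \<kappa>" "S \<in> cell (l + d) \<kappa>'" "S' \<in> cell (l + d) \<kappa>'" for S S'
  proof -
    have "point_count (dyad l c) S' = point_count (dyad l c) S" if c: "c \<in> dyads l" for c
    proof -
      obtain C where C: "C \<subseteq> dyads (l + d)" "dyad l c = (\<Union>c'\<in>C. dyad (l + d) c')"
        using dyads_subdivide[OF c] by metis
      have "point_count (dyad l c) T = (\<Sum>c'\<in>C. of_nat (\<kappa>' c'))" if "T \<in> cell (l + d) \<kappa>'" for T
      proof -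
        have "point_count (dyad l c) T = (\<Sum>c'\<in>C. point_count (dyad (l + d) c') T)"
          unfolding C(2) using C(1)
          by (intro point_count_UN disjoint_dyad) (auto intro: finite_subset)
        also have "\<dots> = (\<Sum>c'\<in>C. of_nat (\<kappa>' c'))"
          using that C(1) by (intro sum.cong) (auto simp: cell_def)
        finally show ?thesis .
      qed
      then show ?thesis using \<open>S \<in> cell (l + d) \<kappa>'\<close> \<open>S' \<in> cell (l + d) \<kappa>'\<close> by simp
    qed
    then show ?thesis using that unfolding cell_def by auto
  qed
  then show ?thesis by blast
qed

lemma mem_cell:
  assumes "S \<in> configs"
  shows "\<exists>\<kappa> \<in> dyads l \<rightarrow>\<^sub>E UNIV. S \<in> cell l \<kappa>"
  using assms finite_Int_dyad[OF assms]
  by (intro bexI[of _ "\<lambda>c\<in>dyads l. card (S \<inter> dyad l c)"])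
    (auto simp: cell_def point_count_finite)

text \<open>Extensional functions fix the values off the finite window; this keeps the number of
  cells per level countable.\<close>

lemma countable_cell_index: "countable (dyads l \<rightarrow>\<^sub>E (UNIV :: nat set))"
  by (intro countable_PiE) auto

lemma sets_cell [measurable]: "cell l \<kappa> \<in> sets config_space"
proof -
  have "cell l \<kappa> = {S \<in> space config_space. \<forall>c\<in>dyads l. point_count (dyad l c) S = of_nat (\<kappa> c)}"
    by (simp add: cell_def)
  also have "\<dots> \<in> sets config_space" by measurable
  finally show ?thesis .
qed

lemma dyads_mono: "l \<le> l' \<Longrightarrow> z \<in> dyad l c \<Longrightarrow> c \<in> dyads l \<Longrightarrow> \<exists>c'\<in>dyads l'. z \<in> dyad l' c'"
  using dyads_subdivide[of c l "l' - l"] by (simp add: subset_eq) blast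

lemma mem_dyads: "\<forall>\<^sub>F l in sequentially. \<exists>c\<in>dyads l. z \<in> dyad l c"
proof -
  obtain l :: nat where l: "\<bar>fst z\<bar> + \<bar>snd z\<bar> < 2 ^ l"
    using real_arch_pow[of 2] by auto
  have bd: "\<lfloor>2 ^ l * x\<rfloor> \<in> {- (4 ^ l)..<4 ^ l}" if "\<bar>x\<bar> < 2 ^ l" for x :: real
  proof -
    have eq: "(4::real) ^ l = 2 ^ l * 2 ^ l" by (simp add: power_mult_distrib[symmetric])
    have "\<bar>2 ^ l * x\<bar> < 4 ^ l" unfolding eq abs_mult using that by simp
    then show ?thesis by (auto simp: le_floor_iff floor_less_iff)
  qed
  have "(\<lfloor>2 ^ l * fst z\<rfloor>, \<lfloor>2 ^ l * snd z\<rfloor>) \<in> dyads l"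
    unfolding dyads_def using bd[of "fst z"] bd[of "snd z"] l by auto
  moreover have "z \<in> dyad l (\<lfloor>2 ^ l * fst z\<rfloor>, \<lfloor>2 ^ l * snd z\<rfloor>)" by (simp add: dyad_def)
  ultimately show ?thesis
    unfolding eventually_sequentially using dyads_mono by blast
qed

text \<open>An open set is the countable union of the squares inside it: around each of its points
  such a square exists once the side is small and the window has reached the point. The empty set is
  added because disjoint squares intersect in it.\<close>

lemma sets_borel_eq_dyads:
  "sets (borel :: (real \<times> real) measure) = sigma_sets UNIV ({{}} \<union> (\<Union>l. dyad l ` dyads l))"
    (is "_ = sigma_sets UNIV ?G")
proof -
  have "U \<in> sigma_sets UNIV ?G" if U: "open U" for U :: "(real \<times> real) set"
  proof -
    let ?I = "{(l, c). c \<in> dyads l \<and> dyad l c \<subseteq> U}"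
    have "U \<subseteq> (\<Union>(l, c)\<in>?I. dyad l c)"
    proof
      fix z assume "z \<in> U"
      with U obtain e where e: "e > 0" "ball z e \<subseteq> U" using open_contains_ball by blast
      have "(\<lambda>l. 2 / 2 ^ l :: real) \<longlonglongrightarrow> 0" by (rule LIMSEQ_divide_realpow_zero) simp
      then have "\<forall>\<^sub>F l in sequentially. 2 / 2 ^ l < e" using e by (simp add: order_tendstoD(2))
      from eventually_conj[OF this mem_dyads[of z]] obtain l c
        where l: "2 / 2 ^ l < e" and c: "c \<in> dyads l" "z \<in> dyad l c"
        unfolding eventually_sequentially by auto
      have "w \<in> ball z e" if "w \<in> dyad l c" for w
      proof -
        have 1: "\<bar>a - b\<bar> < 1 / 2 ^ l" if "\<lfloor>2 ^ l * a\<rfloor> = \<lfloor>2 ^ l * b\<rfloor>" for a b :: real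
        proof -
          have "\<bar>2 ^ l * a - 2 ^ l * b\<bar> < 1" using that by linarith
          then have "2 ^ l * \<bar>a - b\<bar> < 1" by (simp flip: right_diff_distrib add: abs_mult)
          then show ?thesis by (simp add: field_simps)
        qed
        have "dist z w \<le> dist (fst z) (fst w) + dist (snd z) (snd w)"
          unfolding dist_prod_def by (rule sqrt_sum_squares_le_sum) auto
        also have "\<dots> < 2 / 2 ^ l"
          using 1[of "fst z" "fst w"] 1[of "snd z" "snd w"] that c(2)
          by (auto simp: dyad_def dist_real_def)
        finally show ?thesis using l by simp
      qed
      with e c show "z \<in> (\<Union>(l, c)\<in>?I. dyad l c)" by blast
    qed
    then have "U = (\<Union>(l, c)\<in>?I. dyad l c)" by auto
    also have "\<dots> \<in> sets (sigma UNIV ?G)"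
    proof (rule sets.countable_UN'')
      show "countable ?I" by (rule countable_subset[of _ UNIV]) auto
      fix i assume "i \<in> ?I"
      then show "(case i of (l, c) \<Rightarrow> dyad l c) \<in> sets (sigma UNIV ?G)"
        by (auto intro!: sigma_sets.Basic)
    qed
    finally show ?thesis by simp
  qed
  then have "sigma_sets UNIV {S :: (real \<times> real) set. open S} = sigma_sets UNIV ?G"
  proof (intro sigma_sets_eqI)
    fix b assume "b \<in> ?G"
    then have "b \<in> sets borel" by auto
    then show "b \<in> sigma_sets UNIV {S :: (real \<times> real) set. open S}" by (simp add: sets_borel)
  qed auto
  then show ?thesis by (simp add: sets_borel)
qed

lemma Int_stable_treeI:
  assumes "\<And>a b. a \<in> G \<Longrightarrow> b \<in> G \<Longrightarrow> a \<inter> b \<in> {{}, a, b}"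
  shows "Int_stable ({{}} \<union> G)"
  unfolding Int_stable_def
proof (intro ballI)
  fix a b assume ab: "a \<in> {{}} \<union> G" "b \<in> {{}} \<union> G"
  show "a \<inter> b \<in> {{}} \<union> G"
  proof (cases "a = {} \<or> b = {}")
    case False
    with ab have *: "a \<in> G" "b \<in> G" by auto
    from assms[OF *] * show ?thesis by (elim insertE) auto
  qed auto
qed

text \<open>Inclusion of sigma-algebras becomes measurability of the identity, so that criteria for
  maps into \<open>config_space\<close> can be applied to generators.\<close>

lemma sets_subset_of_measurable_id:
  assumes "(\<lambda>x. x) \<in> M \<rightarrow>\<^sub>M N" "space M = space N"
  shows "sets N \<subseteq> sets M"
proof
  fix X assume X: "X \<in> sets N"
  then have "(\<lambda>x. x) -` X \<inter> space M = X" using sets.sets_into_space[OF X] assms(2) by auto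
  then show "X \<in> sets M" using measurable_sets[OF assms(1) X] by simp
qed

lemma Int_stable_dyads: "Int_stable ({{}} \<union> (\<Union>l. dyad l ` dyads l))"
proof (rule Int_stable_treeI)
  have "dyad l c \<inter> dyad l' c' \<in> {{}, dyad l c, dyad l' c'}" for l l' c c'
    using dyad_nested[of l c "l' - l" c'] dyad_nested[of l' c' "l - l'" c]
    by (cases "l \<le> l'") auto
  then show "a \<inter> b \<in> {{}, a, b}" if "a \<in> (\<Union>l. dyad l ` dyads l)" "b \<in> (\<Union>l. dyad l ` dyads l)" for a b
    using that by (elim UN_E imageE) (simp only:)
qed

text \<open>Within a single square all counts are finite, so the induction over Borel sets can
  subtract for complements. The general count is then a finite sum over the window, followed by a
  supremum over the windows.\<close>

lemma measurable_config_spaceI_dyads: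
  assumes T: "\<And>x. x \<in> space M \<Longrightarrow> T x \<in> configs"
    and meas [measurable]: "\<And>l c. c \<in> dyads l \<Longrightarrow> (\<lambda>x. point_count (dyad l c) (T x)) \<in> borel_measurable M"
  shows "T \<in> M \<rightarrow>\<^sub>M config_space"
proof (rule measurable_config_spaceI[OF T])
  fix A :: "(real \<times> real) set" assume A: "A \<in> sets borel"
  have fin: "point_count (A \<inter> dyad l c) (T x) \<noteq> \<top>" if "x \<in> space M" for A l c x
  proof -
    have "finite (T x \<inter> (A \<inter> dyad l c))"
      by (rule finite_subset[OF _ finite_Int_dyad[OF T[OF that], of l c]]) auto
    then show ?thesis by (simp add: point_count_finite)
  qed
  have loc: "(\<lambda>x. point_count (A \<inter> dyad l c) (T x)) \<in> borel_measurable M" if c: "c \<in> dyads l" for l c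
    using Int_stable_dyads subset_UNIV[of "{{}} \<union> (\<Union>l. dyad l ` dyads l)", folded Pow_UNIV] A[unfolded sets_borel_eq_dyads]
  proof (induction rule: sigma_sets_induct_disjoint)
    case (basic A)
    show ?case
    proof (cases "A = {}")
      case False
      with basic obtain l' c' where A: "A = dyad l' c'" and c': "c' \<in> dyads l'" by auto
      have "A \<inter> dyad l c \<in> {{}, dyad l c, dyad l' c'}"
        unfolding A using dyad_nested[of l c "l' - l" c'] dyad_nested[of l' c' "l - l'" c]
        by (cases "l \<le> l'") auto
      then show ?thesis using meas[OF c] meas[OF c'] by (auto simp: point_count_def)
    qed (simp add: point_count_def)
  next
    case empty
    then show ?case by (simp add: point_count_def)
  next
    case (compl A)
    have "point_count ((UNIV - A) \<inter> dyad l c) (T x)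
        = point_count (dyad l c) (T x) - point_count (A \<inter> dyad l c) (T x)" if "x \<in> space M" for x
    proof (rule ennreal_eq_minusI[OF _ fin[OF that]])
      have "T x \<inter> dyad l c = (T x \<inter> ((UNIV - A) \<inter> dyad l c)) \<union> (T x \<inter> (A \<inter> dyad l c))" by auto
      then show "point_count ((UNIV - A) \<inter> dyad l c) (T x) + point_count (A \<inter> dyad l c) (T x)
        = point_count (dyad l c) (T x)"
        unfolding point_count_def by (simp only:) (intro plus_emeasure, auto)
    qed
    moreover have "(\<lambda>x. point_count (dyad l c) (T x) - point_count (A \<inter> dyad l c) (T x)) \<in> borel_measurable M"
      using compl meas[OF c] by measurable
    ultimately show ?case by (subst measurable_cong) auto
  next
    case (union A)
    have "point_count ((\<Union>i. A i) \<inter> dyad l c) (T x) = (\<Sum>i. point_count (A i \<inter> dyad l c) (T x))" for x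
    proof -
      have "T x \<inter> ((\<Union>i. A i) \<inter> dyad l c) = (\<Union>i. T x \<inter> (A i \<inter> dyad l c))" by auto
      then show ?thesis unfolding point_count_def
        using union(1) by (simp only:) (intro suminf_emeasure[symmetric], auto simp: disjoint_family_on_def)
    qed
    then show ?case using union by simp
  qed
  have sum: "(\<lambda>x. point_count (\<Union>c\<in>dyads l. A \<inter> dyad l c) (T x)) \<in> borel_measurable M" for l
  proof -
    have "point_count (\<Union>c\<in>dyads l. A \<inter> dyad l c) (T x) = (\<Sum>c\<in>dyads l. point_count (A \<inter> dyad l c) (T x))" for x
      by (intro point_count_UN) (auto simp: disjoint_family_on_def dyad_def)
    then show ?thesis using loc by simp
  qed
  have "point_count A (T x) = (SUP l. point_count (\<Union>c\<in>dyads l. A \<inter> dyad l c) (T x))" for x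
  proof -
    have "T x \<inter> A = (\<Union>l. T x \<inter> (\<Union>c\<in>dyads l. A \<inter> dyad l c))"
      using eventually_happens[OF mem_dyads] by fastforce
    then have "emeasure (count_space UNIV) (T x \<inter> A)
        = emeasure (count_space UNIV) (\<Union>l. T x \<inter> (\<Union>c\<in>dyads l. A \<inter> dyad l c))" by simp
    also have "\<dots> = (SUP l. emeasure (count_space UNIV) (T x \<inter> (\<Union>c\<in>dyads l. A \<inter> dyad l c)))"
    proof (rule SUP_emeasure_incseq[symmetric])
      show "incseq (\<lambda>l. T x \<inter> (\<Union>c\<in>dyads l. A \<inter> dyad l c))"
        unfolding incseq_def using dyads_mono by blast
    qed auto
    finally show ?thesis unfolding point_count_def .
  qed
  then show "(\<lambda>x. point_count A (T x)) \<in> borel_measurable M" using sum by simp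
qed

definition cells :: "(real \<times> real) set set set" where
  "cells = {{}} \<union> (\<Union>l. range (cell l))"

text \<open>The count in a square of the window is constant on each cell of that level, so its
  preimages are countable unions of cells.\<close>

lemma sets_config_space_eq_cells: "sets config_space = sigma_sets configs cells"
proof
  have P: "cells \<subseteq> Pow configs" unfolding cells_def cell_def by auto
  have "(\<lambda>S. S) \<in> sigma configs cells \<rightarrow>\<^sub>M config_space"
  proof (rule measurable_config_spaceI_dyads)
    fix l c assume c: "c \<in> dyads l"
    have [measurable]: "cell l \<kappa> \<in> sets (sigma configs cells)" for \<kappa>
      using P by (auto simp: cells_def)
    show "point_count (dyad l c) \<in> borel_measurable (sigma configs cells)"
    proof (rule measurableI)
      fix B :: "ennreal set"
      have "S \<in> (\<Union>\<kappa>\<in>{\<kappa> \<in> dyads l \<rightarrow>\<^sub>E UNIV. of_nat (\<kappa> c) \<in> B}. cell l \<kappa>)"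
        if "S \<in> configs" "point_count (dyad l c) S \<in> B" for S
        using mem_cell[OF that(1), of l] that(2) c by (auto simp: cell_def)
      then have "point_count (dyad l c) -` B \<inter> space (sigma configs cells)
          = (\<Union>\<kappa>\<in>{\<kappa> \<in> dyads l \<rightarrow>\<^sub>E UNIV. of_nat (\<kappa> c) \<in> B}. cell l \<kappa>)"
        using P c by (auto simp: space_measure_of cell_def)
      also have "\<dots> \<in> sets (sigma configs cells)"
        using countable_cell_index[of l] by (intro sets.countable_UN'') (auto intro: countable_subset)
      finally show "point_count (dyad l c) -` B \<inter> space (sigma configs cells) \<in> sets (sigma configs cells)" .
    qed auto
  qed (use P in \<open>simp add: space_measure_of\<close>)
  from sets_subset_of_measurable_id[OF this] P
  show "sets config_space \<subseteq> sigma_sets configs cells" by (simp add: space_measure_of)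
  have "cells \<subseteq> sets config_space" by (auto simp: cells_def)
  from sets.sigma_sets_subset[OF this]
  show "sigma_sets configs cells \<subseteq> sets config_space" by simp
qed

lemma Int_stable_cells: "Int_stable cells"
  unfolding cells_def
proof (rule Int_stable_treeI)
  have "cell l \<kappa> \<inter> cell l' \<kappa>' \<in> {{}, cell l \<kappa>, cell l' \<kappa>'}" for l l' \<kappa> \<kappa>'
    using cell_nested[of l \<kappa> "l' - l" \<kappa>'] cell_nested[of l' \<kappa>' "l - l'" \<kappa>]
    by (cases "l \<le> l'") auto
  then show "a \<inter> b \<in> {{}, a, b}" if "a \<in> (\<Union>l. range (cell l))" "b \<in> (\<Union>l. range (cell l))" for a b
    using that by (elim UN_E rangeE) (simp only:)
qed

text \<open>The cells are stable under intersection, hence the joint counts on each level determine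
  a law of configurations.\<close>

lemma config_measure_eqI:
  assumes Q: "sets Q = sets config_space" "sets Q' = sets config_space" "finite_measure Q"
    and eq: "\<And>l \<kappa>. emeasure Q (cell l \<kappa>) = emeasure Q' (cell l \<kappa>)"
  shows "Q = Q'"
proof (rule measure_eqI_generator_eq_countable[OF Int_stable_cells])
  show "cells \<subseteq> Pow configs" unfolding cells_def cell_def by auto
  show "emeasure Q X = emeasure Q' X" if "X \<in> cells" for X
    using that eq by (auto simp: cells_def)
  show "sets Q = sigma_sets configs cells" "sets Q' = sigma_sets configs cells"
    using Q sets_config_space_eq_cells by auto
  \<comment> \<open>Level 0 alone already covers all configurations by countably many cells.\<close>
  let ?A = "cell 0 ` (dyads 0 \<rightarrow>\<^sub>E UNIV)"
  show "?A \<subseteq> cells" by (auto simp: cells_def)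
  show "\<Union>?A = configs" using mem_cell by (auto simp: cell_def)
  show "countable ?A" using countable_cell_index by auto
  show "emeasure Q a \<noteq> \<infinity>" for a using Q(3) by (simp add: finite_measure.emeasure_eq_measure)
qed

text \<open>Point and configuration are discretised at the same level. This keeps the family a tree,
  and deleting a point of the square then changes exactly one of the prescribed counts.\<close>

definition marked_cells :: "((real \<times> real) \<times> (real \<times> real) set) set set" where
  "marked_cells = {{}} \<union> {dyad l c \<times> cell l \<kappa> | l c \<kappa>. c \<in> dyads l}"

lemma marked_cells_subset: "marked_cells \<subseteq> Pow (UNIV \<times> configs)"
  unfolding marked_cells_def cell_def by auto

lemma Int_stable_marked_cells: "Int_stable marked_cells"
  unfolding marked_cells_def
proof (rule Int_stable_treeI)
  have *: "(dyad l c \<times> cell l \<kappa>) \<inter> (dyad l' c' \<times> cell l' \<kappa>') \<in> {{}, dyad l' c' \<times> cell l' \<kappa>'}" if "l \<le> l'"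
    for l l' c c' \<kappa> \<kappa>'
    using that dyad_nested[of l c "l' - l" c'] cell_nested[of l \<kappa> "l' - l" \<kappa>']
    by (auto simp: Times_Int_Times)
  have "(dyad l c \<times> cell l \<kappa>) \<inter> (dyad l' c' \<times> cell l' \<kappa>')
      \<in> {{}, dyad l c \<times> cell l \<kappa>, dyad l' c' \<times> cell l' \<kappa>'}" for l l' c c' \<kappa> \<kappa>'
  proof (cases "l \<le> l'")
    case True
    from *[OF this, of c \<kappa> c' \<kappa>'] show ?thesis by blast
  next
    case False
    then have "l' \<le> l" by simp
    from *[OF this, of c' \<kappa>' c \<kappa>] show ?thesis by (subst Int_commute) blast
  qed
  then show "a \<inter> b \<in> {{}, a, b}" if "a \<in> {dyad l c \<times> cell l \<kappa> | l c \<kappa>. c \<in> dyads l}"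
    "b \<in> {dyad l c \<times> cell l \<kappa> | l c \<kappa>. c \<in> dyads l}" for a b
    using that by (elim CollectE exE conjE) (simp only:)
qed

lemma countable_marked_index:
  "countable (Sigma UNIV (\<lambda>l. dyads l \<times> (dyads l \<rightarrow>\<^sub>E (UNIV :: nat set))))"
  using countable_cell_index by (intro countable_SIGMA) (auto intro: countable_finite)

lemma marked_cells_cover:
  "UNIV \<times> configs = (\<Union>(l, c, \<kappa>)\<in>Sigma UNIV (\<lambda>l. dyads l \<times> (dyads l \<rightarrow>\<^sub>E UNIV)). dyad l c \<times> cell l \<kappa>)"
proof (intro equalityI subsetI)
  fix x :: "(real \<times> real) \<times> (real \<times> real) set" assume "x \<in> UNIV \<times> configs"
  then have S: "snd x \<in> configs" by auto
  obtain l c where "c \<in> dyads l" "fst x \<in> dyad l c"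
    using eventually_happens[OF mem_dyads[of "fst x"]] by auto
  moreover obtain \<kappa> where "\<kappa> \<in> dyads l \<rightarrow>\<^sub>E UNIV" "snd x \<in> cell l \<kappa>" using mem_cell[OF S] by blast
  ultimately have "(l, c, \<kappa>) \<in> Sigma UNIV (\<lambda>l. dyads l \<times> (dyads l \<rightarrow>\<^sub>E UNIV))" "x \<in> dyad l c \<times> cell l \<kappa>"
    by (auto simp: mem_Times_iff)
  then show "x \<in> (\<Union>(l, c, \<kappa>)\<in>Sigma UNIV (\<lambda>l. dyads l \<times> (dyads l \<rightarrow>\<^sub>E UNIV)). dyad l c \<times> cell l \<kappa>)"
    by blast
qed (auto simp: cell_def)

text \<open>A set that restricts only one of the two coordinates is a countable union of marked
  cells. For a restriction on the configuration one passes to finer levels until the window contains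
  the point.\<close>

lemma sets_marked_config_space:
  "sets (borel \<Otimes>\<^sub>M config_space) = sigma_sets (UNIV \<times> configs) marked_cells"
proof
  let ?M = "sigma (UNIV \<times> configs) marked_cells"
  note P = marked_cells_subset
  have [measurable]: "dyad l c \<times> cell l \<kappa> \<in> sets ?M" if "c \<in> dyads l" for l c \<kappa>
  proof -
    have "dyad l c \<times> cell l \<kappa> \<in> marked_cells" unfolding marked_cells_def using that by blast
    with P show ?thesis by (simp add: sigma_sets.Basic)
  qed
  have sp [simp]: "space ?M = UNIV \<times> configs" using P by (simp add: space_measure_of)
  have fst_meas [measurable]: "fst \<in> ?M \<rightarrow>\<^sub>M borel"
  proof (rule measurable_sigma_sets[OF sets_borel_eq_dyads])
    fix y :: "(real \<times> real) set" assume "y \<in> {{}} \<union> (\<Union>l. dyad l ` dyads l)"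
    then consider "y = {}" | l c where "c \<in> dyads l" "y = dyad l c" by auto
    then show "fst -` y \<inter> space ?M \<in> sets ?M"
    proof cases
      case (2 l c)
      have "fst -` y \<inter> space ?M = (\<Union>\<kappa>\<in>dyads l \<rightarrow>\<^sub>E UNIV. dyad l c \<times> cell l \<kappa>)"
        using mem_cell[of _ l] unfolding 2 by (auto simp: cell_def)
      also have "\<dots> \<in> sets ?M"
        using 2 countable_cell_index by (intro sets.countable_UN'') auto
      finally show ?thesis .
    qed simp
  qed auto
  have snd_meas [measurable]: "snd \<in> ?M \<rightarrow>\<^sub>M config_space"
  proof (rule measurable_sigma_sets[OF sets_config_space_eq_cells])
    show "cells \<subseteq> Pow configs" unfolding cells_def cell_def by auto
    fix y assume "y \<in> cells"
    then consider "y = {}" | l0 \<kappa>0 where "y = cell l0 \<kappa>0" by (auto simp: cells_def)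
    then show "snd -` y \<inter> space ?M \<in> sets ?M"
    proof cases
      case (2 l0 \<kappa>0)
      let ?I = "{(l, c, \<kappa>) \<in> Sigma UNIV (\<lambda>l. dyads l \<times> (dyads l \<rightarrow>\<^sub>E UNIV)). cell l \<kappa> \<subseteq> y}"
      have "snd -` y \<inter> space ?M = (\<Union>(l, c, \<kappa>)\<in>?I. dyad l c \<times> cell l \<kappa>)"
      proof (intro equalityI subsetI)
        fix x assume "x \<in> snd -` y \<inter> space ?M"
        then have S: "snd x \<in> configs" "snd x \<in> cell l0 \<kappa>0" using 2 by auto
        obtain l c where l: "c \<in> dyads l" "fst x \<in> dyad l c" "l0 \<le> l"
          using eventually_happens[OF eventually_conj[OF mem_dyads[of "fst x"] eventually_ge_at_top[of l0]]]
          by auto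
        obtain \<kappa> where \<kappa>: "\<kappa> \<in> dyads l \<rightarrow>\<^sub>E UNIV" "snd x \<in> cell l \<kappa>" using mem_cell[OF S(1)] by blast
        have "cell l \<kappa> \<subseteq> y"
          using cell_nested[of l0 \<kappa>0 "l - l0" \<kappa>] S \<kappa> l unfolding 2 by auto
        with l \<kappa> have "(l, c, \<kappa>) \<in> ?I" "x \<in> dyad l c \<times> cell l \<kappa>" by (auto simp: mem_Times_iff)
        then show "x \<in> (\<Union>(l, c, \<kappa>)\<in>?I. dyad l c \<times> cell l \<kappa>)" by blast
      qed (auto simp: cell_def)
      also have "\<dots> \<in> sets ?M"
      proof (rule sets.countable_UN'')
        show "countable ?I" by (rule countable_subset[OF _ countable_marked_index]) auto
      qed auto
      finally show ?thesis .
    qed simp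
  qed auto
  have "(\<lambda>x. x) \<in> ?M \<rightarrow>\<^sub>M borel \<Otimes>\<^sub>M config_space"
    using measurable_Pair[OF fst_meas snd_meas] by simp
  from sets_subset_of_measurable_id[OF this] P
  show "sets (borel \<Otimes>\<^sub>M config_space) \<subseteq> sigma_sets (UNIV \<times> configs) marked_cells"
    by (simp add: space_pair_measure)
  have "dyad l c \<times> cell l \<kappa> \<in> sets (borel \<Otimes>\<^sub>M config_space)" for l c \<kappa>
    by (intro pair_measureI sets_dyad sets_cell)
  then have "marked_cells \<subseteq> sets (borel \<Otimes>\<^sub>M config_space)"
    unfolding marked_cells_def by blast
  from sets.sigma_sets_subset[OF this]
  show "sigma_sets (UNIV \<times> configs) marked_cells \<subseteq> sets (borel \<Otimes>\<^sub>M config_space)"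
    by (simp add: space_pair_measure)
qed

section \<open>Mecke's formula\<close>

lemma is_ppp_lawD:
  assumes "is_ppp_law \<mu> Q"
  shows "prob_space Q" "sets Q = sets config_space" "space Q = configs"
  using assms sets_eq_imp_space_eq[of Q config_space] unfolding is_ppp_law_def by auto

definition poisson_mass :: "real \<Rightarrow> nat \<Rightarrow> real" where
  "poisson_mass m k = exp (- m) * m ^ k / fact k"

text \<open>The independence clause of \<open>is_ppp_law\<close> speaks of initial segments of the
  naturals; an enumeration of \<open>J\<close> transports it to any finite index set. The empty
  \<open>J\<close> is separate because the product rule for independent variables asks for a
  nonempty one.\<close>

lemma ppp_law_product:
  assumes law: "is_ppp_law \<mu> Q" and J: "finite J"
    and A: "\<And>j. j \<in> J \<Longrightarrow> A j \<in> sets borel" "\<And>j. j \<in> J \<Longrightarrow> emeasure \<mu> (A j) < \<infinity>"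
    and disj: "disjoint_family_on A J"
  shows "measure Q {S \<in> configs. \<forall>j\<in>J. point_count (A j) S = of_nat (\<kappa> j)}
    = (\<Prod>j\<in>J. poisson_mass (measure \<mu> (A j)) (\<kappa> j))"
proof -
  interpret prob_space Q using is_ppp_lawD(1)[OF law] .
  note sp = is_ppp_lawD(3)[OF law]
  show ?thesis
  proof (cases "J = {}")
    case True
    then show ?thesis using prob_space sp by simp
  next
    case False
    define m where "m = card J"
    obtain h where h: "bij_betw h {..<m} J"
      using ex_bij_betw_nat_finite[OF J] unfolding m_def lessThan_atLeast0 by auto
    have m: "{..<m} \<noteq> {}" using False J unfolding m_def by (simp add: card_gt_0_iff lessThan_empty_iff)
    have hJ: "h i \<in> J" if "i < m" for i using h that by (auto simp: bij_betw_def)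
    have "disjoint_family_on (A \<circ> h) {..<m}"
      using disj hJ inj_onD[OF bij_betw_imp_inj_on[OF h]] unfolding disjoint_family_on_def by auto blast
    moreover have "\<forall>i<m. (A \<circ> h) i \<in> sets borel" using A(1) hJ by simp
    moreover have "\<forall>m (A :: nat \<Rightarrow> (real \<times> real) set). (\<forall>i<m. A i \<in> sets borel) \<and> disjoint_family_on A {..<m} \<longrightarrow>
        indep_vars (\<lambda>_. borel) (\<lambda>i S. point_count (A i) S) {..<m}"
      using law unfolding is_ppp_law_def by blast
    ultimately have ind: "indep_vars (\<lambda>_. borel) (\<lambda>i S. point_count ((A \<circ> h) i) S) {..<m}"
      by blast
    have "{S \<in> configs. \<forall>j\<in>J. point_count (A j) S = of_nat (\<kappa> j)}
        = (\<Inter>i\<in>{..<m}. point_count ((A \<circ> h) i) -` {of_nat (\<kappa> (h i))} \<inter> space Q)"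
      using m h unfolding sp bij_betw_def by auto
    then have "prob {S \<in> configs. \<forall>j\<in>J. point_count (A j) S = of_nat (\<kappa> j)}
        = (\<Prod>i<m. prob (point_count ((A \<circ> h) i) -` {of_nat (\<kappa> (h i))} \<inter> space Q))"
      using indep_varsD_finite[OF ind m] by simp
    also have "\<dots> = (\<Prod>i<m. poisson_mass (measure \<mu> (A (h i))) (\<kappa> (h i)))"
    proof (rule prod.cong)
      fix i assume "i \<in> {..<m}"
      then have "h i \<in> J" using hJ by auto
      then have "prob {S \<in> space Q. point_count (A (h i)) S = of_nat (\<kappa> (h i))}
          = poisson_mass (measure \<mu> (A (h i))) (\<kappa> (h i))"
        using law A unfolding is_ppp_law_def poisson_mass_def by blast
      moreover have "point_count ((A \<circ> h) i) -` {of_nat (\<kappa> (h i))} \<inter> space Q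
          = {S \<in> space Q. point_count (A (h i)) S = of_nat (\<kappa> (h i))}" by auto
      ultimately show "prob (point_count ((A \<circ> h) i) -` {of_nat (\<kappa> (h i))} \<inter> space Q)
          = poisson_mass (measure \<mu> (A (h i))) (\<kappa> (h i))" by simp
    qed simp
    also have "\<dots> = (\<Prod>j\<in>J. poisson_mass (measure \<mu> (A j)) (\<kappa> j))"
      using prod.reindex_bij_betw[OF h] .
    finally show ?thesis .
  qed
qed

lemma ppp_law_cell:
  assumes law: "is_ppp_law \<mu> Q" and fin: "\<And>l c. emeasure \<mu> (dyad l c) < \<infinity>"
  shows "emeasure Q (cell l \<kappa>) = ennreal (\<Prod>c\<in>dyads l. poisson_mass (measure \<mu> (dyad l c)) (\<kappa> c))"
proof -
  interpret prob_space Q using is_ppp_lawD(1)[OF law] .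
  show ?thesis
    unfolding emeasure_eq_measure cell_def
    using ppp_law_product[OF law finite_dyads[of l] sets_dyad fin disjoint_dyad] by simp
qed

text \<open>Deleting a point of the square \<open>c\<close> lowers the count there by one and leaves
  the others. So the terms are nonzero only if \<open>S\<close> has one point too many in that
  square, and then each of its \<open>\<kappa> c + 1\<close> points contributes 1.\<close>

lemma points_removed_cell:
  assumes S: "S \<in> configs" and c: "c \<in> dyads l"
  shows "(\<integral>\<^sup>+z. indicator (dyad l c \<times> cell l \<kappa>) (z, S - {z}) \<partial>count_space S)
    = of_nat (\<kappa> c + 1) * indicator (cell l (\<kappa>(c := \<kappa> c + 1))) S"
proof -
  let ?\<kappa>' = "\<kappa>(c := \<kappa> c + 1)"
  have fin: "finite (S \<inter> dyad l c')" for c' by (rule finite_Int_dyad[OF S])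
  have fin': "finite ((S - {z}) \<inter> dyad l c')" for c' z
    by (rule finite_subset[OF _ fin[of c']]) auto
  have iff: "S - {z} \<in> cell l \<kappa> \<longleftrightarrow> S \<in> cell l ?\<kappa>'" if z: "z \<in> S" "z \<in> dyad l c" for z
  proof -
    have conf: "S - {z} \<in> configs" using S unfolding configs_def by (auto intro: finite_subset[rotated])
    have "(card ((S - {z}) \<inter> dyad l c') = \<kappa> c') = (card (S \<inter> dyad l c') = ?\<kappa>' c')" for c'
    proof (cases "c' = c")
      case True
      have eq: "(S - {z}) \<inter> dyad l c = (S \<inter> dyad l c) - {z}" by auto
      have "card (S \<inter> dyad l c) > 0" using z fin[of c] by (auto simp: card_gt_0_iff)
      moreover have "card ((S - {z}) \<inter> dyad l c) = card (S \<inter> dyad l c) - 1"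
        unfolding eq using z fin[of c] by (subst card_Diff_singleton) auto
      ultimately show ?thesis using True by auto
    next
      case False
      then have "z \<notin> dyad l c'" using z by (auto simp: dyad_def prod_eq_iff)
      then have "(S - {z}) \<inter> dyad l c' = S \<inter> dyad l c'" by auto
      then show ?thesis using False by simp
    qed
    then show ?thesis using S conf fin fin' by (simp add: cell_def point_count_finite)
  qed
  have "(\<integral>\<^sup>+z. indicator (dyad l c \<times> cell l \<kappa>) (z, S - {z}) \<partial>count_space S)
      = (\<integral>\<^sup>+z. indicator (cell l ?\<kappa>') S * indicator (dyad l c) z \<partial>count_space S)"
    using iff by (intro nn_integral_cong) (auto simp: indicator_def)
  also have "\<dots> = indicator (cell l ?\<kappa>') S * point_count (dyad l c) S"
    by (subst nn_integral_cmult) (auto simp: nn_integral_count_space_eq_point_count)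
  also have "\<dots> = of_nat (\<kappa> c + 1) * indicator (cell l ?\<kappa>') S"
    using c by (auto simp: indicator_def cell_def mult.commute)
  finally show ?thesis .
qed

lemma measurable_point_nn_integral [measurable (raw)]:
  fixes f :: "'a \<Rightarrow> real \<times> real \<Rightarrow> ennreal"
  assumes "T \<in> M \<rightarrow>\<^sub>M config_space"
    and "case_prod f \<in> borel_measurable (M \<Otimes>\<^sub>M borel)"
  shows "(\<lambda>x. \<integral>\<^sup>+z. f x z \<partial>count_space (T x)) \<in> borel_measurable M"
  using borel_measurable_points_nn_integral[OF assms] by simp

lemma measurable_removed_points:
  fixes f :: "(real \<times> real) \<times> (real \<times> real) set \<Rightarrow> ennreal"
  assumes f [measurable]: "f \<in> borel_measurable (borel \<Otimes>\<^sub>M config_space)"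
  shows "(\<lambda>S. \<integral>\<^sup>+z. f (z, S - {z}) \<partial>count_space S) \<in> borel_measurable config_space"
proof (rule measurable_point_nn_integral)
  have "(\<lambda>x. (snd x, fst x)) \<in> config_space \<Otimes>\<^sub>M (borel :: (real \<times> real) measure) \<rightarrow>\<^sub>M borel \<Otimes>\<^sub>M config_space"
    by measurable
  from measurable_compose[OF this measurable_remove_point]
  have "(\<lambda>x. (snd x, fst x - {snd x})) \<in> config_space \<Otimes>\<^sub>M (borel :: (real \<times> real) measure) \<rightarrow>\<^sub>M borel \<Otimes>\<^sub>M config_space"
    by (intro measurable_Pair) auto
  from measurable_compose[OF this f]
  show "(\<lambda>(S, z). f (z, S - {z})) \<in> borel_measurable (config_space \<Otimes>\<^sub>M borel)"
    by (simp add: split_beta')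
qed simp

text \<open>Both sides integrate \<open>f\<close> against measures on pairs, so it suffices that
  these agree on \<open>marked_cells\<close>. There the counts are independent Poisson variables,
  and the claim is the recursion
  \<open>(k + 1) * poisson_mass m (k + 1) = m * poisson_mass m k\<close>.\<close>

theorem mecke_formula:
  fixes f :: "(real \<times> real) \<times> (real \<times> real) set \<Rightarrow> ennreal"
  assumes law: "is_ppp_law \<mu> Q" and \<mu>: "sets \<mu> = sets borel"
    and fin: "\<And>l c. emeasure \<mu> (dyad l c) < \<infinity>"
    and f: "f \<in> borel_measurable (borel \<Otimes>\<^sub>M config_space)"
  shows "(\<integral>\<^sup>+S. \<integral>\<^sup>+z. f (z, S - {z}) \<partial>count_space S \<partial>Q) = (\<integral>\<^sup>+z. \<integral>\<^sup>+S. f (z, S) \<partial>Q \<partial>\<mu>)"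
proof -
  interpret Q: prob_space Q using is_ppp_lawD(1)[OF law] .
  note sQ [measurable_cong] = is_ppp_lawD(2)[OF law]
  note spQ = is_ppp_lawD(3)[OF law]
  note \<mu>[measurable_cong]
  let ?B = "borel \<Otimes>\<^sub>M config_space :: ((real \<times> real) \<times> (real \<times> real) set) measure"
  \<comment> \<open>\<open>I\<close> is the reduced Campbell measure of the process, as a set
    function.\<close>
  define I where "I = (\<lambda>E. \<integral>\<^sup>+S. \<integral>\<^sup>+z. indicator E (z, S - {z}) \<partial>count_space S \<partial>Q)"
  define M where "M = measure_of (space ?B) (sets ?B) I"
  have meas [measurable]: "(\<lambda>S. \<integral>\<^sup>+z. f (z, S - {z}) \<partial>count_space S) \<in> borel_measurable Q"
    if "f \<in> borel_measurable ?B" for f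
    using measurable_removed_points[OF that] measurable_cong_sets[OF sQ refl] by blast
  have sM: "sets M = sets ?B" unfolding M_def by (simp add: sets.space_closed sets.sigma_sets_eq)
  have eM: "emeasure M E = I E" if "E \<in> sets ?B" for E
    unfolding M_def
  proof (rule emeasure_measure_of_sigma[OF _ _ _ that])
    show "sigma_algebra (space ?B) (sets ?B)" ..
    show "positive (sets ?B) I" by (simp add: positive_def I_def)
    show "countably_additive (sets ?B) I"
    proof (rule countably_additiveI)
      fix A :: "nat \<Rightarrow> ((real \<times> real) \<times> (real \<times> real) set) set"
      assume A: "range A \<subseteq> sets ?B" "disjoint_family A"
      then have ind: "(\<lambda>x. indicator (A i) x :: ennreal) \<in> borel_measurable ?B" for i by auto
      have "I (\<Union>i. A i) = (\<integral>\<^sup>+S. (\<Sum>i. \<integral>\<^sup>+z. indicator (A i) (z, S - {z}) \<partial>count_space S) \<partial>Q)"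
        unfolding I_def using A(2)
        by (subst nn_integral_suminf[symmetric]) (auto simp: suminf_indicator)
      also have "\<dots> = (\<Sum>i. I (A i))"
        unfolding I_def by (intro nn_integral_suminf meas ind)
      finally show "(\<Sum>i. I (A i)) = I (\<Union>i. A i)" ..
    qed
  qed
  have gen: "emeasure M E = emeasure (\<mu> \<Otimes>\<^sub>M Q) E" if E: "E = dyad l c \<times> cell l \<kappa>" and c: "c \<in> dyads l" for E l c \<kappa>
  proof -
    let ?\<kappa>' = "\<kappa>(c := \<kappa> c + 1)" and ?m = "\<lambda>c. measure \<mu> (dyad l c)"
    have "emeasure M E = I E" unfolding E by (intro eM pair_measureI sets_dyad sets_cell)
    also have "\<dots> = (\<integral>\<^sup>+S. of_nat (\<kappa> c + 1) * indicator (cell l ?\<kappa>') S \<partial>Q)"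
      unfolding I_def E using points_removed_cell[OF _ c, of _ \<kappa>] spQ
      by (intro nn_integral_cong) auto
    also have "\<dots> = of_nat (\<kappa> c + 1) * emeasure Q (cell l ?\<kappa>')"
      using sets_cell by (intro nn_integral_cmult_indicator) (simp add: sQ)
    also have "\<dots> = ennreal (of_nat (\<kappa> c + 1) * (\<Prod>c'\<in>dyads l. poisson_mass (?m c') (?\<kappa>' c')))"
      unfolding ppp_law_cell[OF law fin]
      by (subst ennreal_mult) (auto intro!: prod_nonneg simp: poisson_mass_def simp flip: ennreal_of_nat_eq_real_of_nat)
    also have "of_nat (\<kappa> c + 1) * (\<Prod>c'\<in>dyads l. poisson_mass (?m c') (?\<kappa>' c'))
        = of_nat (\<kappa> c + 1) * poisson_mass (?m c) (\<kappa> c + 1) * (\<Prod>c'\<in>dyads l - {c}. poisson_mass (?m c') (?\<kappa>' c'))"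
      using c by (subst prod.remove[of _ c]) auto
    also have "of_nat (\<kappa> c + 1) * poisson_mass (?m c) (\<kappa> c + 1) = ?m c * poisson_mass (?m c) (\<kappa> c)"
      by (simp add: poisson_mass_def field_simps del: of_nat_Suc)
    also have "(\<Prod>c'\<in>dyads l - {c}. poisson_mass (?m c') (?\<kappa>' c')) = (\<Prod>c'\<in>dyads l - {c}. poisson_mass (?m c') (\<kappa> c'))"
      by (intro prod.cong) auto
    also have "?m c * poisson_mass (?m c) (\<kappa> c) * \<dots> = ?m c * (\<Prod>c'\<in>dyads l. poisson_mass (?m c') (\<kappa> c'))"
      using c by (subst prod.remove[of _ c]) auto
    also have "ennreal \<dots> = emeasure \<mu> (dyad l c) * emeasure Q (cell l \<kappa>)"
      unfolding ppp_law_cell[OF law fin]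
      using fin[of l c] by (subst ennreal_mult) (auto intro!: prod_nonneg simp: poisson_mass_def emeasure_eq_ennreal_measure)
    also have "\<dots> = emeasure (\<mu> \<Otimes>\<^sub>M Q) E"
      unfolding E by (intro Q.emeasure_pair_measure_Times[symmetric]) (simp_all add: sQ \<mu>)
    finally show ?thesis .
  qed
  have MQ: "M = \<mu> \<Otimes>\<^sub>M Q"
  proof (rule measure_eqI_generator_eq_countable[OF Int_stable_marked_cells marked_cells_subset])
    show "emeasure M X = emeasure (\<mu> \<Otimes>\<^sub>M Q) X" if "X \<in> marked_cells" for X
      using that gen unfolding marked_cells_def by auto
    show "sets M = sigma_sets (UNIV \<times> configs) marked_cells"
      using sM sets_marked_config_space by simp
    show "sets (\<mu> \<Otimes>\<^sub>M Q) = sigma_sets (UNIV \<times> configs) marked_cells"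
      using sets_pair_measure_cong[OF \<mu> sQ] sets_marked_config_space by simp
    let ?A = "(\<lambda>(l, c, \<kappa>). dyad l c \<times> cell l \<kappa>) ` Sigma UNIV (\<lambda>l. dyads l \<times> (dyads l \<rightarrow>\<^sub>E UNIV))"
    show "?A \<subseteq> marked_cells"
    proof
      fix a assume "a \<in> ?A"
      then obtain l c \<kappa> where "c \<in> dyads l" "a = dyad l c \<times> cell l \<kappa>" by auto
      then show "a \<in> marked_cells" unfolding marked_cells_def by blast
    qed
    show "\<Union>?A = UNIV \<times> configs" using marked_cells_cover by simp
    show "countable ?A" using countable_marked_index by (rule countable_image)
    show "emeasure M a \<noteq> \<infinity>" if "a \<in> ?A" for a
    proof -
      from that obtain l c \<kappa> where "c \<in> dyads l" "a = dyad l c \<times> cell l \<kappa>" by auto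
      then have "emeasure M a = emeasure \<mu> (dyad l c) * emeasure Q (cell l \<kappa>)"
        using gen by (simp add: Q.emeasure_pair_measure_Times sQ \<mu>)
      also have "\<dots> < \<infinity>" using fin[of l c]
        by (simp add: ennreal_mult_less_top Q.emeasure_eq_measure)
      finally show ?thesis by simp
    qed
  qed
  have "(\<integral>\<^sup>+S. \<integral>\<^sup>+z. f (z, S - {z}) \<partial>count_space S \<partial>Q) = (\<integral>\<^sup>+x. f x \<partial>M)"
    using f
  proof (induction rule: borel_measurable_induct)
    case (cong f g)
    have "(\<integral>\<^sup>+S. \<integral>\<^sup>+z. f (z, S - {z}) \<partial>count_space S \<partial>Q) = (\<integral>\<^sup>+S. \<integral>\<^sup>+z. g (z, S - {z}) \<partial>count_space S \<partial>Q)"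
    proof (intro nn_integral_cong cong(3))
      fix S z assume "S \<in> space Q"
      then have "S - {z} \<in> configs" unfolding spQ configs_def by (auto intro: finite_subset[rotated])
      then show "(z, S - {z}) \<in> space ?B" by (simp add: space_pair_measure)
    qed
    moreover have "(\<integral>\<^sup>+x. f x \<partial>M) = (\<integral>\<^sup>+x. g x \<partial>M)"
      using cong(3) sets_eq_imp_space_eq[OF sM] by (intro nn_integral_cong) auto
    ultimately show ?case using cong by simp
  next
    case (set A)
    then show ?case using eM[of A] sM by (simp add: I_def)
  next
    case (mult u c)
    then show ?case using meas[OF mult(2)] sM
      by (simp add: nn_integral_cmult cong: measurable_cong_sets)
  next
    case (add u v)
    then show ?case using meas[OF add(1)] meas[OF add(3)] sM
      by (simp add: nn_integral_add cong: measurable_cong_sets)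
  next
    case (seq U)
    have inc: "incseq U" by fact
    have 1: "(\<integral>\<^sup>+z. (SUP i. U i) (z, S - {z}) \<partial>count_space S) = (SUP i. \<integral>\<^sup>+z. U i (z, S - {z}) \<partial>count_space S)" for S
      unfolding SUP_apply using inc
      by (intro nn_integral_monotone_convergence_SUP) (auto simp: incseq_def le_fun_def)
    have "(\<integral>\<^sup>+S. (SUP i. \<integral>\<^sup>+z. U i (z, S - {z}) \<partial>count_space S) \<partial>Q)
        = (SUP i. \<integral>\<^sup>+S. \<integral>\<^sup>+z. U i (z, S - {z}) \<partial>count_space S \<partial>Q)"
      using inc meas[OF seq(1)]
      by (intro nn_integral_monotone_convergence_SUP) (auto simp: incseq_def le_fun_def intro!: nn_integral_mono)
    also have "\<dots> = (SUP i. \<integral>\<^sup>+x. U i x \<partial>M)" using seq by simp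
    also have "\<dots> = (\<integral>\<^sup>+x. (SUP i. U i x) \<partial>M)"
      using inc seq(1) sM
      by (intro nn_integral_monotone_convergence_SUP[symmetric]) (auto cong: measurable_cong_sets)
    finally show ?case unfolding 1 by (simp add: image_image)
  qed
  also have "\<dots> = (\<integral>\<^sup>+z. \<integral>\<^sup>+S. f (z, S) \<partial>Q \<partial>\<mu>)"
    unfolding MQ using f by (intro Q.nn_integral_fst[symmetric]) measurable
  finally show ?thesis .
qed

section \<open>Variance of sums over undominated points\<close>

definition undominated :: "('a \<Rightarrow> 'a \<Rightarrow> bool) \<Rightarrow> 'a \<Rightarrow> 'a set \<Rightarrow> ennreal" where
  "undominated r z S = (if \<forall>w\<in>S. \<not> r w z then 1 else 0)"

text \<open>Mecke's formula needs integrands in terms of the configuration without the point; the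
  influence of \<open>w\<close> is therefore split off as a factor.\<close>

lemma undominated_remove:
  "w \<in> S \<Longrightarrow> undominated r z S = undominated r z (S - {w}) * (if r w z then 0 else 1)"
  by (auto simp: undominated_def)

lemma undominated_square: "undominated r z S * undominated r z S = undominated r z S"
  by (auto simp: undominated_def)

text \<open>A point is undominated exactly when the number of points dominating it, an integral over
  the configuration, is 0.\<close>

lemma measurable_undominated [measurable (raw)]:
  fixes r :: "real \<times> real \<Rightarrow> real \<times> real \<Rightarrow> bool"
  assumes r: "{x. r (fst x) (snd x)} \<in> sets (borel \<Otimes>\<^sub>M borel)"
    and [measurable]: "f \<in> M \<rightarrow>\<^sub>M borel" "T \<in> M \<rightarrow>\<^sub>M config_space"
  shows "(\<lambda>x. undominated r (f x) (T x)) \<in> borel_measurable M"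
proof -
  let ?E = "{x. r (fst x) (snd x)}"
  let ?F = "\<lambda>x. \<integral>\<^sup>+w. indicator ?E (w, f x) \<partial>count_space (T x)"
  have [measurable]: "(\<lambda>(x, w). indicator ?E (w, f x) :: ennreal) \<in> borel_measurable (M \<Otimes>\<^sub>M borel)"
    unfolding split_beta' using r by measurable
  have "undominated r (f x) (T x) = indicator {0} (?F x)" for x
  proof -
    have "?F x = 0 \<longleftrightarrow> (\<forall>w\<in>T x. indicator ?E (w, f x) = (0::ennreal))"
      by (subst nn_integral_0_iff_AE) (auto simp: AE_count_space)
    then show ?thesis by (auto simp: undominated_def indicator_def)
  qed
  moreover have "(\<lambda>x. indicator {0} (?F x) :: ennreal) \<in> borel_measurable M"
    by measurable
  ultimately show ?thesis by simp
qed

lemma ennreal_add_right_cancelI: "a + c = b + c \<Longrightarrow> c \<noteq> \<top> \<Longrightarrow> a = b" for a b c :: ennreal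
  by (metis ennreal_add_diff_cancel_right)

text \<open>If two new points are added to the configuration, at most one of them dominates the other;
  hence the off-diagonal contributions cancel and only the diagonal term survives.\<close>

theorem undominated_sum_variance:
  fixes r :: "real \<times> real \<Rightarrow> real \<times> real \<Rightarrow> bool" and h :: "real \<times> real \<Rightarrow> ennreal"
  assumes law: "is_ppp_law \<mu> Q" and \<mu>: "sets \<mu> = sets borel" "sigma_finite_measure \<mu>"
    and fin: "\<And>l c. emeasure \<mu> (dyad l c) < \<infinity>"
    and r: "{x. r (fst x) (snd x)} \<in> sets (borel \<Otimes>\<^sub>M borel)"
    and asym: "\<And>z w. r z w \<Longrightarrow> \<not> r w z"
    and h [measurable]: "h \<in> borel_measurable borel"
    and B_fin: "(\<integral>\<^sup>+S. (\<integral>\<^sup>+z. h z * undominated r z S \<partial>\<mu>)\<^sup>2 \<partial>Q) < \<infinity>"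
  shows "(\<integral>\<^sup>+S. ennreal ((enn2real (\<integral>\<^sup>+z. h z * undominated r z S \<partial>count_space S)
                      - enn2real (\<integral>\<^sup>+z. h z * undominated r z S \<partial>\<mu>))\<^sup>2) \<partial>Q)
    \<le> (\<integral>\<^sup>+z. \<integral>\<^sup>+S. h z * h z * undominated r z S \<partial>Q \<partial>\<mu>)"
proof -
  interpret Q: prob_space Q using is_ppp_lawD(1)[OF law] .
  interpret \<mu>: sigma_finite_measure \<mu> by fact
  interpret \<mu>Q: pair_sigma_finite \<mu> Q ..
  interpret \<mu>\<mu>: pair_sigma_finite \<mu> \<mu> ..
  note sQ [measurable_cong] = is_ppp_lawD(2)[OF law]
  note \<mu>(1) [measurable_cong]
  note r [measurable]
  define u where "u = undominated r"
  define d where "d = (\<lambda>z w. if r z w then 0 else 1 :: ennreal)"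
  define A where "A S = (\<integral>\<^sup>+z. h z * u z S \<partial>count_space S)" for S
  define B where "B S = (\<integral>\<^sup>+z. h z * u z S \<partial>\<mu>)" for S
  define G where "G z w = (\<integral>\<^sup>+S. h z * u z S * (h w * u w S) \<partial>Q)" for z w
  define D where "D = (\<integral>\<^sup>+z. \<integral>\<^sup>+S. h z * h z * u z S \<partial>Q \<partial>\<mu>)"
  \<comment> \<open>Mecke's formula will identify these three with the off-diagonal part of the
    second moment of \<open>A\<close>, the mixed moment of \<open>A\<close> and \<open>B\<close>,
    and the second moment of \<open>B\<close>. The factor \<open>d z w\<close> records that
    \<open>z\<close> does not dominate \<open>w\<close>.\<close>
  define T1 where "T1 = (\<integral>\<^sup>+z. \<integral>\<^sup>+w. G z w * (d z w * d w z) \<partial>\<mu> \<partial>\<mu>)"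
  define T2 where "T2 = (\<integral>\<^sup>+z. \<integral>\<^sup>+w. G z w * d z w \<partial>\<mu> \<partial>\<mu>)"
  define T3 where "T3 = (\<integral>\<^sup>+z. \<integral>\<^sup>+w. G z w \<partial>\<mu> \<partial>\<mu>)"
  have u_meas [measurable (raw)]: "(\<lambda>x. u (f x) (T x)) \<in> borel_measurable M"
    if "f \<in> M \<rightarrow>\<^sub>M borel" "T \<in> M \<rightarrow>\<^sub>M config_space" for f T and M :: "'x measure"
    unfolding u_def using r that by (rule measurable_undominated)
  have d_meas [measurable (raw)]: "(\<lambda>x. d (f x) (g x)) \<in> borel_measurable M"
    if [measurable]: "f \<in> M \<rightarrow>\<^sub>M borel" "g \<in> M \<rightarrow>\<^sub>M borel" for f g and M :: "'x measure"
  proof -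
    have "(\<lambda>x. d (f x) (g x)) = (\<lambda>x. 1 - indicator {x. r (fst x) (snd x)} (f x, g x))"
      by (auto simp: d_def indicator_def)
    also have "\<dots> \<in> borel_measurable M" by measurable
    finally show ?thesis .
  qed
  have irr: "\<not> r z z" for z using asym by blast
  have u_rm: "u z S = u z (S - {w}) * d w z" if "w \<in> S" for z w S
    unfolding u_def d_def by (rule undominated_remove[OF that])
  have u_rm_self: "u z S = u z (S - {z})" if "z \<in> S" for z S
    using u_rm[OF that, of z] irr by (simp add: d_def)
  have uu: "u z S * u z S = u z S" for z S unfolding u_def by (rule undominated_square)
  have A_meas [measurable]: "A \<in> borel_measurable config_space" unfolding A_def by measurable
  have B_meas [measurable]: "B \<in> borel_measurable config_space" unfolding B_def by measurable
  have mecke: "(\<integral>\<^sup>+S. \<integral>\<^sup>+z. f (z, S - {z}) \<partial>count_space S \<partial>Q) = (\<integral>\<^sup>+z. \<integral>\<^sup>+S. f (z, S) \<partial>Q \<partial>\<mu>)"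
    if "f \<in> borel_measurable (borel \<Otimes>\<^sub>M config_space)" for f
    by (rule mecke_formula[OF law \<mu>(1) fin that])
  have G_meas [measurable]: "(\<lambda>x. G (fst x) (snd x)) \<in> borel_measurable (borel \<Otimes>\<^sub>M borel)"
    unfolding G_def by measurable
  have [measurable]: "G z \<in> borel_measurable borel" for z
    using measurable_compose[OF _ G_meas, of "\<lambda>w. (z, w)" borel] by simp
  have G_sym: "G z w = G w z" for z w unfolding G_def by (simp add: mult.commute)

  have AA: "(\<integral>\<^sup>+S. A S * A S \<partial>Q) = D + T1"
  proof -
    \<comment> \<open>\<open>?off\<close> collects the pairs of distinct points. Once
      \<open>z\<close> is removed, every other \<open>w\<close> keeps the factor
      \<open>d z w\<close>, since \<open>z\<close> might have been the point that dominates
      it.\<close>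
    let ?off = "\<lambda>(z, S). h z * u z S * (\<integral>\<^sup>+w. h w * u w S * d z w \<partial>count_space S)"
    have [measurable]: "?off \<in> borel_measurable (borel \<Otimes>\<^sub>M config_space)" by measurable
    have "A S * A S = (\<integral>\<^sup>+z. h z * h z * u z (S - {z}) \<partial>count_space S) + (\<integral>\<^sup>+z. ?off (z, S - {z}) \<partial>count_space S)" for S
    proof -
      have "A S * A S = (\<integral>\<^sup>+z. h z * u z S * A S \<partial>count_space S)"
        unfolding A_def by (rule nn_integral_multc[symmetric]) simp
      also have "\<dots> = (\<integral>\<^sup>+z. h z * h z * u z (S - {z}) + ?off (z, S - {z}) \<partial>count_space S)"
      proof (rule nn_integral_cong)
        fix z assume "z \<in> space (count_space S)"
        then have z: "z \<in> S" by simp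
        have "A S = (\<integral>\<^sup>+w. h w * u w S * indicator {z} w + h w * u w S * indicator (S - {z}) w \<partial>count_space S)"
          unfolding A_def by (intro nn_integral_cong) (auto simp: indicator_def)
        also have "\<dots> = (\<integral>\<^sup>+w. h w * u w S * indicator {z} w \<partial>count_space S)
            + (\<integral>\<^sup>+w. h w * u w S * indicator (S - {z}) w \<partial>count_space S)"
          by (rule nn_integral_add) auto
        also have "(\<integral>\<^sup>+w. h w * u w S * indicator {z} w \<partial>count_space S) = h z * u z S"
          using z by (subst nn_integral_indicator_singleton) auto
        also have "(\<integral>\<^sup>+w. h w * u w S * indicator (S - {z}) w \<partial>count_space S)
            = (\<integral>\<^sup>+w. h w * u w S \<partial>count_space (S - {z}))"
          by (subst (1 2) nn_integral_count_space_indicator) (auto intro!: nn_integral_cong simp: indicator_def)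
        also have "\<dots> = (\<integral>\<^sup>+w. h w * u w (S - {z}) * d z w \<partial>count_space (S - {z}))"
          using u_rm[OF z] by (intro nn_integral_cong) (simp add: mult.assoc)
        finally have A: "A S = h z * u z S + \<dots>" .
        have "h z * u z S * A S = h z * h z * (u z S * u z S) + h z * u z S * (\<integral>\<^sup>+w. h w * u w (S - {z}) * d z w \<partial>count_space (S - {z}))"
          unfolding A by (simp add: distrib_left mult_ac)
        then show "h z * u z S * A S = h z * h z * u z (S - {z}) + ?off (z, S - {z})"
          unfolding uu u_rm_self[OF z] by simp
      qed
      also have "\<dots> = (\<integral>\<^sup>+z. h z * h z * u z (S - {z}) \<partial>count_space S) + (\<integral>\<^sup>+z. ?off (z, S - {z}) \<partial>count_space S)"
        by (rule nn_integral_add) auto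
      finally show ?thesis .
    qed
    then have "(\<integral>\<^sup>+S. A S * A S \<partial>Q) = (\<integral>\<^sup>+S. \<integral>\<^sup>+z. h z * h z * u z (S - {z}) \<partial>count_space S \<partial>Q)
        + (\<integral>\<^sup>+S. \<integral>\<^sup>+z. ?off (z, S - {z}) \<partial>count_space S \<partial>Q)"
      using measurable_removed_points[of "\<lambda>(z, S). h z * h z * u z S"] measurable_removed_points[of ?off]
      by (simp add: nn_integral_add cong: measurable_cong_sets)
    also have "(\<integral>\<^sup>+S. \<integral>\<^sup>+z. h z * h z * u z (S - {z}) \<partial>count_space S \<partial>Q) = D"
      using mecke[of "\<lambda>(z, S). h z * h z * u z S"] unfolding D_def by simp
    also have "(\<integral>\<^sup>+S. \<integral>\<^sup>+z. ?off (z, S - {z}) \<partial>count_space S \<partial>Q) = (\<integral>\<^sup>+z. \<integral>\<^sup>+S. ?off (z, S) \<partial>Q \<partial>\<mu>)"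
      by (rule mecke) measurable
    also have "\<dots> = T1"
      unfolding T1_def
    proof (rule nn_integral_cong)
      fix z
      \<comment> \<open>Second use of Mecke's formula, for \<open>w\<close> with \<open>z\<close>
        held fixed.\<close>
      let ?f = "\<lambda>(w, S). h z * u z S * (h w * u w S) * (d z w * d w z)"
      have "(\<integral>\<^sup>+S. ?off (z, S) \<partial>Q) = (\<integral>\<^sup>+S. \<integral>\<^sup>+w. ?f (w, S - {w}) \<partial>count_space S \<partial>Q)"
      proof (rule nn_integral_cong)
        fix S
        have "?off (z, S) = (\<integral>\<^sup>+w. h z * u z S * (h w * u w S * d z w) \<partial>count_space S)"
          by (simp add: nn_integral_cmult)
        also have "\<dots> = (\<integral>\<^sup>+w. ?f (w, S - {w}) \<partial>count_space S)"
        proof (rule nn_integral_cong)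
          fix w assume "w \<in> space (count_space S)"
          then have "u w S = u w (S - {w})" "u z S = u z (S - {w}) * d w z"
            using u_rm_self u_rm by auto
          then show "h z * u z S * (h w * u w S * d z w) = ?f (w, S - {w})"
            by (simp add: mult_ac)
        qed
        finally show "?off (z, S) = (\<integral>\<^sup>+w. ?f (w, S - {w}) \<partial>count_space S)" .
      qed
      also have "\<dots> = (\<integral>\<^sup>+w. \<integral>\<^sup>+S. ?f (w, S) \<partial>Q \<partial>\<mu>)"
        by (rule mecke) measurable
      also have "\<dots> = (\<integral>\<^sup>+w. G z w * (d z w * d w z) \<partial>\<mu>)"
        unfolding G_def by (intro nn_integral_cong) (simp, subst nn_integral_multc[symmetric], auto)
      finally show "(\<integral>\<^sup>+S. ?off (z, S) \<partial>Q) = (\<integral>\<^sup>+w. G z w * (d z w * d w z) \<partial>\<mu>)" .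
    qed
    finally show ?thesis .
  qed

  have AB: "(\<integral>\<^sup>+S. A S * B S \<partial>Q) = T2"
  proof -
    let ?f = "\<lambda>(z, S). h z * u z S * (\<integral>\<^sup>+w. h w * u w S * d z w \<partial>\<mu>)"
    have "(\<integral>\<^sup>+S. A S * B S \<partial>Q) = (\<integral>\<^sup>+S. \<integral>\<^sup>+z. ?f (z, S - {z}) \<partial>count_space S \<partial>Q)"
    proof (rule nn_integral_cong)
      fix S
      have "A S * B S = (\<integral>\<^sup>+z. h z * u z S * B S \<partial>count_space S)"
        unfolding A_def by (rule nn_integral_multc[symmetric]) simp
      also have "\<dots> = (\<integral>\<^sup>+z. ?f (z, S - {z}) \<partial>count_space S)"
      proof (rule nn_integral_cong)
        fix z assume "z \<in> space (count_space S)"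
        then have z: "z \<in> S" by simp
        have "B S = (\<integral>\<^sup>+w. h w * u w (S - {z}) * d z w \<partial>\<mu>)"
          unfolding B_def using u_rm[OF z] by (intro nn_integral_cong) (simp add: mult.assoc)
        then show "h z * u z S * B S = ?f (z, S - {z})" using u_rm_self[OF z] by simp
      qed
      finally show "A S * B S = (\<integral>\<^sup>+z. ?f (z, S - {z}) \<partial>count_space S)" .
    qed
    also have "\<dots> = (\<integral>\<^sup>+z. \<integral>\<^sup>+S. ?f (z, S) \<partial>Q \<partial>\<mu>)"
      by (rule mecke) measurable
    also have "\<dots> = T2"
      unfolding T2_def
    proof (rule nn_integral_cong)
      fix z
      have "(\<integral>\<^sup>+S. ?f (z, S) \<partial>Q) = (\<integral>\<^sup>+S. \<integral>\<^sup>+w. h z * u z S * (h w * u w S) * d z w \<partial>\<mu> \<partial>Q)"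
      proof (rule nn_integral_cong)
        fix S assume "S \<in> space Q"
        then have [measurable]: "S \<in> space config_space" using is_ppp_lawD(3)[OF law] by simp
        show "?f (z, S) = (\<integral>\<^sup>+w. h z * u z S * (h w * u w S) * d z w \<partial>\<mu>)"
          by (simp add: nn_integral_cmult[symmetric] mult.assoc)
      qed
      also have "\<dots> = (\<integral>\<^sup>+w. \<integral>\<^sup>+S. h z * u z S * (h w * u w S) * d z w \<partial>Q \<partial>\<mu>)"
        by (rule \<mu>Q.Fubini') measurable
      also have "\<dots> = (\<integral>\<^sup>+w. G z w * d z w \<partial>\<mu>)"
        unfolding G_def by (intro nn_integral_cong) (subst nn_integral_multc[symmetric], auto)
      finally show "(\<integral>\<^sup>+S. ?f (z, S) \<partial>Q) = (\<integral>\<^sup>+w. G z w * d z w \<partial>\<mu>)" .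
    qed
    finally show ?thesis .
  qed

  have BB: "(\<integral>\<^sup>+S. B S * B S \<partial>Q) = T3"
  proof -
    have "(\<integral>\<^sup>+S. B S * B S \<partial>Q) = (\<integral>\<^sup>+S. \<integral>\<^sup>+z. h z * u z S * B S \<partial>\<mu> \<partial>Q)"
    proof (rule nn_integral_cong)
      fix S assume "S \<in> space Q"
      then have [measurable]: "S \<in> space config_space" using is_ppp_lawD(3)[OF law] by simp
      show "B S * B S = (\<integral>\<^sup>+z. h z * u z S * B S \<partial>\<mu>)"
        unfolding B_def by (rule nn_integral_multc[symmetric]) measurable
    qed
    also have "\<dots> = (\<integral>\<^sup>+z. \<integral>\<^sup>+S. h z * u z S * B S \<partial>Q \<partial>\<mu>)"
      by (rule \<mu>Q.Fubini') measurable
    also have "\<dots> = T3"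
      unfolding T3_def
    proof (rule nn_integral_cong)
      fix z
      have "(\<integral>\<^sup>+S. h z * u z S * B S \<partial>Q) = (\<integral>\<^sup>+S. \<integral>\<^sup>+w. h z * u z S * (h w * u w S) \<partial>\<mu> \<partial>Q)"
      proof (rule nn_integral_cong)
        fix S assume "S \<in> space Q"
        then have [measurable]: "S \<in> space config_space" using is_ppp_lawD(3)[OF law] by simp
        show "h z * u z S * B S = (\<integral>\<^sup>+w. h z * u z S * (h w * u w S) \<partial>\<mu>)"
          unfolding B_def by (rule nn_integral_cmult[symmetric]) measurable
      qed
      also have "\<dots> = (\<integral>\<^sup>+w. G z w \<partial>\<mu>)"
        unfolding G_def by (rule \<mu>Q.Fubini') measurable
      finally show "(\<integral>\<^sup>+S. h z * u z S * B S \<partial>Q) = (\<integral>\<^sup>+w. G z w \<partial>\<mu>)" .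
    qed
    finally show ?thesis .
  qed

  have T2': "T2 = (\<integral>\<^sup>+z. \<integral>\<^sup>+w. G z w * d w z \<partial>\<mu> \<partial>\<mu>)"
    unfolding T2_def by (subst \<mu>\<mu>.Fubini') (auto simp: G_sym[of _ "_ :: real \<times> real"] intro!: nn_integral_cong)
  have cancel: "T1 + T3 = T2 + T2"
  proof -
    have "T1 + T3 = (\<integral>\<^sup>+z. \<integral>\<^sup>+w. G z w * (d z w * d w z) + G z w \<partial>\<mu> \<partial>\<mu>)"
    proof -
      have "(\<integral>\<^sup>+w. G z w * (d z w * d w z) + G z w \<partial>\<mu>)
          = (\<integral>\<^sup>+w. G z w * (d z w * d w z) \<partial>\<mu>) + (\<integral>\<^sup>+w. G z w \<partial>\<mu>)" for z
        by (rule nn_integral_add) measurable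
      moreover have "(\<integral>\<^sup>+z. (\<integral>\<^sup>+w. G z w * (d z w * d w z) \<partial>\<mu>) + (\<integral>\<^sup>+w. G z w \<partial>\<mu>) \<partial>\<mu>) = T1 + T3"
        unfolding T1_def T3_def by (rule nn_integral_add) measurable
      ultimately show ?thesis by simp
    qed
    \<comment> \<open>Pointwise \<open>d z w * d w z + 1 = d z w + d w z\<close>, because asymmetry
      forbids that both factors vanish.\<close>
    also have "\<dots> = (\<integral>\<^sup>+z. \<integral>\<^sup>+w. G z w * d z w + G z w * d w z \<partial>\<mu> \<partial>\<mu>)"
      using asym by (intro nn_integral_cong) (auto simp: d_def)
    also have "\<dots> = T2 + T2"
    proof -
      have "(\<integral>\<^sup>+w. G z w * d z w + G z w * d w z \<partial>\<mu>)
          = (\<integral>\<^sup>+w. G z w * d z w \<partial>\<mu>) + (\<integral>\<^sup>+w. G z w * d w z \<partial>\<mu>)" for z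
        by (rule nn_integral_add) measurable
      moreover have "(\<integral>\<^sup>+z. (\<integral>\<^sup>+w. G z w * d z w \<partial>\<mu>) + (\<integral>\<^sup>+w. G z w * d w z \<partial>\<mu>) \<partial>\<mu>)
          = (\<integral>\<^sup>+z. \<integral>\<^sup>+w. G z w * d z w \<partial>\<mu> \<partial>\<mu>) + (\<integral>\<^sup>+z. \<integral>\<^sup>+w. G z w * d w z \<partial>\<mu> \<partial>\<mu>)"
        by (rule nn_integral_add) measurable
      ultimately show ?thesis unfolding T2'[symmetric] T2_def[symmetric] by simp
    qed
    finally show ?thesis .
  qed
  have T3_fin: "T3 < \<infinity>"
    using B_fin unfolding BB[symmetric] B_def u_def by (simp add: power2_eq_square)
  have T2_fin: "T2 < \<infinity>"
  proof (rule le_less_trans[OF _ T3_fin])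
    show "T2 \<le> T3" unfolding T2_def T3_def
      by (intro nn_integral_mono) (auto simp: d_def)
  qed
  show ?thesis
  proof (cases "D = \<infinity>")
    case True
    then show ?thesis unfolding D_def u_def by simp
  next
    case False
    have "T1 \<le> T2 + T2" unfolding cancel[symmetric] by simp
    also have "\<dots> < \<infinity>" using T2_fin by simp
    finally have T1_fin: "T1 < \<infinity>" .
    have A_fin: "AE S in Q. A S < \<infinity>"
    proof -
      have "AE S in Q. A S * A S \<noteq> \<infinity>"
        using AA T1_fin False by (intro nn_integral_PInf_AE) (auto simp: less_top)
      then show ?thesis by eventually_elim (auto simp: ennreal_mult_eq_top_iff less_top)
    qed
    have B_fin': "AE S in Q. B S < \<infinity>"
    proof -
      have "AE S in Q. B S * B S \<noteq> \<infinity>"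
        using BB T3_fin by (intro nn_integral_PInf_AE) (auto simp: less_top)
      then show ?thesis by eventually_elim (auto simp: ennreal_mult_eq_top_iff less_top)
    qed
    let ?X = "\<lambda>S. ennreal ((enn2real (A S) - enn2real (B S))\<^sup>2)"
    \<comment> \<open>Expanding the square would need a subtraction of extended reals. The mixed
      terms \<open>T2 + T2\<close> are added on both sides instead and cancelled at the end, which
      is where their finiteness enters.\<close>
    have "(\<integral>\<^sup>+S. ?X S \<partial>Q) + (T2 + T2) = (\<integral>\<^sup>+S. ?X S + (A S * B S + A S * B S) \<partial>Q)"
      unfolding AB[symmetric] by (simp add: nn_integral_add)
    also have "\<dots> = (\<integral>\<^sup>+S. A S * A S + B S * B S \<partial>Q)"
    proof (rule nn_integral_cong_AE, use A_fin B_fin' in eventually_elim)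
      case (elim S)
      then obtain a b where ab: "A S = ennreal a" "0 \<le> a" "B S = ennreal b" "0 \<le> b"
        by (metis ennreal_cases infinity_ennreal_def less_irrefl)
      have "(a - b)\<^sup>2 + (a * b + a * b) = a * a + b * b" by (simp add: power2_eq_square algebra_simps)
      then show ?case using ab by (simp flip: ennreal_mult ennreal_plus)
    qed
    also have "\<dots> = D + (T2 + T2)"
      using AA BB cancel by (simp add: nn_integral_add add.assoc)
    finally have eq: "(\<integral>\<^sup>+S. ?X S \<partial>Q) + (T2 + T2) = D + (T2 + T2)" .
    have "T2 + T2 \<noteq> \<top>" using T2_fin by simp
    from ennreal_add_right_cancelI[OF eq this] have "(\<integral>\<^sup>+S. ?X S \<partial>Q) = D" .
    then show ?thesis unfolding D_def A_def B_def u_def by simp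
  qed
qed

section \<open>Intensities above a curve and change of measure\<close>

lemma continuous_on_hoelder_ball:
  assumes g: "g \<in> hoelder_ball \<beta> R" and \<beta>: "0 < \<beta>"
  shows "continuous_on {0..1} g"
  unfolding continuous_on_def
proof
  fix x :: real assume x: "x \<in> {0..1}"
  have "((\<lambda>y. g y - g x) \<longlongrightarrow> 0) (at x within {0..1})"
  proof (rule Lim_null_comparison)
    show "\<forall>\<^sub>F y in at x within {0..1}. norm (g y - g x) \<le> R * \<bar>y - x\<bar> powr \<beta>"
      using g x unfolding hoelder_ball_def by (auto simp: eventually_at_filter)
    have "((\<lambda>y. R * \<bar>y - x\<bar> powr \<beta>) \<longlongrightarrow> R * \<bar>x - x\<bar> powr \<beta>) (at x within {0..1})"
      using \<beta> by (intro tendsto_intros tendsto_powr') auto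
    then show "((\<lambda>y. R * \<bar>y - x\<bar> powr \<beta>) \<longlongrightarrow> 0) (at x within {0..1})" by simp
  qed
  then show "(g \<longlongrightarrow> g x) (at x within {0..1})" by (rule LIM_zero_cancel)
qed

definition support_region :: "(real \<Rightarrow> real) \<Rightarrow> (real \<times> real) set" where
  "support_region g = {(x, y). x \<in> {0..1} \<and> y \<ge> g x}"

text \<open>A curve of the Hoelder ball may fail to be measurable off the unit interval, so its
  product with the indicator is used.\<close>

lemma borel_measurable_restrict_unit:
  assumes "continuous_on {0..1} (g :: real \<Rightarrow> real)"
  shows "(\<lambda>x. g x * indicator {0..1} x) \<in> borel_measurable borel"
proof -
  have "(\<lambda>x. if x \<in> {0..1} then g x else 0) \<in> borel_measurable borel"
    using assms by (intro borel_measurable_continuous_on_if) auto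
  also have "(\<lambda>x. if x \<in> {0..1} then g x else 0) = (\<lambda>x. g x * indicator {0..1} x)"
    by (auto simp: indicator_def)
  finally show ?thesis .
qed

lemma sets_support_region:
  assumes "continuous_on {0..1} g"
  shows "support_region g \<in> sets borel"
proof -
  note [measurable] = borel_measurable_restrict_unit[OF assms]
  have "{z \<in> space (borel \<Otimes>\<^sub>M borel). fst z \<in> {0..1::real} \<and> g (fst z) * indicator {0..1} (fst z) \<le> snd z}
      \<in> sets (borel \<Otimes>\<^sub>M borel)"
    by measurable
  moreover have "{z \<in> space (borel \<Otimes>\<^sub>M borel). fst z \<in> {0..1::real} \<and> g (fst z) * indicator {0..1} (fst z) \<le> snd z}
      = support_region g"
    by (auto simp: support_region_def space_pair_measure)
  ultimately show ?thesis unfolding borel_prod by (simp only:)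
qed

lemma intensity_eq: "intensity n g = density lborel (\<lambda>z. of_nat n * indicator (support_region g) z)"
  unfolding intensity_def support_region_def by simp

lemma sets_intensity [simp, measurable_cong]: "sets (intensity n g) = sets borel"
  unfolding intensity_def by simp

lemma nn_integral_intensity:
  assumes g: "continuous_on {0..1} g" and [measurable]: "f \<in> borel_measurable borel"
  shows "(\<integral>\<^sup>+z. f z \<partial>intensity n g)
    = (\<integral>\<^sup>+x. (\<integral>\<^sup>+y. of_nat n * f (x, y) * indicator {g x..} y \<partial>lborel) * indicator {0..1} x \<partial>lborel)"
proof -
  note [measurable] = sets_support_region[OF g]
  have "(\<integral>\<^sup>+z. f z \<partial>intensity n g) = (\<integral>\<^sup>+z. of_nat n * indicator (support_region g) z * f z \<partial>lborel)"
    unfolding intensity_eq by (subst nn_integral_density) auto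
  also have "\<dots> = (\<integral>\<^sup>+x. \<integral>\<^sup>+y. of_nat n * indicator (support_region g) (x, y) * f (x, y) \<partial>lborel \<partial>lborel)"
  proof -
    have "(\<lambda>z. of_nat n * indicator (support_region g) z * f z) \<in> borel_measurable (lborel \<Otimes>\<^sub>M lborel)"
      unfolding lborel_prod by measurable
    from lborel.nn_integral_fst[OF this] show ?thesis unfolding lborel_prod by (rule sym)
  qed
  also have "\<dots> = (\<integral>\<^sup>+x. (\<integral>\<^sup>+y. of_nat n * f (x, y) * indicator {g x..} y \<partial>lborel) * indicator {0..1} x \<partial>lborel)"
    by (intro nn_integral_cong)
      (auto simp: support_region_def indicator_def intro!: nn_integral_cong)
  finally show ?thesis .
qed

lemma emeasure_intensity:
  assumes "continuous_on {0..1} g" "A \<in> sets borel"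
  shows "emeasure (intensity n g) A = of_nat n * emeasure lborel (A \<inter> support_region g)"
proof -
  note [measurable] = sets_support_region[OF assms(1)] assms(2)
  have "emeasure (intensity n g) A = (\<integral>\<^sup>+z. of_nat n * indicator (A \<inter> support_region g) z \<partial>lborel)"
    unfolding intensity_eq by (subst emeasure_density) (auto intro!: nn_integral_cong simp: indicator_def)
  then show ?thesis by (simp add: nn_integral_cmult)
qed

lemma bounded_dyad: "bounded (dyad l c)"
proof (rule bounded_subset)
  let ?a = "\<lambda>i. of_int i / 2 ^ l :: real" and ?b = "\<lambda>i. (of_int i + 1) / 2 ^ l :: real"
  have *: "?a i \<le> x \<and> x \<le> ?b i" if "\<lfloor>2 ^ l * x\<rfloor> = i" for x :: real and i
  proof -
    have "of_int i \<le> 2 ^ l * x" "2 ^ l * x \<le> of_int i + 1" using that by linarith+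
    then show ?thesis by (simp add: field_simps)
  qed
  show "dyad l c \<subseteq> {?a (fst c)..?b (fst c)} \<times> {?a (snd c)..?b (snd c)}"
  proof
    fix z assume "z \<in> dyad l c"
    then have "\<lfloor>2 ^ l * fst z\<rfloor> = fst c" "\<lfloor>2 ^ l * snd z\<rfloor> = snd c" by (auto simp: dyad_def)
    from *[OF this(1)] *[OF this(2)]
    show "z \<in> {?a (fst c)..?b (fst c)} \<times> {?a (snd c)..?b (snd c)}" by (simp add: mem_Times_iff)
  qed
  show "bounded ({?a (fst c)..?b (fst c)} \<times> {?a (snd c)..?b (snd c)})"
    by (intro bounded_Times bounded_closed_interval)
qed

lemma emeasure_intensity_finite:
  assumes "continuous_on {0..1} g" "A \<in> sets borel" "bounded A"
  shows "emeasure (intensity n g) A < \<infinity>"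
proof -
  have "emeasure lborel (A \<inter> support_region g) < \<infinity>"
    using assms(3) by (intro emeasure_bounded_finite) (auto intro: bounded_subset)
  then show ?thesis
    unfolding emeasure_intensity[OF assms(1,2)] by (simp add: ennreal_mult_less_top of_nat_less_top)
qed

lemma emeasure_intensity_dyad:
  "continuous_on {0..1} g \<Longrightarrow> emeasure (intensity n g) (dyad l c) < \<infinity>"
  by (intro emeasure_intensity_finite sets_dyad bounded_dyad)

lemma sigma_finite_intensity:
  assumes "continuous_on {0..1} g"
  shows "sigma_finite_measure (intensity n g)"
proof
  let ?A = "(\<lambda>(l, c). dyad l c) ` (UNIV :: (nat \<times> int \<times> int) set)"
  have "countable ?A" by (intro countable_image) auto
  moreover have "?A \<subseteq> sets (intensity n g)" by auto
  moreover have "\<Union>?A = space (intensity n g)"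
  proof -
    have "z \<in> \<Union>?A" for z
      using eventually_happens[OF mem_dyads[of z]] by auto
    moreover have "space (intensity n g) = UNIV" by (simp add: intensity_def)
    ultimately show ?thesis by blast
  qed
  moreover have "\<forall>a\<in>?A. emeasure (intensity n g) a \<noteq> \<infinity>"
    using emeasure_intensity_dyad[OF assms, of n] by (auto simp: less_top)
  ultimately show "\<exists>A. countable A \<and> A \<subseteq> sets (intensity n g) \<and> \<Union>A = space (intensity n g)
      \<and> (\<forall>a\<in>A. emeasure (intensity n g) a \<noteq> \<infinity>)"
    by blast
qed

section \<open>Void probabilities and likelihood ratios\<close>

lemma void_probability:
  assumes law: "is_ppp_law \<mu> Q" and A: "A \<in> sets borel" "emeasure \<mu> A < \<infinity>"
  shows "measure Q {S \<in> configs. point_count A S = 0} = exp (- measure \<mu> A)"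
  using ppp_law_product[OF law, of "{()}" "\<lambda>_. A" "\<lambda>_. 0"] A
  by (simp add: disjoint_family_on_def poisson_mass_def)

text \<open>Discarding the points in \<open>B\<close> turns the intensity of \<open>Q0\<close> into
  that of \<open>Q1\<close>. As counts in disjoint sets are independent, this has the same effect on
  the law as conditioning \<open>Q0\<close> on having no points in \<open>B\<close>; the exponential
  is the reciprocal of the probability of that event.\<close>

lemma ppp_law_density:
  assumes law0: "is_ppp_law \<mu>0 Q0" and law1: "is_ppp_law \<mu>1 Q1"
    and fin: "\<And>l c. emeasure \<mu>0 (dyad l c) < \<infinity>"
    and sets: "sets \<mu>0 = sets borel" "sets \<mu>1 = sets borel"
    and B [measurable]: "B \<in> sets borel" and B_fin: "emeasure \<mu>0 B < \<infinity>"
    and diff: "\<And>A. A \<in> sets borel \<Longrightarrow> emeasure \<mu>1 A = emeasure \<mu>0 (A - B)"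
  shows "Q1 = density Q0 (\<lambda>S. ennreal (exp (measure \<mu>0 B)) * indicator {S \<in> configs. point_count B S = 0} S)"
    (is "_ = density Q0 (\<lambda>S. ennreal ?e * indicator ?V S)")
proof (rule config_measure_eqI)
  interpret Q0: prob_space Q0 using is_ppp_lawD(1)[OF law0] .
  note sQ0 [measurable_cong] = is_ppp_lawD(2)[OF law0]
  show "sets Q1 = sets config_space" using is_ppp_lawD(2)[OF law1] .
  show "sets (density Q0 (\<lambda>S. ennreal ?e * indicator ?V S)) = sets config_space" using sQ0 by simp
  show "finite_measure Q1" using is_ppp_lawD(1)[OF law1] by (rule prob_space.finite_measure)
  have "{S \<in> space config_space. point_count B S = 0} \<in> sets config_space" by measurable
  then have V [measurable]: "?V \<in> sets config_space" by simp
  have fin0: "emeasure \<mu>0 (A - B) < \<infinity>" if "emeasure \<mu>0 A < \<infinity>" "A \<in> sets borel" for A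
    using emeasure_mono[of "A - B" A \<mu>0] that sets by auto
  fix l and \<kappa> :: "int \<times> int \<Rightarrow> nat"
  \<comment> \<open>\<open>None\<close> stands for \<open>B\<close> with prescribed count 0,
    \<open>Some c\<close> for the rest of a square. On the void event the counts of a square and of
    its rest agree.\<close>
  let ?J = "insert None (Some ` dyads l)"
  let ?A = "\<lambda>j. case j of None \<Rightarrow> B | Some c \<Rightarrow> dyad l c - B"
  let ?k = "\<lambda>j. case j of None \<Rightarrow> 0 | Some c \<Rightarrow> (\<kappa> c :: nat)"
  have dens: "(\<lambda>S. ennreal ?e * indicator ?V S) \<in> borel_measurable Q0" by measurable
  have "cell l \<kappa> \<in> sets Q0" using sQ0 by simp
  from emeasure_density[OF dens this]
  have "emeasure (density Q0 (\<lambda>S. ennreal ?e * indicator ?V S)) (cell l \<kappa>)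
      = (\<integral>\<^sup>+S. ennreal ?e * indicator (?V \<inter> cell l \<kappa>) S \<partial>Q0)"
    by (simp add: indicator_inter_arith mult.assoc)
  also have "\<dots> = ennreal ?e * emeasure Q0 (?V \<inter> cell l \<kappa>)"
    using V by (intro nn_integral_cmult_indicator) (simp add: sQ0 sets.Int)
  also have "?V \<inter> cell l \<kappa> = {S \<in> configs. \<forall>j\<in>?J. point_count (?A j) S = of_nat (?k j)}"
  proof -
    have "point_count (dyad l c - B) S = point_count (dyad l c) S" if "point_count B S = 0" for c S
    proof -
      have "S \<inter> B = {}" using that by (simp add: point_count_def emeasure_count_space split: if_splits)
      then have "S \<inter> (dyad l c - B) = S \<inter> dyad l c" by auto
      then show ?thesis by (simp add: point_count_def)
    qed
    then show ?thesis by (auto simp: cell_def)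
  qed
  also have "emeasure Q0 \<dots> = ennreal (\<Prod>j\<in>?J. poisson_mass (measure \<mu>0 (?A j)) (?k j))"
  proof -
    have disj: "disjoint_family_on ?A ?J"
      unfolding disjoint_family_on_def by (auto simp: dyad_def prod_eq_iff)
    have "?A j \<in> sets borel" "emeasure \<mu>0 (?A j) < \<infinity>" if "j \<in> ?J" for j
      using that B_fin fin0[OF fin sets_dyad] by (auto split: option.splits)
    from ppp_law_product[OF law0 _ this disj, of ?k] show ?thesis
      unfolding Q0.emeasure_eq_measure by simp
  qed
  also have "(\<Prod>j\<in>?J. poisson_mass (measure \<mu>0 (?A j)) (?k j))
      = exp (- measure \<mu>0 B) * (\<Prod>c\<in>dyads l. poisson_mass (measure \<mu>0 (dyad l c - B)) (\<kappa> c))"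
    by (subst prod.insert) (auto simp: prod.reindex poisson_mass_def)
  also have "(\<Prod>c\<in>dyads l. poisson_mass (measure \<mu>0 (dyad l c - B)) (\<kappa> c))
      = (\<Prod>c\<in>dyads l. poisson_mass (measure \<mu>1 (dyad l c)) (\<kappa> c))"
    by (intro prod.cong) (auto simp: measure_def diff)
  also have "ennreal ?e * ennreal (exp (- measure \<mu>0 B) * \<dots>) = ennreal \<dots>"
    by (simp flip: ennreal_mult' mult.assoc exp_add)
  also have "\<dots> = emeasure Q1 (cell l \<kappa>)"
    using fin0[OF fin sets_dyad] by (intro ppp_law_cell[OF law1, symmetric]) (simp add: diff)
  finally show "emeasure Q1 (cell l \<kappa>) = emeasure (density Q0 (\<lambda>S. ennreal ?e * indicator ?V S)) (cell l \<kappa>)" ..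
qed

section \<open>Mixtures of bump curves\<close>

lemma powr_add_le:
  fixes x y a :: real
  assumes "0 \<le> x" "0 \<le> y" "0 < a" "a \<le> 1"
  shows "(x + y) powr a \<le> x powr a + y powr a"
proof (cases "x + y = 0")
  case False
  define s where "s = x + y"
  have s: "s > 0" using assms False unfolding s_def by linarith
  have *: "z / s \<le> (z / s) powr a" if "0 \<le> z" "z \<le> s" for z
    using powr_mono'[of a 1 "z / s"] that s assms by (simp add: divide_le_eq)
  have "1 = x / s + y / s" using s unfolding s_def by (simp add: add_divide_distrib[symmetric])
  also have "\<dots> \<le> (x / s) powr a + (y / s) powr a"
    using assms by (intro add_mono *) (auto simp: s_def)
  also have "\<dots> = (x powr a + y powr a) / s powr a"
    using assms s by (simp add: powr_divide add_divide_distrib)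
  finally show ?thesis using s unfolding s_def[symmetric] by (simp add: field_simps)
qed (use assms in auto)

lemma abs_powr_diff_le:
  fixes x y a :: real
  assumes "0 \<le> x" "0 \<le> y" "0 < a" "a \<le> 1"
  shows "\<bar>x powr a - y powr a\<bar> \<le> \<bar>x - y\<bar> powr a"
proof -
  have *: "\<bar>x powr a - y powr a\<bar> \<le> \<bar>x - y\<bar> powr a" if "0 \<le> x" "x \<le> y" for x y
    using powr_add_le[of x "y - x" a] powr_mono2[of a x y] that assms by auto
  show ?thesis
    using *[of x y] *[of y x] assms by (cases "x \<le> y") (auto simp: abs_minus_commute)
qed

text \<open>With \<open>L\<close> the likelihood ratio of the mixture, the sum of the risks is at least \<open>s * E (min 1 L)\<close>, and
  \<open>min 1 L \<ge> t * L - t\<^sup>2 * L\<^sup>2 / 4\<close> for \<open>0 \<le> t \<le> 1\<close> bounds this below through the first two moments of \<open>L\<close>.\<close>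

lemma mixture_risk_bound:
  fixes T :: "'a \<Rightarrow> real" and lik :: "'i \<Rightarrow> 'a \<Rightarrow> real"
  assumes Q0: "prob_space Q0" and F: "finite F" "F \<noteq> {}"
    and lik [measurable]: "\<And>f. f \<in> F \<Longrightarrow> lik f \<in> borel_measurable Q0"
    and lik_bd: "\<And>f S. f \<in> F \<Longrightarrow> 0 \<le> lik f S \<and> lik f S \<le> C"
    and lik_int: "\<And>f. f \<in> F \<Longrightarrow> (\<integral>S. lik f S \<partial>Q0) = 1"
    and Qf: "\<And>f. f \<in> F \<Longrightarrow> Qf f = density Q0 (\<lambda>S. ennreal (lik f S))"
    and c: "1 \<le> c" "(\<Sum>f\<in>F. \<Sum>f'\<in>F. \<integral>S. lik f S * lik f' S \<partial>Q0) \<le> c * (real (card F))\<^sup>2"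
    and T [measurable]: "T \<in> borel_measurable Q0"
    and s: "0 \<le> s" "\<And>f. f \<in> F \<Longrightarrow> s \<le> \<theta> f"
    and risk0: "(\<integral>\<^sup>+S. ennreal \<bar>T S\<bar> \<partial>Q0) \<le> \<rho>"
    and risk: "\<And>f. f \<in> F \<Longrightarrow> (\<integral>\<^sup>+S. ennreal \<bar>T S - \<theta> f\<bar> \<partial>Qf f) \<le> \<rho>"
  shows "ennreal (3 * s / (8 * c)) \<le> \<rho>"
proof -
  interpret prob_space Q0 by fact
  define K where "K = real (card F)"
  have K: "K > 0" using F by (simp add: K_def card_gt_0_iff)
  define L where "L S = (\<Sum>f\<in>F. lik f S) / K" for S
  \<comment> \<open>The bound \<open>t - t\<^sup>2 * c / 4\<close> is largest at
    \<open>2 / c\<close>, but \<open>t \<le> 1\<close> is required. The choice \<open>1 / c\<close>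
    is admissible since \<open>1 \<le> c\<close>, and yields \<open>3 / (4 * c)\<close>.\<close>
  define t where "t = 1 / c"
  have t: "0 \<le> t" "t \<le> 1" using c by (auto simp: t_def)
  have L_meas [measurable]: "L \<in> borel_measurable Q0" unfolding L_def by measurable
  have L_nonneg: "0 \<le> L S" for S unfolding L_def using lik_bd K by (intro divide_nonneg_pos sum_nonneg) auto
  have int1: "integrable Q0 (lik f)" if "f \<in> F" for f
    using lik_bd[OF that] that by (intro integrable_const_bound[where B = C]) auto
  have int2: "integrable Q0 (\<lambda>S. lik f S * lik f' S)" if "f \<in> F" "f' \<in> F" for f f'
  proof (rule integrable_const_bound[where B = "C * C"])
    have "norm (lik f S * lik f' S) \<le> C * C" for S
      using lik_bd[OF that(1), of S] lik_bd[OF that(2), of S] by (auto simp: abs_mult intro!: mult_mono)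
    then show "AE S in Q0. norm (lik f S * lik f' S) \<le> C * C" by simp
  qed (use that in auto)
  have intL: "integrable Q0 L" unfolding L_def using int1 by auto
  have L2: "(L S)\<^sup>2 = (\<Sum>f\<in>F. \<Sum>f'\<in>F. lik f S * lik f' S) / K\<^sup>2" for S
    by (simp add: L_def power_divide power2_eq_square sum_product)
  have intL2: "integrable Q0 (\<lambda>S. (L S)\<^sup>2)" unfolding L2 using int2 by auto
  have EL: "(\<integral>S. L S \<partial>Q0) = 1"
  proof -
    have "(\<integral>S. L S \<partial>Q0) = (\<Sum>f\<in>F. \<integral>S. lik f S \<partial>Q0) / K"
      unfolding L_def using int1 by simp
    then show ?thesis using lik_int K by (simp add: K_def)
  qed
  have EL2: "(\<integral>S. (L S)\<^sup>2 \<partial>Q0) \<le> c"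
  proof -
    have "(\<integral>S. (L S)\<^sup>2 \<partial>Q0) = (\<Sum>f\<in>F. \<Sum>f'\<in>F. \<integral>S. lik f S * lik f' S \<partial>Q0) / K\<^sup>2"
      unfolding L2 using int2 by simp
    also have "\<dots> \<le> c" using c(2) K by (simp add: divide_le_eq K_def)
    finally show ?thesis .
  qed
  define h where "h S = s * (t * L S - t\<^sup>2 * (L S)\<^sup>2 / 4)" for S
  have int_h: "integrable Q0 h" unfolding h_def using intL intL2 by auto
  have "3 * s / (4 * c) \<le> s * (t - t\<^sup>2 * c / 4)"
    using c(1) by (simp add: t_def power2_eq_square field_simps)
  also have "\<dots> \<le> s * (t - t\<^sup>2 * (\<integral>S. (L S)\<^sup>2 \<partial>Q0) / 4)"
    using s(1) EL2 by (intro mult_left_mono diff_left_mono divide_right_mono) auto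
  also have "\<dots> = (\<integral>S. h S \<partial>Q0)"
    unfolding h_def using intL intL2 EL by simp
  also have "\<dots> \<le> (\<integral>S. max 0 (h S) \<partial>Q0)" using int_h by (intro integral_mono) auto
  finally have "ennreal (3 * s / (4 * c)) \<le> ennreal (\<integral>S. max 0 (h S) \<partial>Q0)" by (rule ennreal_leI)
  also have "\<dots> = (\<integral>\<^sup>+S. ennreal (max 0 (h S)) \<partial>Q0)"
    using int_h by (intro nn_integral_eq_integral[symmetric]) auto
  also have "\<dots> \<le> (\<integral>\<^sup>+S. ennreal \<bar>T S\<bar> + (\<Sum>f\<in>F. ennreal (lik f S) * ennreal \<bar>T S - \<theta> f\<bar>) / ennreal K \<partial>Q0)"
  proof (rule nn_integral_mono)
    fix S
    define a where "a = \<bar>T S\<bar>"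
    \<comment> \<open>If \<open>s \<le> a\<close>, the loss at the zero curve suffices. Otherwise at
      least \<open>s - a\<close> is lost at every curve of the mixture, and the cases
      \<open>L S \<ge> 1\<close> and \<open>L S < 1\<close> correspond to the two arguments of
      \<open>min 1 L\<close>.\<close>
    have "h S \<le> a + L S * max 0 (s - a)"
    proof -
      have tL: "t * L S - t\<^sup>2 * (L S)\<^sup>2 / 4 \<le> 1"
        using zero_le_power2[of "t * L S / 2 - 1"] by (simp add: power2_eq_square algebra_simps)
      have tL': "t * L S - t\<^sup>2 * (L S)\<^sup>2 / 4 \<le> L S"
      proof -
        have "t * L S \<le> L S" using t L_nonneg[of S] mult_right_mono[of t 1 "L S"] by simp
        moreover have "0 \<le> t\<^sup>2 * (L S)\<^sup>2 / 4" by simp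
        ultimately show ?thesis by linarith
      qed
      have h1: "h S \<le> s" unfolding h_def using mult_left_mono[OF tL s(1)] by simp
      have h2: "h S \<le> s * L S" unfolding h_def using mult_left_mono[OF tL' s(1)] by simp
      have a: "0 \<le> a" by (simp add: a_def)
      show ?thesis
      proof (cases "s \<le> a")
        case False
        show ?thesis
        proof (cases "L S \<ge> 1")
          case True
          then have "1 * max 0 (s - a) \<le> L S * max 0 (s - a)" by (intro mult_right_mono) auto
          then have "s - a \<le> L S * max 0 (s - a)" by simp
          then show ?thesis using h1 by linarith
        next
          case L: False
          then show ?thesis using h2 False a mult_right_mono[of "L S" 1 a] by (simp add: algebra_simps)
        qed
      qed (use h1 in simp)
    qed
    also have "L S * max 0 (s - a) \<le> (\<Sum>f\<in>F. lik f S * \<bar>T S - \<theta> f\<bar>) / K"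
    proof -
      have "max 0 (s - a) \<le> \<bar>T S - \<theta> f\<bar>" if "f \<in> F" for f using s(2)[OF that] by (auto simp: a_def)
      then have "(\<Sum>f\<in>F. lik f S * max 0 (s - a)) \<le> (\<Sum>f\<in>F. lik f S * \<bar>T S - \<theta> f\<bar>)"
        using lik_bd by (intro sum_mono mult_left_mono) auto
      then show ?thesis using K unfolding L_def by (simp add: sum_distrib_right[symmetric] divide_right_mono)
    qed
    finally have "max 0 (h S) \<le> a + (\<Sum>f\<in>F. lik f S * \<bar>T S - \<theta> f\<bar>) / K"
      using lik_bd K by (auto simp: a_def intro!: add_nonneg_nonneg divide_nonneg_pos sum_nonneg)
    then have "ennreal (max 0 (h S)) \<le> ennreal (a + (\<Sum>f\<in>F. lik f S * \<bar>T S - \<theta> f\<bar>) / K)" by (rule ennreal_leI)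
    also have "\<dots> = ennreal a + (\<Sum>f\<in>F. ennreal (lik f S) * ennreal \<bar>T S - \<theta> f\<bar>) / ennreal K"
      using lik_bd K
      by (simp add: a_def divide_ennreal[symmetric] sum_nonneg ennreal_mult[symmetric] ennreal_plus)
    finally show "ennreal (max 0 (h S)) \<le> ennreal \<bar>T S\<bar> + (\<Sum>f\<in>F. ennreal (lik f S) * ennreal \<bar>T S - \<theta> f\<bar>) / ennreal K"
      by (simp add: a_def)
  qed
  also have "\<dots> = (\<integral>\<^sup>+S. ennreal \<bar>T S\<bar> \<partial>Q0)
      + (\<Sum>f\<in>F. \<integral>\<^sup>+S. ennreal (lik f S) * ennreal \<bar>T S - \<theta> f\<bar> \<partial>Q0) / ennreal K"
    by (simp add: nn_integral_add nn_integral_divide nn_integral_sum)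
  also have "\<dots> \<le> \<rho> + (\<Sum>f\<in>F. \<rho>) / ennreal K"
  proof (intro add_mono risk0 divide_right_mono_ennreal sum_mono)
    fix f assume f: "f \<in> F"
    have "(\<integral>\<^sup>+S. ennreal (lik f S) * ennreal \<bar>T S - \<theta> f\<bar> \<partial>Q0) = (\<integral>\<^sup>+S. ennreal \<bar>T S - \<theta> f\<bar> \<partial>Qf f)"
      unfolding Qf[OF f] using f by (intro nn_integral_density[symmetric]) auto
    then show "(\<integral>\<^sup>+S. ennreal (lik f S) * ennreal \<bar>T S - \<theta> f\<bar> \<partial>Q0) \<le> \<rho>" using risk[OF f] by simp
  qed
  also have "(\<Sum>f\<in>F. \<rho>) / ennreal K = \<rho> * ennreal K / ennreal K"
    by (simp add: K_def ennreal_of_nat_eq_real_of_nat mult.commute)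
  also have "\<dots> = \<rho>" using K by (intro ennreal_mult_divide_eq) auto
  \<comment> \<open>The zero curve and the average over \<open>F\<close> contribute at most
    \<open>\<rho>\<close> each; halving turns the 4 of the constant into 8.\<close>
  finally have *: "ennreal (3 * s / (4 * c)) \<le> \<rho> * 2" by (simp add: mult_2_right)
  have "ennreal (3 * s / (8 * c)) = ennreal (3 * s / (4 * c)) / 2"
    using s(1) c(1) by (simp add: divide_ennreal flip: ennreal_numeral)
  also have "\<dots> \<le> \<rho> * 2 / 2" using * by (rule divide_right_mono_ennreal)
  also have "\<dots> = \<rho>" by (intro ennreal_mult_divide_eq) auto
  finally show ?thesis .
qed

text \<open>The unit interval is cut into \<open>k\<^sup>2\<close> cells, grouped into \<open>k\<close> blocks of \<open>k\<close> cells; \<open>f\<close> selects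
  one cell in every block.  All curves then have the same norm, and the overlap of two uniformly
  chosen ones is a sum of \<open>k\<close> independent indicators of probability \<open>1 / k\<close>.\<close>

definition bump_cells :: "nat \<Rightarrow> (nat \<Rightarrow> nat) \<Rightarrow> real set" where
  "bump_cells k f = (\<Union>i<k. {real (i * k + f i) / (real k)\<^sup>2 <..< (real (i * k + f i) + 1) / (real k)\<^sup>2})"

text \<open>The distance to a set is 1-Lipschitz, so this power of it lies in the ball whatever
  cells are selected, with no case distinction between neighbouring cells.\<close>

definition bump :: "real \<Rightarrow> real \<Rightarrow> nat \<Rightarrow> (nat \<Rightarrow> nat) \<Rightarrow> real \<Rightarrow> real" where
  "bump \<beta> R k f x = R * infdist x (- bump_cells k f) powr \<beta>"

text \<open>Grid points are the nearby points of the complement that bound the height of a bump.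
  They also make the complement nonempty, which matters because \<open>infdist\<close> to the empty
  set is 0 by default.\<close>

lemma grid_notin_bump_cells: "real m / (real k)\<^sup>2 \<notin> bump_cells k f"
proof
  assume "real m / (real k)\<^sup>2 \<in> bump_cells k f"
  then obtain i where i: "i < k" "real (i * k + f i) / (real k)\<^sup>2 < real m / (real k)\<^sup>2"
    "real m / (real k)\<^sup>2 < (real (i * k + f i) + 1) / (real k)\<^sup>2"
    unfolding bump_cells_def by auto
  then have "(real k)\<^sup>2 > 0" by auto
  with i have "real (i * k + f i) < real m" "real m < real (i * k + f i) + 1"
    by (simp_all add: divide_less_cancel)
  then have "real (i * k + f i) < real m" "real m < real (i * k + f i + 1)" by simp_all
  then show False unfolding of_nat_less_iff by simp
qed

lemma compl_bump_cells_nonempty: "- bump_cells k f \<noteq> {}"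
  using grid_notin_bump_cells[of 0 k f] by auto

lemma bump_nonneg: "0 \<le> R \<Longrightarrow> 0 \<le> bump \<beta> R k f x"
  by (simp add: bump_def)

lemma bump_zero: "x \<notin> bump_cells k f \<Longrightarrow> 0 < \<beta> \<Longrightarrow> bump \<beta> R k f x = 0"
  by (simp add: bump_def)

lemma bump_le:
  assumes "0 \<le> R" "0 < \<beta>"
  shows "bump \<beta> R k f x \<le> R * (1 / (real k)\<^sup>2) powr \<beta>"
proof (cases "x \<in> bump_cells k f")
  case True
  then obtain i where i: "real (i * k + f i) / (real k)\<^sup>2 < x" "x < (real (i * k + f i) + 1) / (real k)\<^sup>2"
    unfolding bump_cells_def by auto
  have "infdist x (- bump_cells k f) \<le> dist x (real (i * k + f i) / (real k)\<^sup>2)"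
    using grid_notin_bump_cells[of "i * k + f i" k f] by (intro infdist_le) auto
  also have "\<dots> \<le> 1 / (real k)\<^sup>2" using i by (simp add: dist_real_def add_divide_distrib)
  finally show ?thesis
    unfolding bump_def using assms by (intro mult_left_mono powr_mono2) (auto simp: infdist_nonneg)
qed (use assms bump_zero[of x k f \<beta> R] in auto)

text \<open>On the middle half of a cell the distance to the complement is at least a quarter of the
  width.\<close>

lemma bump_ge:
  assumes "0 \<le> R" "0 < \<beta>" and i: "i < k"
    and x: "(real (i * k + f i) + 1 / 4) / (real k)\<^sup>2 \<le> x" "x \<le> (real (i * k + f i) + 3 / 4) / (real k)\<^sup>2"
  shows "R * (1 / (4 * (real k)\<^sup>2)) powr \<beta> \<le> bump \<beta> R k f x"
proof -
  let ?m = "real (i * k + f i)" and ?w = "1 / (4 * (real k)\<^sup>2)"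
  have "?w \<le> dist x y" if "y \<in> - bump_cells k f" for y
  proof (rule ccontr)
    assume "\<not> ?w \<le> dist x y"
    then have "\<bar>x - y\<bar> < ?w" by (simp add: dist_real_def)
    moreover have "?m / (real k)\<^sup>2 + ?w \<le> x" "x \<le> (?m + 1) / (real k)\<^sup>2 - ?w"
    proof -
      have "(m + 1 / 4) / K = m / K + 1 / (4 * K)" "(m + 3 / 4) / K = (m + 1) / K - 1 / (4 * K)"
        if "0 < K" for m K :: real
        using that by (simp_all add: field_simps)
      then show "?m / (real k)\<^sup>2 + ?w \<le> x" "x \<le> (?m + 1) / (real k)\<^sup>2 - ?w"
        using i x by simp_all
    qed
    moreover have "a < y \<and> y < b" if "\<bar>x - y\<bar> < w" "a + w \<le> x" "x \<le> b - w" for a b w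
      using that by auto
    ultimately have "?m / (real k)\<^sup>2 < y" "y < (?m + 1) / (real k)\<^sup>2" by blast+
    then have "y \<in> bump_cells k f" unfolding bump_cells_def using i by auto
    then show False using that by simp
  qed
  then have "?w \<le> infdist x (- bump_cells k f)"
    unfolding infdist_notempty[OF compl_bump_cells_nonempty]
    by (intro cINF_greatest compl_bump_cells_nonempty)
  then show ?thesis unfolding bump_def using assms by (intro mult_left_mono powr_mono2) auto
qed

lemma bump_hoelder:
  assumes "0 \<le> R" "0 < \<beta>" "\<beta> \<le> 1"
  shows "bump \<beta> R k f \<in> hoelder_ball \<beta> R"
proof -
  let ?d = "\<lambda>x. infdist x (- bump_cells k f)"
  have "\<bar>bump \<beta> R k f x - bump \<beta> R k f y\<bar> \<le> R * \<bar>x - y\<bar> powr \<beta>" for x y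
  proof -
    have "\<bar>?d x - ?d y\<bar> \<le> \<bar>x - y\<bar>"
      using infdist_triangle[of x "- bump_cells k f" y] infdist_triangle[of y "- bump_cells k f" x]
      by (simp add: dist_real_def abs_minus_commute)
    have "\<bar>bump \<beta> R k f x - bump \<beta> R k f y\<bar> = R * \<bar>?d x powr \<beta> - ?d y powr \<beta>\<bar>"
      using assms by (simp add: bump_def right_diff_distrib[symmetric] abs_mult)
    also have "\<dots> \<le> R * \<bar>?d x - ?d y\<bar> powr \<beta>"
      using assms by (intro mult_left_mono abs_powr_diff_le) (auto simp: infdist_nonneg)
    also have "\<dots> \<le> R * \<bar>x - y\<bar> powr \<beta>"
      using assms \<open>\<bar>?d x - ?d y\<bar> \<le> \<bar>x - y\<bar>\<close> by (intro mult_left_mono powr_mono2) auto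
    finally show ?thesis .
  qed
  then show ?thesis unfolding hoelder_ball_def by auto
qed

lemma block_index_inj:
  fixes i i' j j' k :: nat
  assumes "i * k + j = i' * k + j'" "j < k" "j' < k"
  shows "i = i'" "j = j'"
proof -
  have "(j + i * k) div k = i" "(j' + i' * k) div k = i'" using assms(2,3) by auto
  then show "i = i'" using assms(1) by (simp add: add.commute)
  then show "j = j'" using assms by simp
qed

text \<open>The middle halves of the \<open>k\<close> selected cells are disjoint and have total
  length \<open>1 / (2 * k)\<close>; on them \<open>bump_ge\<close> applies.\<close>

lemma Lp_norm_bump_ge:
  assumes R: "0 < R" "0 < \<beta>" "\<beta> \<le> 1" and p: "1 \<le> p" and k: "1 \<le> k"
    and f: "\<And>i. i < k \<Longrightarrow> f i < k"
  shows "(1 / (2 * real k)) powr (1 / p) * (R * (1 / (4 * (real k)\<^sup>2)) powr \<beta>) \<le> Lp_norm p (bump \<beta> R k f)"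
proof -
  let ?c = "R * (1 / (4 * (real k)\<^sup>2)) powr \<beta>"
  define I where "I i = {(real (i * k + f i) + 1 / 4) / (real k)\<^sup>2 .. (real (i * k + f i) + 3 / 4) / (real k)\<^sup>2}" for i
  have c: "0 < ?c" using R k by simp
  have k2: "0 < (real k)\<^sup>2" using k by simp
  have sub: "I i \<subseteq> {0..1}" if i: "i < k" for i
  proof -
    have "i * k + f i + 1 \<le> (i + 1) * k" using f[OF i] by simp
    also have "\<dots> \<le> k * k" using i by (intro mult_right_mono) auto
    finally have "real (i * k + f i + 1) \<le> real (k * k)" by (rule of_nat_mono)
    then have "(real (i * k + f i) + 3 / 4) / (real k)\<^sup>2 \<le> 1"
      using k2 by (simp add: divide_le_eq power2_eq_square)
    moreover have "0 \<le> (real (i * k + f i) + 1 / 4) / (real k)\<^sup>2" by simp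
    ultimately show ?thesis unfolding I_def by auto
  qed
  have disj: "disjoint_family_on I {..<k}"
    unfolding disjoint_family_on_def
  proof (intro ballI impI)
    fix i i' assume i: "i \<in> {..<k}" "i' \<in> {..<k}" "i \<noteq> i'"
    have "i * k + f i \<noteq> i' * k + f i'" using block_index_inj(1)[of i k "f i" i' "f i'"] f i by auto
    then have "real (i * k + f i) + 1 \<le> real (i' * k + f i') \<or> real (i' * k + f i') + 1 \<le> real (i * k + f i)" by linarith
    then have "(real (i * k + f i) + 3 / 4) / (real k)\<^sup>2 < (real (i' * k + f i') + 1 / 4) / (real k)\<^sup>2
      \<or> (real (i' * k + f i') + 3 / 4) / (real k)\<^sup>2 < (real (i * k + f i) + 1 / 4) / (real k)\<^sup>2"
      using k2 by (auto simp: divide_less_cancel)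
    then show "I i \<inter> I i' = {}" unfolding I_def by auto
  qed
  have len: "measure lborel (I i) = 1 / (2 * (real k)\<^sup>2)" for i
    using k2 by (simp add: I_def divide_right_mono field_simps)
  have "measure lborel (\<Union>i<k. I i) = (\<Sum>i<k. measure lborel (I i))"
  proof (rule measure_finite_Union[OF _ _ disj])
    show "emeasure lborel (I i) \<noteq> \<infinity>" for i unfolding I_def by (simp add: emeasure_lborel_Icc_eq)
  qed (auto simp: I_def)
  also have "\<dots> = 1 / (2 * real k)" using k by (simp add: len power2_eq_square)
  finally have meas: "measure lborel (\<Union>i<k. I i) = 1 / (2 * real k)" .
  have cont: "continuous_on {0..1} (\<lambda>x. \<bar>bump \<beta> R k f x\<bar> powr p)"
    using continuous_on_hoelder_ball[OF bump_hoelder, of R \<beta> k f] R p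
    by (intro continuous_on_powr' continuous_intros) auto
  have "?c powr p * (1 / (2 * real k)) = (LINT x|lborel. ?c powr p * indicator (\<Union>i<k. I i) x)"
    using meas by simp
  also have "\<dots> \<le> (LINT x:{0..1}|lborel. \<bar>bump \<beta> R k f x\<bar> powr p)"
    unfolding set_lebesgue_integral_def
  proof (rule integral_mono)
    have "bounded (\<Union>i<k. I i)" using sub by (intro bounded_subset[OF bounded_closed_interval[of 0 1]]) auto
    then have "emeasure lborel (\<Union>i<k. I i) < \<infinity>" by (rule emeasure_bounded_finite)
    then show "integrable lborel (\<lambda>x. ?c powr p * indicator (\<Union>i<k. I i) x)"
      by (auto simp: I_def)
    show "integrable lborel (\<lambda>x. indicat_real {0..1} x *\<^sub>R \<bar>bump \<beta> R k f x\<bar> powr p)"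
      using borel_integrable_compact[OF _ cont] by simp
    fix x
    show "?c powr p * indicator (\<Union>i<k. I i) x \<le> indicat_real {0..1} x *\<^sub>R \<bar>bump \<beta> R k f x\<bar> powr p"
    proof (cases "x \<in> (\<Union>i<k. I i)")
      case True
      then obtain i where i: "i < k" "x \<in> I i" by auto
      have "?c \<le> bump \<beta> R k f x" using i R by (intro bump_ge) (auto simp: I_def)
      then show ?thesis using True sub[OF i(1)] i c p by (auto intro!: powr_mono2 simp: indicator_def)
    qed (auto simp: indicator_def)
  qed
  finally have "(?c powr p * (1 / (2 * real k))) powr (1 / p) \<le> Lp_norm p (bump \<beta> R k f)"
    unfolding Lp_norm_def using p by (intro powr_mono2) auto
  also have "(?c powr p * (1 / (2 * real k))) powr (1 / p) = (1 / (2 * real k)) powr (1 / p) * ?c"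
  proof -
    have "(a powr p * b) powr (1 / p) = b powr (1 / p) * a" if "0 < a" "0 < b" for a b
      using that p by (simp add: powr_mult powr_powr)
    from this[OF c, of "1 / (2 * real k)"] show ?thesis using k by simp
  qed
  finally show ?thesis .
qed

section \<open>The lower bound\<close>

lemma zero_in_hoelder_ball: "0 \<le> R \<Longrightarrow> (\<lambda>_. 0) \<in> hoelder_ball \<beta> R"
  by (simp add: hoelder_ball_def)

text \<open>Condition \<open>nk\<close> gives mass at most \<open>R\<close> to a box over one cell
  that is as high as a bump can be. A shared cell thus costs at most a factor \<open>exp R\<close>
  in the second moment. In each block two selections agree with probability \<open>1 / k\<close>, so
  the moment is at most \<open>(1 + exp R / k) ^ k\<close>, hence at most
  \<open>exp (exp R)\<close>.\<close>

lemma max_risk_ge_bump: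
  fixes Pn :: "(real \<Rightarrow> real) \<Rightarrow> (real \<times> real) set measure"
  assumes \<beta>: "0 < \<beta>" "\<beta> \<le> 1" and R: "0 < R" and p: "1 \<le> p" and k: "1 \<le> k"
    and nk: "real n * (1 / (real k)\<^sup>2) powr (\<beta> + 1) \<le> 1"
    and law: "\<And>g. g \<in> hoelder_ball \<beta> R \<Longrightarrow> is_ppp_law (intensity n g) (Pn g)"
    and T: "T \<in> borel_measurable config_space"
  shows "ennreal (3 * ((1 / (2 * real k)) powr (1 / p) * (R * (1 / (4 * (real k)\<^sup>2)) powr \<beta>)) / (8 * exp (exp R)))
    \<le> max_risk \<beta> R p Pn T"
proof -
  define g where "g f = bump \<beta> R k f" for f
  define F where "F = {..<k} \<rightarrow>\<^sub>E {..<k}"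
  define z :: "real \<Rightarrow> real" where "z = (\<lambda>_. 0)"
  define \<mu> where "\<mu> = intensity n z"
  define B where "B f = support_region z - support_region (g f)" for f
  define b where "b f = measure \<mu> (B f)" for f
  define V where "V f = {S \<in> configs. point_count (B f) S = 0}" for f
  define lik where "lik f S = exp (b f) * indicat_real (V f) S" for f S
  define w where "w = 1 / (real k)\<^sup>2"
  have w: "0 < w" using k by (simp add: w_def)
  have z_ball: "z \<in> hoelder_ball \<beta> R" unfolding z_def using R by (intro zero_in_hoelder_ball) auto
  have g_ball: "g f \<in> hoelder_ball \<beta> R" for f unfolding g_def using R \<beta> by (intro bump_hoelder) auto
  have z_cont: "continuous_on {0..1} z" unfolding z_def by simp
  have g_cont: "continuous_on {0..1} (g f)" for f using continuous_on_hoelder_ball[OF g_ball \<beta>(1)] .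
  have g_nonneg: "0 \<le> g f x" for f x unfolding g_def using R by (intro bump_nonneg) simp
  have g_le: "g f x \<le> R * w powr \<beta>" for f x unfolding g_def w_def using R \<beta> by (intro bump_le) auto
  note [measurable] = sets_support_region[OF z_cont] sets_support_region[OF g_cont]
  have B_sets [measurable]: "B f \<in> sets borel" for f unfolding B_def by measurable
  have B_iff: "(x, y) \<in> B f \<longleftrightarrow> x \<in> {0..1} \<and> 0 \<le> y \<and> y < g f x" for x y f
    by (auto simp: B_def support_region_def z_def)
  have B_bounded: "bounded (B f)" for f
  proof (rule bounded_subset)
    show "B f \<subseteq> {0..1} \<times> {0..R * w powr \<beta>}"
    proof
      fix v assume v: "v \<in> B f"
      obtain x y where xy: "v = (x, y)" by (cases v)
      have "x \<in> {0..1}" "0 \<le> y" "y < g f x" using v unfolding xy B_iff by auto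
      then show "v \<in> {0..1} \<times> {0..R * w powr \<beta>}" using g_le[of f x] unfolding xy by auto
    qed
  qed (intro bounded_Times bounded_closed_interval)
  have fin: "emeasure \<mu> A < \<infinity>" if "A \<in> sets borel" "bounded A" for A
    unfolding \<mu>_def using emeasure_intensity_finite[OF z_cont that] .
  have fin_dyad: "emeasure \<mu> (dyad l c) < \<infinity>" for l c by (intro fin sets_dyad bounded_dyad)
  have law0: "is_ppp_law \<mu> (Pn z)" unfolding \<mu>_def using law[OF z_ball] .
  interpret Q0: prob_space "Pn z" using is_ppp_lawD(1)[OF law0] .
  note sQ0 [measurable_cong] = is_ppp_lawD(2)[OF law0]
  have V_meas [measurable]: "V f \<in> sets config_space" for f
  proof -
    have "{S \<in> space config_space. point_count (B f) S = 0} \<in> sets config_space" by measurable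
    then show ?thesis by (simp add: V_def)
  qed
  have dens: "Pn (g f) = density (Pn z) (\<lambda>S. ennreal (lik f S))" for f
  proof -
    have "Pn (g f) = density (Pn z) (\<lambda>S. ennreal (exp (measure \<mu> (B f)))
        * indicator {S \<in> configs. point_count (B f) S = 0} S)"
    proof (rule ppp_law_density[OF law0 law[OF g_ball] fin_dyad])
      show "emeasure \<mu> (B f) < \<infinity>" by (intro fin B_sets B_bounded)
      fix A :: "(real \<times> real) set" assume A: "A \<in> sets borel"
      have eq: "(A - B f) \<inter> support_region z = A \<inter> support_region (g f)"
        using g_nonneg[of f] unfolding B_def support_region_def z_def by (auto intro: order_trans)
      have "A - B f \<in> sets borel" using A by auto
      then show "emeasure (intensity n (g f)) A = emeasure \<mu> (A - B f)"
        unfolding \<mu>_def using A emeasure_intensity[OF g_cont A] emeasure_intensity[OF z_cont] by (simp add: eq)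
    qed (auto simp: \<mu>_def)
    also have "(\<lambda>S. ennreal (exp (measure \<mu> (B f))) * indicator {S \<in> configs. point_count (B f) S = 0} S)
        = (\<lambda>S. ennreal (lik f S))"
      by (auto simp: lik_def b_def V_def indicator_def)
    finally show ?thesis .
  qed
  \<comment> \<open>The product is nonzero only if the union of both regions is void, and
    inclusion-exclusion leaves the mass of the intersection in the exponent.\<close>
  have lik_int2: "(\<integral>S. lik f S * lik f' S \<partial>Pn z) = exp (measure \<mu> (B f \<inter> B f'))" for f f'
  proof -
    have BB: "B f \<union> B f' \<in> sets borel" "bounded (B f \<union> B f')" using B_bounded by auto
    have V: "V f \<inter> V f' = {S \<in> configs. point_count (B f \<union> B f') S = 0}"
      by (auto simp: V_def point_count_def Int_Un_distrib emeasure_count_space split: if_splits)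
    have "(\<integral>S. lik f S * lik f' S \<partial>Pn z) = (\<integral>S. exp (b f + b f') * indicat_real (V f \<inter> V f') S \<partial>Pn z)"
      by (intro Bochner_Integration.integral_cong) (auto simp: lik_def indicator_def exp_add)
    also have "\<dots> = exp (b f + b f') * measure (Pn z) (V f \<inter> V f')"
      by (simp add: sQ0 sets.Int is_ppp_lawD(3)[OF law0] Int_absorb2 V_def subset_eq)
    also have "measure (Pn z) (V f \<inter> V f') = exp (- measure \<mu> (B f \<union> B f'))"
      unfolding V by (rule void_probability[OF law0 BB(1) fin[OF BB]])
    also have "measure \<mu> (B f \<union> B f') = b f + b f' - measure \<mu> (B f \<inter> B f')"
      unfolding b_def using fin[OF B_sets B_bounded]
      by (intro measure_Un3) (auto simp: fmeasurable_def \<mu>_def less_top)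
    finally show ?thesis by (simp flip: exp_add)
  qed
  have V_prob: "measure (Pn z) (V f) = exp (- b f)" for f
    unfolding V_def b_def by (rule void_probability[OF law0 B_sets fin[OF B_sets B_bounded]])
  have overlap: "measure \<mu> (B f \<inter> B f') \<le> (\<Sum>i<k. if f i = f' i then R else 0)"
    if f: "f \<in> F" "f' \<in> F" for f f'
  proof -
    let ?I = "{i. i < k \<and> f i = f' i}"
    define C where "C i = {real (i * k + f i) / (real k)\<^sup>2 <..< (real (i * k + f i) + 1) / (real k)\<^sup>2} \<times> {0..R * w powr \<beta>}" for i
    have C_sets: "C i \<in> sets borel" for i
      unfolding C_def borel_prod[symmetric] by (intro pair_measureI) auto
    have "B f \<inter> B f' \<subseteq> (\<Union>i\<in>?I. C i)"
    proof
      fix v assume v: "v \<in> B f \<inter> B f'"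
      obtain x y where xy: "v = (x, y)" by (cases v)
      have y: "0 \<le> y" "y < g f x" "y < g f' x" using v unfolding xy by (auto simp: B_iff)
      \<comment> \<open>A point below both curves lies over a cell of each selection. Overlapping
        cells of the grid coincide, and the index of a cell determines its block and its position
        there.\<close>
      have "x \<in> bump_cells k f" "x \<in> bump_cells k f'"
        using y bump_zero[of x k f \<beta> R] bump_zero[of x k f' \<beta> R] \<beta> unfolding g_def by force+
      then obtain i i' where i: "i < k" "real (i * k + f i) / (real k)\<^sup>2 < x" "x < (real (i * k + f i) + 1) / (real k)\<^sup>2"
        and i': "i' < k" "real (i' * k + f' i') / (real k)\<^sup>2 < x" "x < (real (i' * k + f' i') + 1) / (real k)\<^sup>2"
        unfolding bump_cells_def by auto
      have "real (i * k + f i) / (real k)\<^sup>2 < (real (i' * k + f' i') + 1) / (real k)\<^sup>2"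
        "real (i' * k + f' i') / (real k)\<^sup>2 < (real (i * k + f i) + 1) / (real k)\<^sup>2"
        using i i' by linarith+
      then have "real (i * k + f i) < real (i' * k + f' i' + 1)" "real (i' * k + f' i') < real (i * k + f i + 1)"
        using k by (auto simp: divide_less_cancel)
      then have "i * k + f i = i' * k + f' i'" unfolding of_nat_less_iff by simp
      moreover have "f i < k" "f' i' < k" using f i i' by (auto simp: F_def)
      ultimately have "i = i'" "f i = f' i'" using block_index_inj by blast+
      moreover have "y \<le> R * w powr \<beta>" using g_le[of f x] y by simp
      ultimately show "v \<in> (\<Union>i\<in>?I. C i)" using i y unfolding xy C_def by auto
    qed
    then have "emeasure \<mu> (B f \<inter> B f') \<le> emeasure \<mu> (\<Union>i\<in>?I. C i)"
      using C_sets by (intro emeasure_mono) (auto simp: \<mu>_def)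
    also have "\<dots> \<le> (\<Sum>i\<in>?I. emeasure \<mu> (C i))"
      using C_sets by (intro emeasure_subadditive_finite) (auto simp: \<mu>_def)
    also have "\<dots> \<le> (\<Sum>i\<in>?I. ennreal R)"
    proof (rule sum_mono)
      fix i
      have "emeasure \<mu> (C i) = of_nat n * emeasure lborel (C i \<inter> support_region z)"
        unfolding \<mu>_def using C_sets by (intro emeasure_intensity z_cont) simp
      also have "\<dots> \<le> of_nat n * emeasure (lborel \<Otimes>\<^sub>M lborel) (C i)"
        unfolding lborel_prod using C_sets by (intro mult_left_mono emeasure_mono) auto
      also have "emeasure (lborel \<Otimes>\<^sub>M lborel) (C i) = ennreal w * ennreal (R * w powr \<beta>)"
        unfolding C_def using R w k
        by (subst lborel.emeasure_pair_measure_Times)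
          (auto simp: w_def divide_right_mono diff_divide_distrib[symmetric])
      also have "of_nat n * \<dots> = ennreal (R * (real n * w powr (\<beta> + 1)))"
        using R w by (simp add: ennreal_of_nat_eq_real_of_nat powr_add mult_ac flip: ennreal_mult)
      also have "\<dots> \<le> ennreal R"
        using nk R mult_left_mono[of "real n * w powr (\<beta> + 1)" 1 R] unfolding w_def by (intro ennreal_leI) auto
      finally show "emeasure \<mu> (C i) \<le> ennreal R" .
    qed
    also have "\<dots> = ennreal (\<Sum>i\<in>?I. R)" using R by (intro sum_ennreal) auto
    also have "(\<Sum>i\<in>?I. R) = (\<Sum>i<k. if f i = f' i then R else 0)"
      by (subst sum.inter_filter[symmetric]) (auto intro!: sum.cong)
    finally show ?thesis
      unfolding measure_def using R by (intro enn2real_leI) (auto intro!: sum_nonneg)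
  qed
  have F: "finite F" "F \<noteq> {}" "card F = k ^ k"
    using k unfolding F_def by (auto intro!: finite_PiE simp: card_PiE PiE_eq_empty_iff)
  show ?thesis
  proof (rule mixture_risk_bound[where ?Q0.0 = "Pn z" and F = F and lik = lik and Qf = "\<lambda>f. Pn (g f)"
        and C = "exp (Max (b ` F))" and T = T and \<theta> = "\<lambda>f. Lp_norm p (g f)"])
    show "prob_space (Pn z)" by (rule Q0.prob_space_axioms)
    show "finite F" "F \<noteq> {}" by fact+
    show "lik f \<in> borel_measurable (Pn z)" for f unfolding lik_def by measurable
    \<comment> \<open>This bound only serves integrability; its size does not enter the
      result.\<close>
    show "0 \<le> lik f S \<and> lik f S \<le> exp (Max (b ` F))" if "f \<in> F" for f S
      using that F by (auto simp: lik_def indicator_def)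
    show "(\<integral>S. lik f S \<partial>Pn z) = 1" for f
    proof -
      have "(\<integral>S. lik f S \<partial>Pn z) = exp (b f) * measure (Pn z) (V f)"
        unfolding lik_def by (simp add: is_ppp_lawD(3)[OF law0] Int_absorb2 V_def subset_eq)
      then show ?thesis by (simp add: V_prob flip: exp_add)
    qed
    show "Pn (g f) = density (Pn z) (\<lambda>S. ennreal (lik f S))" for f by (rule dens)
    show "1 \<le> exp (exp R)" by simp
    show "(\<Sum>f\<in>F. \<Sum>f'\<in>F. \<integral>S. lik f S * lik f' S \<partial>Pn z) \<le> exp (exp R) * (real (card F))\<^sup>2"
    proof -
      have "(\<Sum>f'\<in>F. \<integral>S. lik f S * lik f' S \<partial>Pn z) \<le> exp (exp R) * real (card F)" if f: "f \<in> F" for f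
      proof -
        have "(\<Sum>f'\<in>F. \<integral>S. lik f S * lik f' S \<partial>Pn z) \<le> (\<Sum>f'\<in>F. \<Prod>i<k. exp (if f i = f' i then R else 0))"
          using overlap[OF f] by (intro sum_mono) (simp add: lik_int2 flip: exp_sum)
        \<comment> \<open>\<open>F\<close> is a product set, so the sum over \<open>f'\<close>
          factorises over the blocks.\<close>
        also have "\<dots> = (\<Prod>i<k. \<Sum>j<k. exp (if f i = j then R else 0))"
          unfolding F_def by (subst prod_sum_PiE) auto
        also have "\<dots> = (\<Prod>i<k. exp R + (real k - 1))"
        proof (rule prod.cong)
          fix i assume "i \<in> {..<k}"
          then have fi: "f i \<in> {..<k}" using f by (auto simp: F_def)
          have "(\<Sum>j<k. exp (if f i = j then R else 0)) = exp R + (\<Sum>j\<in>{..<k} - {f i}. exp (if f i = j then R else 0))"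
            using fi by (subst sum.remove[of _ "f i"]) auto
          also have "(\<Sum>j\<in>{..<k} - {f i}. exp (if f i = j then R else 0)) = (\<Sum>j\<in>{..<k} - {f i}. 1)"
            by (intro sum.cong) auto
          also have "\<dots> = real k - 1" using fi k by (simp add: of_nat_diff)
          finally show "(\<Sum>j<k. exp (if f i = j then R else 0)) = exp R + (real k - 1)" .
        qed simp
        also have "\<dots> = (exp R + (real k - 1)) ^ k" by simp
        also have "\<dots> \<le> (real k * exp (exp R / real k)) ^ k"
        proof (rule power_mono)
          have "real k * (1 + exp R / real k) \<le> real k * exp (exp R / real k)"
            by (intro mult_left_mono exp_ge_add_one_self) auto
          then show "exp R + (real k - 1) \<le> real k * exp (exp R / real k)"
            using k by (simp add: algebra_simps)
          show "0 \<le> exp R + (real k - 1)" using k by (intro add_nonneg_nonneg) auto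
        qed
        also have "\<dots> = real (k ^ k) * exp (exp R)"
          using k by (simp add: power_mult_distrib exp_of_nat_mult[symmetric])
        finally show ?thesis using F by (simp add: mult.commute)
      qed
      then have "(\<Sum>f\<in>F. \<Sum>f'\<in>F. \<integral>S. lik f S * lik f' S \<partial>Pn z) \<le> (\<Sum>f\<in>F. exp (exp R) * real (card F))"
        by (rule sum_mono)
      then show ?thesis by (simp add: power2_eq_square mult_ac)
    qed
    show "T \<in> borel_measurable (Pn z)" using T by (simp cong: measurable_cong_sets add: sQ0)
    show "0 \<le> (1 / (2 * real k)) powr (1 / p) * (R * (1 / (4 * (real k)\<^sup>2)) powr \<beta>)" using R by simp
    show "(1 / (2 * real k)) powr (1 / p) * (R * (1 / (4 * (real k)\<^sup>2)) powr \<beta>) \<le> Lp_norm p (g f)" if "f \<in> F" for f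
      unfolding g_def using that by (intro Lp_norm_bump_ge R \<beta> p k) (auto simp: F_def)
    show "(\<integral>\<^sup>+S. ennreal \<bar>T S - Lp_norm p (g f)\<bar> \<partial>Pn (g f)) \<le> max_risk \<beta> R p Pn T" for f
      unfolding max_risk_def using g_ball[of f] by (rule SUP_upper)
    have "(\<integral>\<^sup>+S. ennreal \<bar>T S - Lp_norm p z\<bar> \<partial>Pn z) \<le> max_risk \<beta> R p Pn T"
      unfolding max_risk_def using z_ball by (rule SUP_upper)
    moreover have "Lp_norm p z = 0" unfolding Lp_norm_def z_def by (simp add: set_lebesgue_integral_def)
    ultimately show "(\<integral>\<^sup>+S. ennreal \<bar>T S\<bar> \<partial>Pn z) \<le> max_risk \<beta> R p Pn T" by simp
  qed
qed

text \<open>The exponent \<open>\<theta>\<close> solves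
  \<open>real n = v powr (2 * (\<beta> + 1))\<close>, so rounding \<open>v\<close> up to
  \<open>k\<close> meets the mass condition of \<open>max_risk_ge_bump\<close>. Since
  \<open>k \<le> 2 * v\<close>, rounding costs only the constants \<open>1 / 4\<close> and
  \<open>1 / 16\<close>.\<close>

theorem minimax_risk_lower:
  fixes \<beta> R p :: real
  assumes \<beta>: "0 < \<beta>" "\<beta> \<le> 1" and R: "0 < R" and p: "1 \<le> p"
  shows "\<exists>c>0. \<forall>P. ppp_model \<beta> R P \<longrightarrow> (\<forall>n\<ge>1.
    ennreal (c * real n powr (- ((\<beta> + 1 / (2 * p)) / (\<beta> + 1)))) \<le> minimax_risk \<beta> R p (P n))"
proof (intro exI conjI allI impI)
  define K where "K = 3 / (8 * exp (exp R))"
  let ?c = "K * ((1 / 4) powr (1 / p) * (R * (1 / 16) powr \<beta>))"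
  show "0 < ?c" using R by (simp add: K_def)
  fix P and n :: nat
  assume P: "ppp_model \<beta> R P" and n: "1 \<le> n"
  define \<theta> where "\<theta> = 1 / (2 * (\<beta> + 1))"
  define v where "v = real n powr \<theta>"
  define k where "k = nat \<lceil>v\<rceil>"
  have v: "1 \<le> v" unfolding v_def \<theta>_def using n \<beta> by (intro ge_one_powr_ge_zero) auto
  have k: "1 \<le> k" "v \<le> real k" "real k \<le> 2 * v" using v unfolding k_def by linarith+
  have nk: "real n * (1 / (real k)\<^sup>2) powr (\<beta> + 1) \<le> 1"
  proof -
    have "real n = v powr (2 * (\<beta> + 1))" unfolding v_def \<theta>_def using n \<beta> by (simp add: powr_powr)
    also have "\<dots> \<le> real k powr (2 * (\<beta> + 1))" using k v \<beta> by (intro powr_mono2) auto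
    also have "\<dots> = (real k powr 2) powr (\<beta> + 1)" by (simp only: powr_powr)
    also have "\<dots> = (real k)\<^sup>2 powr (\<beta> + 1)" using k by simp
    finally show ?thesis using k by (simp add: powr_divide divide_le_eq)
  qed
  show "ennreal (?c * real n powr (- ((\<beta> + 1 / (2 * p)) / (\<beta> + 1)))) \<le> minimax_risk \<beta> R p (P n)"
    unfolding minimax_risk_def
  proof (rule INF_greatest)
    fix T :: "(real \<times> real) set \<Rightarrow> real" assume T: "T \<in> borel_measurable config_space"
    have "(1 / 4) powr (1 / p) * (R * (1 / 16) powr \<beta>) * real n powr (- ((\<beta> + 1 / (2 * p)) / (\<beta> + 1)))
        = (1 / (4 * v)) powr (1 / p) * (R * (1 / (16 * v\<^sup>2)) powr \<beta>)"
    proof -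
      have e: "- ((\<beta> + 1 / (2 * p)) / (\<beta> + 1)) = - \<theta> / p + - (2 * \<theta> * \<beta>)"
      proof -
        have "2 * \<theta> * \<beta> = \<beta> / (\<beta> + 1)" using \<beta> by (simp add: \<theta>_def field_simps)
        moreover have "\<theta> / p = 1 / (2 * p) / (\<beta> + 1)" by (simp add: \<theta>_def)
        ultimately show ?thesis by (simp add: add_divide_distrib)
      qed
      have "(1 / (4 * v)) powr (1 / p) = (1 / 4) powr (1 / p) * real n powr (- \<theta> / p)"
        using n by (simp add: v_def powr_divide powr_mult powr_powr powr_minus field_simps)
      moreover have "(1 / (16 * v\<^sup>2)) powr \<beta> = (1 / 16) powr \<beta> * real n powr (- (2 * \<theta> * \<beta>))"
      proof -
        have "v\<^sup>2 = real n powr (2 * \<theta>)" using n by (simp add: v_def power2_eq_square powr_add[symmetric])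
        then show ?thesis using n by (simp add: powr_divide powr_mult powr_powr powr_minus field_simps)
      qed
      ultimately show ?thesis unfolding e by (simp only: powr_add mult_ac)
    qed
    also have "\<dots> \<le> (1 / (2 * real k)) powr (1 / p) * (R * (1 / (4 * (real k)\<^sup>2)) powr \<beta>)"
    proof (intro mult_mono powr_mono2 mult_left_mono)
      show "1 / (4 * v) \<le> 1 / (2 * real k)" using k v by (simp add: field_simps)
      have "(real k)\<^sup>2 \<le> (2 * v)\<^sup>2" using k by (intro power_mono) auto
      then show "1 / (16 * v\<^sup>2) \<le> 1 / (4 * (real k)\<^sup>2)"
        using k v by (simp add: field_simps power_mult_distrib)
    qed (use R p \<beta> v in auto)
    finally have "K * ((1 / 4) powr (1 / p) * (R * (1 / 16) powr \<beta>) * real n powr (- ((\<beta> + 1 / (2 * p)) / (\<beta> + 1))))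
        \<le> K * ((1 / (2 * real k)) powr (1 / p) * (R * (1 / (4 * (real k)\<^sup>2)) powr \<beta>))"
      by (intro mult_left_mono) (auto simp: K_def)
    also have "\<dots> = 3 * ((1 / (2 * real k)) powr (1 / p) * (R * (1 / (4 * (real k)\<^sup>2)) powr \<beta>)) / (8 * exp (exp R))"
      by (simp add: K_def)
    finally have "ennreal (?c * real n powr (- ((\<beta> + 1 / (2 * p)) / (\<beta> + 1)))) \<le> ennreal \<dots>"
      by (intro ennreal_leI) (simp only: mult.assoc)
    also have "\<dots> \<le> max_risk \<beta> R p (P n) T"
    proof (rule max_risk_ge_bump[OF \<beta> R p k(1) nk _ T])
      show "is_ppp_law (intensity n g) (P n g)" if "g \<in> hoelder_ball \<beta> R" for g
        using P n that by (auto simp: ppp_model_def)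
    qed
    finally show "ennreal (?c * real n powr (- ((\<beta> + 1 / (2 * p)) / (\<beta> + 1)))) \<le> max_risk \<beta> R p (P n) T" .
  qed
qed

section \<open>The maximum-likelihood estimator\<close>

text \<open>The cone that starts at \<open>w\<close> runs strictly below \<open>z\<close>.
  Strictness keeps points on the graph of the estimator in the sum, as the indicator in
  \<open>F_hat\<close> demands, and makes the relation asymmetric.\<close>

definition dominates :: "real \<Rightarrow> real \<Rightarrow> real \<times> real \<Rightarrow> real \<times> real \<Rightarrow> bool" where
  "dominates \<beta> R w z \<longleftrightarrow> snd w + R * \<bar>fst z - fst w\<bar> powr \<beta> < snd z"

text \<open>Adding the two inequalities would make
  \<open>2 * R * \<bar>fst z - fst w\<bar> powr \<beta>\<close> negative.\<close>

lemma dominates_asym: "0 \<le> R \<Longrightarrow> dominates \<beta> R z w \<Longrightarrow> \<not> dominates \<beta> R w z"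
  unfolding dominates_def
  by (smt (verit) mult_nonneg_nonneg powr_ge_zero)

lemma sets_dominates:
  "{x. dominates \<beta> R (fst x) (snd x)} \<in> sets (borel \<Otimes>\<^sub>M borel)"
proof -
  have "{x \<in> space ((borel \<Otimes>\<^sub>M borel) \<Otimes>\<^sub>M (borel \<Otimes>\<^sub>M borel)).
      snd (fst x) + R * \<bar>fst (snd x) - fst (fst x)\<bar> powr \<beta> < snd (snd x)}
      \<in> sets ((borel \<Otimes>\<^sub>M borel) \<Otimes>\<^sub>M (borel \<Otimes>\<^sub>M borel))"
    by measurable
  then show ?thesis unfolding borel_prod dominates_def by (simp add: space_pair_measure)
qed

lemma configs_bdd_below:
  assumes "S \<in> configs" shows "bdd_below (snd ` S)"
proof -
  have "finite {z \<in> S. snd z \<le> 0}" using assms unfolding configs_def by auto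
  then have "bdd_below (snd ` {z \<in> S. snd z \<le> 0} \<union> {0..})" by (intro bdd_below_Un[THEN iffD2]) auto
  then show ?thesis by (rule bdd_below_mono) auto
qed

lemma g_mle_bdd_below:
  assumes S: "S \<in> configs" and R: "0 \<le> R"
  shows "bdd_below ((\<lambda>z. snd z + R * \<bar>x - fst z\<bar> powr \<beta>) ` S)"
proof -
  obtain m where "m \<le> snd z" if "z \<in> S" for z
    using configs_bdd_below[OF S] unfolding bdd_below_def by auto
  then show ?thesis using R by (intro bdd_belowI2[of _ m]) (auto intro!: add_increasing2)
qed

lemma le_g_mle_iff:
  assumes "S \<in> configs" "S \<noteq> {}" "0 \<le> R"
  shows "y \<le> g_mle \<beta> R S x \<longleftrightarrow> (\<forall>w\<in>S. \<not> dominates \<beta> R w (x, y))"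
  unfolding g_mle_def le_cINF_iff[OF assms(2) g_mle_bdd_below[OF assms(1,3)]]
  by (auto simp: dominates_def not_less)

lemma undominated_eq_g_mle:
  assumes "S \<in> configs" "S \<noteq> {}" "0 \<le> R"
  shows "undominated (dominates \<beta> R) (x, y) S = indicator {..g_mle \<beta> R S x} y"
  using le_g_mle_iff[OF assms] by (auto simp: undominated_def indicator_def)

lemma g_mle_le:
  assumes "S \<in> configs" "z \<in> S" "0 \<le> R"
  shows "g_mle \<beta> R S x \<le> snd z + R * \<bar>x - fst z\<bar> powr \<beta>"
  unfolding g_mle_def by (rule cINF_lower[OF g_mle_bdd_below[OF assms(1,3)] assms(2)])

text \<open>An infimum of functions with a common modulus of continuity inherits it; a single cone
  has it by subadditivity of the power.\<close>

lemma g_mle_hoelder: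
  assumes S: "S \<in> configs" "S \<noteq> {}" and R: "0 \<le> R" and \<beta>: "0 < \<beta>" "\<beta> \<le> 1"
  shows "g_mle \<beta> R S \<in> hoelder_ball \<beta> R"
proof -
  have *: "g_mle \<beta> R S x \<le> g_mle \<beta> R S y + R * \<bar>x - y\<bar> powr \<beta>" for x y
  proof -
    have "g_mle \<beta> R S x - R * \<bar>x - y\<bar> powr \<beta> \<le> g_mle \<beta> R S y"
      unfolding g_mle_def[of _ _ _ y]
    proof (rule cINF_greatest[OF S(2)])
      fix z assume z: "z \<in> S"
      have "\<bar>x - fst z\<bar> powr \<beta> \<le> (\<bar>x - y\<bar> + \<bar>y - fst z\<bar>) powr \<beta>" using \<beta> by (intro powr_mono2) auto
      also have "\<dots> \<le> \<bar>x - y\<bar> powr \<beta> + \<bar>y - fst z\<bar> powr \<beta>" using \<beta> by (intro powr_add_le) auto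
      finally have "R * \<bar>x - fst z\<bar> powr \<beta> \<le> R * (\<bar>x - y\<bar> powr \<beta> + \<bar>y - fst z\<bar> powr \<beta>)"
        using R by (rule mult_left_mono)
      with g_mle_le[OF S(1) z R, of \<beta> x]
      show "g_mle \<beta> R S x - R * \<bar>x - y\<bar> powr \<beta> \<le> snd z + R * \<bar>y - fst z\<bar> powr \<beta>"
        by (simp add: algebra_simps)
    qed
    then show ?thesis by simp
  qed
  have "\<bar>g_mle \<beta> R S x - g_mle \<beta> R S y\<bar> \<le> R * \<bar>x - y\<bar> powr \<beta>" for x y
    using *[of x y] *[of y x] by (simp add: abs_le_iff abs_minus_commute)
  then show ?thesis unfolding hoelder_ball_def by auto
qed

lemma empty_config_iff: "S = {} \<longleftrightarrow> point_count UNIV S = 0"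
  by (auto simp: point_count_def emeasure_count_space)

lemma measurable_g_mle [measurable]:
  assumes R: "0 \<le> R"
  shows "(\<lambda>x. g_mle \<beta> R (fst x) (snd x)) \<in> borel_measurable (config_space \<Otimes>\<^sub>M borel)"
proof (rule borel_measurableI_ge)
  fix y :: real
  let ?M = "config_space \<Otimes>\<^sub>M (borel :: real measure)"
  note sets_dominates[of \<beta> R, measurable]
  have [measurable]: "(\<lambda>x. (snd x, y)) \<in> ?M \<rightarrow>\<^sub>M borel"
    unfolding borel_prod[symmetric] by measurable
  have [measurable]: "(\<lambda>x. undominated (dominates \<beta> R) (snd x, y) (fst x)) \<in> borel_measurable ?M"
    by (rule measurable_undominated[OF sets_dominates]) measurable
  \<comment> \<open>On the empty configuration the estimator is the default real
    \<open>Inf {}\<close>, so this case of the superlevel set is split off.\<close>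
  have "{x \<in> space ?M. y \<le> g_mle \<beta> R (fst x) (snd x)}
    = {x \<in> space ?M. (point_count UNIV (fst x) \<noteq> 0 \<and> undominated (dominates \<beta> R) (snd x, y) (fst x) = 1)
        \<or> (point_count UNIV (fst x) = 0 \<and> y \<le> Inf {})}"
  proof (rule Collect_cong, rule conj_cong[OF refl])
    fix x :: "(real \<times> real) set \<times> real" assume "x \<in> space ?M"
    then have S: "fst x \<in> configs" by (auto simp: space_pair_measure)
    show "y \<le> g_mle \<beta> R (fst x) (snd x) \<longleftrightarrow>
        (point_count UNIV (fst x) \<noteq> 0 \<and> undominated (dominates \<beta> R) (snd x, y) (fst x) = 1)
        \<or> (point_count UNIV (fst x) = 0 \<and> y \<le> Inf {})"
    proof (cases "fst x = {}")
      case True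
      then show ?thesis by (simp add: empty_config_iff[symmetric] g_mle_def)
    next
      case False
      then show ?thesis
        using undominated_eq_g_mle[OF S False R, of \<beta> "snd x" y]
        by (simp add: empty_config_iff[symmetric] indicator_def)
    qed
  qed
  also have "\<dots> \<in> sets ?M" by measurable
  finally show "{x \<in> space ?M. y \<le> g_mle \<beta> R (fst x) (snd x)} \<in> sets ?M" .
qed

lemma measurable_g_mle' [measurable (raw)]:
  assumes "0 \<le> R" and [measurable]: "T \<in> M \<rightarrow>\<^sub>M config_space" "f \<in> borel_measurable M"
  shows "(\<lambda>x. g_mle \<beta> R (T x) (f x)) \<in> borel_measurable M"
  using measurable_compose[OF measurable_Pair[OF assms(2,3)] measurable_g_mle[OF assms(1), of \<beta>]] by simp

lemma continuous_on_unit_bounded: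
  fixes g :: "real \<Rightarrow> real"
  assumes "continuous_on {0..1} g"
  obtains M where "0 \<le> M" "\<And>x. x \<in> {0..1} \<Longrightarrow> \<bar>g x\<bar> \<le> M"
proof -
  have "bounded (g ` {0..1})"
    using compact_continuous_image[OF assms] by (intro compact_imp_bounded) auto
  then obtain M where M: "\<forall>x\<in>{0..1}. \<bar>g x\<bar> \<le> M" unfolding bounded_iff by auto
  moreover have "0 \<le> M" using bspec[OF M, of 0] by auto
  ultimately show ?thesis using that by blast
qed

lemma finite_selected_points:
  assumes S: "S \<in> configs" and R: "0 \<le> R" and \<beta>: "0 < \<beta>" "\<beta> \<le> 1"
  shows "finite {z \<in> S. snd z \<le> g_mle \<beta> R S (fst z)}"
proof (cases "S = {}")
  case False
  obtain M where M: "\<And>x. x \<in> {0..1} \<Longrightarrow> \<bar>g_mle \<beta> R S x\<bar> \<le> M"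
    using continuous_on_unit_bounded[OF continuous_on_hoelder_ball[OF g_mle_hoelder[OF S False R \<beta>] \<beta>(1)]] by blast
  have "fst z \<in> {0..1}" if "z \<in> S" for z using that S unfolding configs_def by auto
  then have "{z \<in> S. snd z \<le> g_mle \<beta> R S (fst z)} \<subseteq> {z \<in> S. snd z \<le> M}"
    using M by (fastforce simp: abs_le_iff)
  moreover have "finite {z \<in> S. snd z \<le> M}" using S unfolding configs_def by auto
  ultimately show ?thesis by (rule finite_subset)
qed auto

lemma sum_selected_points:
  assumes S: "S \<in> configs" and R: "0 \<le> R" and \<beta>: "0 < \<beta>" "\<beta> \<le> 1" and h: "\<And>z. 0 \<le> h z"
  shows "(\<Sum>z\<in>{z \<in> S. snd z \<le> g_mle \<beta> R S (fst z)}. h z)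
    = enn2real (\<integral>\<^sup>+z. ennreal (h z) * undominated (dominates \<beta> R) z S \<partial>count_space S)"
proof (cases "S = {}")
  case False
  let ?A = "{z \<in> S. snd z \<le> g_mle \<beta> R S (fst z)}"
  have u: "undominated (dominates \<beta> R) z S = indicator {..g_mle \<beta> R S (fst z)} (snd z)" for z
    using undominated_eq_g_mle[OF S False R, of \<beta> "fst z" "snd z"] by simp
  have "(\<integral>\<^sup>+z. ennreal (h z) * undominated (dominates \<beta> R) z S \<partial>count_space S)
      = (\<Sum>z\<in>?A. ennreal (h z) * undominated (dominates \<beta> R) z S)"
    by (rule nn_integral_count_space'[OF finite_selected_points[OF S R \<beta>]]) (auto simp: u indicator_def)
  also have "\<dots> = (\<Sum>z\<in>?A. ennreal (h z))" by (intro sum.cong) (auto simp: u)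
  also have "\<dots> = ennreal (\<Sum>z\<in>?A. h z)" using h by (intro sum_ennreal) auto
  finally show ?thesis using h by (simp add: sum_nonneg)
qed (simp add: nn_integral_empty)

text \<open>The summand of \<open>F_hat\<close> is split into its positive (\<open>\<sigma> = 1\<close>) and negative (\<open>\<sigma> = -1\<close>) parts, so
  that the variance identity is only needed for nonnegative summands.\<close>

definition score :: "real \<Rightarrow> real \<Rightarrow> real \<Rightarrow> real" where
  "score p \<sigma> y = (if 0 < \<sigma> * y then p * \<bar>y\<bar> powr (p - 1) else 0)"

lemma score_nonneg: "0 \<le> p \<Longrightarrow> 0 \<le> score p \<sigma> y"
  by (simp add: score_def)

lemma score_diff: "p * \<bar>y\<bar> powr (p - 1) * sgn y = score p 1 y - score p (-1) y"
  by (auto simp: score_def sgn_if)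

lemma measurable_score [measurable]: "score p \<sigma> \<in> borel_measurable borel"
  unfolding score_def by measurable

lemma F_hat_eq:
  assumes S: "S \<in> configs" and R: "0 \<le> R" and \<beta>: "0 < \<beta>" "\<beta> \<le> 1" and p: "0 \<le> p"
  shows "F_hat \<beta> R p n S = (LINT x:{0..1}|lborel. \<bar>g_mle \<beta> R S x\<bar> powr p)
    - 1 / real n * (enn2real (\<integral>\<^sup>+z. ennreal (score p 1 (snd z)) * undominated (dominates \<beta> R) z S \<partial>count_space S)
      - enn2real (\<integral>\<^sup>+z. ennreal (score p (-1) (snd z)) * undominated (dominates \<beta> R) z S \<partial>count_space S))"
  unfolding F_hat_def score_diff sum_subtractf
  using p by (subst (1 2) sum_selected_points[OF S R \<beta>]) (auto simp: score_nonneg)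

lemma measurable_snd_borel [measurable]: "(snd :: real \<times> real \<Rightarrow> real) \<in> borel_measurable borel"
  unfolding borel_prod[symmetric] by measurable

lemma measurable_score_sum [measurable]:
  "(\<lambda>S. \<integral>\<^sup>+z. ennreal (score p \<sigma> (snd z)) * undominated (dominates \<beta> R) z S \<partial>count_space S)
    \<in> borel_measurable config_space"
proof (rule measurable_point_nn_integral)
  have [measurable]: "(\<lambda>x. undominated (dominates \<beta> R) (snd x) (fst x)) \<in> borel_measurable (config_space \<Otimes>\<^sub>M borel)"
    by (rule measurable_undominated[OF sets_dominates]) measurable
  show "(\<lambda>(S, z). ennreal (score p \<sigma> (snd z)) * undominated (dominates \<beta> R) z S)
      \<in> borel_measurable (config_space \<Otimes>\<^sub>M borel)"
    unfolding split_beta' by measurable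
qed simp

lemma F_hat_measurable:
  assumes R: "0 \<le> R" and \<beta>: "0 < \<beta>" "\<beta> \<le> 1" and p: "0 \<le> p"
  shows "F_hat \<beta> R p n \<in> borel_measurable config_space"
proof -
  note R [measurable]
  have "F_hat \<beta> R p n \<in> borel_measurable config_space
      \<longleftrightarrow> (\<lambda>S. (LINT x:{0..1}|lborel. \<bar>g_mle \<beta> R S x\<bar> powr p)
    - 1 / real n * (enn2real (\<integral>\<^sup>+z. ennreal (score p 1 (snd z)) * undominated (dominates \<beta> R) z S \<partial>count_space S)
      - enn2real (\<integral>\<^sup>+z. ennreal (score p (-1) (snd z)) * undominated (dominates \<beta> R) z S \<partial>count_space S)))
    \<in> borel_measurable config_space"
    by (rule measurable_cong) (simp add: F_hat_eq[OF _ R \<beta> p])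
  moreover have "(\<lambda>S. LINT x:{0..1}|lborel. \<bar>g_mle \<beta> R S x\<bar> powr p) \<in> borel_measurable config_space"
    unfolding set_lebesgue_integral_def using R
    by (intro lborel.borel_measurable_lebesgue_integral) measurable
  ultimately show ?thesis by simp
qed

lemma T_hat_measurable:
  assumes "0 \<le> R" "0 < \<beta>" "\<beta> \<le> 1" "0 \<le> p"
  shows "T_hat \<beta> R p n \<in> borel_measurable config_space"
proof -
  note F_hat_measurable[OF assms, measurable]
  show ?thesis unfolding T_hat_def by measurable
qed

section \<open>Tails and moments of the estimation error\<close>

text \<open>Half of the exponential absorbs the power: \<open>y \<le> exp y\<close> at
  \<open>y = c * (k + 1) / (2 * r)\<close>, raised to the power \<open>r\<close>, leaves a geometric
  series. Taking \<open>r = q + 1\<close> keeps \<open>r\<close> positive for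
  \<open>q = 0\<close>.\<close>

lemma summable_powr_exp:
  fixes q c :: real
  assumes q: "0 \<le> q" and c: "0 < c"
  shows "summable (\<lambda>k::nat. (real k + 1) powr q * exp (- (c * real k)))"
proof (rule summable_comparison_test')
  define r where "r = q + 1"
  define K where "K = (2 * r / c) powr r * exp (c / 2)"
  have r: "r > 0" using q by (simp add: r_def)
  show "summable (\<lambda>k::nat. K * exp (- (c / 2)) ^ k)"
    using c by (intro summable_mult summable_geometric) auto
  fix k :: nat
  let ?y = "c * (real k + 1) / (2 * r)"
  have y: "0 \<le> ?y" using c r by simp
  have "(real k + 1) powr q \<le> (real k + 1) powr r" by (intro powr_mono) (auto simp: r_def)
  also have "(real k + 1) powr r = (2 * r / c * ?y) powr r"
  proof -
    have "real k + 1 = 2 * r / c * ?y" using r c by (simp add: field_simps)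
    from arg_cong[OF this, of "\<lambda>t. t powr r"] show ?thesis .
  qed
  also have "\<dots> = (2 * r / c) powr r * ?y powr r" using r c y by (intro powr_mult)
  also have "\<dots> \<le> (2 * r / c) powr r * exp ?y powr r"
  proof -
    have "?y \<le> exp ?y" using exp_ge_add_one_self[of ?y] by linarith
    then show ?thesis using y r by (intro mult_left_mono powr_mono2) auto
  qed
  also have "exp ?y powr r = exp (c * (real k + 1) / 2)" using r by (simp add: powr_def field_simps)
  also have "\<dots> = exp (c / 2) * exp (c * real k / 2)" by (simp add: exp_add[symmetric] field_simps)
  finally have "(real k + 1) powr q * exp (- (c * real k)) \<le> K * (exp (c * real k / 2) * exp (- (c * real k)))"
    by (simp add: K_def mult_right_mono mult.assoc)
  also have "exp (c * real k / 2) * exp (- (c * real k)) = exp (- (c / 2)) ^ k"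
    by (simp add: exp_of_nat_mult[symmetric] exp_add[symmetric])
  finally show "norm ((real k + 1) powr q * exp (- (c * real k))) \<le> K * exp (- (c / 2)) ^ k" by simp
qed

text \<open>For \<open>u = k * \<epsilon>\<close> with \<open>k \<ge> 1\<close> the box of
  \<open>forcing_box\<close> has mass at least \<open>tail_rate \<beta> R * k\<close>: the minimum
  bounds its width in units of \<open>\<epsilon> powr (1 / \<beta>)\<close>, and the last factor 2
  comes from its height \<open>u / 2\<close>.\<close>

definition tail_rate :: "real \<Rightarrow> real \<Rightarrow> real" where
  "tail_rate \<beta> R = min ((1 / (4 * R)) powr (1 / \<beta>)) (1 / 2) / 2"

text \<open>Contributions to the \<open>q\<close>-th moment, in units of
  \<open>\<epsilon> powr q\<close>, of errors between \<open>k * \<epsilon>\<close> and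
  \<open>(k + 1) * \<epsilon>\<close>. Neither the sample size nor the curve enters, which makes the
  final constant uniform.\<close>

definition moment_const :: "real \<Rightarrow> real \<Rightarrow> real \<Rightarrow> real" where
  "moment_const \<beta> R q = (\<Sum>k. (real k + 1) powr q * exp (- (tail_rate \<beta> R * real k)))"

lemma tail_rate_pos: "0 < R \<Longrightarrow> 0 < tail_rate \<beta> R"
  by (simp add: tail_rate_def)

lemma moment_const_nonneg: "0 < R \<Longrightarrow> 0 \<le> q \<Longrightarrow> 0 \<le> moment_const \<beta> R q"
  unfolding moment_const_def by (intro suminf_nonneg summable_powr_exp tail_rate_pos) auto

text \<open>On a box below the curve \<open>g x + u - R * \<bar>x - t\<bar> powr \<beta>\<close> every point forces the
  estimator below \<open>g x + u\<close> at \<open>x\<close>.\<close>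

lemma forcing_box:
  assumes \<beta>: "0 < \<beta>" "\<beta> \<le> 1" and R: "0 < R" and g: "g \<in> hoelder_ball \<beta> R"
    and x: "x \<in> {0..1}" and u: "0 < u"
  shows "\<exists>A\<in>sets borel.
    emeasure (intensity n g) A = ennreal (real n * (min ((u / (4 * R)) powr (1 / \<beta>)) (1 / 2) * (u / 2)))
    \<and> (\<forall>S\<in>configs. point_count A S \<noteq> 0 \<longrightarrow> S \<noteq> {} \<and> g_mle \<beta> R S x < g x + u)"
proof -
  \<comment> \<open>Within distance \<open>l\<close> both the curve and the penalty of the estimator
    change by at most \<open>u / 4\<close>. The cap \<open>1 / 2\<close> lets the box fit on one
    side of \<open>x\<close> inside the unit interval.\<close>
  define l where "l = min ((u / (4 * R)) powr (1 / \<beta>)) (1 / 2)"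
  have l: "0 < l" "l \<le> 1 / 2" using u R by (auto simp: l_def)
  define a where "a = (if x \<le> 1 / 2 then x else x - l)"
  \<comment> \<open>The bottom at \<open>u / 4\<close> keeps the box above the curve, the top at
    \<open>3 * u / 4\<close> leaves room for the penalty, and the open upper end makes the
    conclusion strict.\<close>
  define A where "A = {a..a + l} \<times> {g x + u / 4..<g x + 3 * u / 4}"
  have near: "t \<in> {0..1} \<and> R * \<bar>x - t\<bar> powr \<beta> \<le> u / 4" if t: "t \<in> {a..a + l}" for t
  proof
    show "t \<in> {0..1}" using t x l by (auto simp: a_def split: if_splits)
    have "\<bar>x - t\<bar> \<le> l" using t by (auto simp: a_def split: if_splits)
    then have "\<bar>x - t\<bar> powr \<beta> \<le> ((u / (4 * R)) powr (1 / \<beta>)) powr \<beta>"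
      using \<beta> by (intro powr_mono2) (auto simp: l_def)
    also have "\<dots> = u / (4 * R)" using \<beta> u R by (simp add: powr_powr)
    finally have "R * \<bar>x - t\<bar> powr \<beta> \<le> R * (u / (4 * R))" using R by (intro mult_left_mono) auto
    then show "R * \<bar>x - t\<bar> powr \<beta> \<le> u / 4" using R by simp
  qed
  have A_sets: "A \<in> sets borel" unfolding A_def borel_prod[symmetric] by (intro pair_measureI) auto
  have "A \<subseteq> support_region g"
  proof
    fix z assume z: "z \<in> A"
    have t: "fst z \<in> {a..a + l}" "g x + u / 4 \<le> snd z" using z by (auto simp: A_def)
    have "\<bar>g (fst z) - g x\<bar> \<le> R * \<bar>fst z - x\<bar> powr \<beta>"
      using g near[OF t(1)] x unfolding hoelder_ball_def by blast
    moreover have "R * \<bar>fst z - x\<bar> powr \<beta> \<le> u / 4" using near[OF t(1)] by (simp add: abs_minus_commute)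
    ultimately have "g (fst z) \<le> g x + u / 4" by linarith
    then show "z \<in> support_region g" using near[OF t(1)] t by (cases z) (auto simp: support_region_def)
  qed
  then have "emeasure (intensity n g) A = of_nat n * emeasure (lborel \<Otimes>\<^sub>M lborel) A"
    unfolding lborel_prod using emeasure_intensity[OF continuous_on_hoelder_ball[OF g \<beta>(1)] A_sets]
    by (simp add: Int_absorb2)
  also have "emeasure (lborel \<Otimes>\<^sub>M lborel) A = ennreal l * ennreal (u / 2)"
    unfolding A_def using l u by (subst lborel.emeasure_pair_measure_Times) auto
  also have "of_nat n * \<dots> = ennreal (real n * (l * (u / 2)))"
    using l u by (simp add: ennreal_of_nat_eq_real_of_nat flip: ennreal_mult)
  finally have e: "emeasure (intensity n g) A = ennreal (real n * (l * (u / 2)))" .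
  have "S \<noteq> {} \<and> g_mle \<beta> R S x < g x + u" if S: "S \<in> configs" and "point_count A S \<noteq> 0" for S
  proof -
    have "S \<inter> A \<noteq> {}" using that(2) by (auto simp: point_count_def)
    then obtain z where z: "z \<in> S" "z \<in> A" by blast
    have "g_mle \<beta> R S x \<le> snd z + R * \<bar>x - fst z\<bar> powr \<beta>" using R by (intro g_mle_le S z) auto
    also have "\<dots> \<le> snd z + u / 4" using near[of "fst z"] z(2) by (auto simp: A_def)
    also have "\<dots> < g x + u" using z(2) by (auto simp: A_def)
    finally show ?thesis using z by auto
  qed
  with e A_sets show ?thesis unfolding l_def by blast
qed

section \<open>The error at a point, for a fixed sample size and a fixed curve\<close>

locale boundary_model =
  fixes \<beta> R :: real and n :: nat and g :: "real \<Rightarrow> real" and Q :: "(real \<times> real) set measure"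
  assumes \<beta>: "0 < \<beta>" "\<beta> \<le> 1" and R: "0 < R" and n: "1 \<le> n"
    and g: "g \<in> hoelder_ball \<beta> R" and law: "is_ppp_law (intensity n g) Q"
begin

sublocale prob_space Q
  using is_ppp_lawD(1)[OF law] .

definition \<epsilon> :: real where "\<epsilon> = real n powr (- (\<beta> / (\<beta> + 1)))"

lemma sets_Q [measurable_cong]: "sets Q = sets config_space" and space_Q: "space Q = configs"
  using is_ppp_lawD[OF law] by auto

lemma g_cont: "continuous_on {0..1} g"
  by (rule continuous_on_hoelder_ball[OF g \<beta>(1)])

lemma R_nonneg: "0 \<le> R" using R by simp

lemma \<epsilon>_pos: "0 < \<epsilon>" and \<epsilon>_le_1: "\<epsilon> \<le> 1"
proof -
  show "0 < \<epsilon>" using n by (simp add: \<epsilon>_def)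
  have "1 powr (\<beta> / (\<beta> + 1)) \<le> real n powr (\<beta> / (\<beta> + 1))" using n \<beta> by (intro powr_mono2) auto
  then show "\<epsilon> \<le> 1" using n by (simp add: \<epsilon>_def powr_minus inverse_le_1_iff)
qed

text \<open>This property determines \<open>\<epsilon>\<close>: a box of height
  \<open>\<epsilon>\<close> whose width is the scale at which the Hoelder condition allows a
  variation of order \<open>\<epsilon>\<close> has mass one.\<close>

lemma \<epsilon>_scale: "real n * (\<epsilon> powr (1 / \<beta>) * \<epsilon>) = 1"
proof -
  have "\<epsilon> powr (1 / \<beta>) * \<epsilon> = \<epsilon> powr (1 / \<beta> + 1)" using \<epsilon>_pos by (simp add: powr_add)
  also have "\<dots> = real n powr (- (\<beta> / (\<beta> + 1)) * (1 / \<beta> + 1))" unfolding \<epsilon>_def by (rule powr_powr)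
  also have "- (\<beta> / (\<beta> + 1)) * (1 / \<beta> + 1) = -1" using \<beta> by (simp add: divide_simps)
  finally show ?thesis using n by (simp add: powr_minus)
qed

text \<open>The tail event is only enclosed in a measurable set, so its own measurability need not
  be discussed. The empty configuration is enclosed as well, since there the estimator is an
  arbitrary default; this also yields \<open>AE_nonempty\<close>.\<close>

lemma tail_bound:
  assumes x: "x \<in> {0..1}"
  shows "\<exists>A\<in>sets config_space. emeasure Q A \<le> ennreal (exp (- (tail_rate \<beta> R * real k)))
    \<and> (\<forall>S\<in>configs. S = {} \<or> real k * \<epsilon> \<le> g_mle \<beta> R S x - g x \<longrightarrow> S \<in> A)"
proof (cases "k = 0")
  case True
  then show ?thesis
    using emeasure_le_1[of "space Q"] sets.top[of Q]
    by (intro bexI[of _ configs]) (auto simp: space_Q sets_Q)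
next
  case False
  let ?u = "real k * \<epsilon>"
  have u: "0 < ?u" using False \<epsilon>_pos by simp
  from forcing_box[OF \<beta> R g x u] obtain A where A: "A \<in> sets borel"
    "emeasure (intensity n g) A = ennreal (real n * (min ((?u / (4 * R)) powr (1 / \<beta>)) (1 / 2) * (?u / 2)))"
    "\<And>S. S \<in> configs \<Longrightarrow> point_count A S \<noteq> 0 \<Longrightarrow> S \<noteq> {} \<and> g_mle \<beta> R S x < g x + ?u"
    by blast
  let ?V = "{S \<in> configs. point_count A S = 0}"
  have "{S \<in> space config_space. point_count A S = 0} \<in> sets config_space" using A(1) by measurable
  then have V: "?V \<in> sets config_space" by simp
  have "(?u / (4 * R)) powr (1 / \<beta>) \<ge> \<epsilon> powr (1 / \<beta>) * (1 / (4 * R)) powr (1 / \<beta>)"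
  proof -
    have "\<epsilon> * (1 / (4 * R)) \<le> ?u / (4 * R)" using False R \<epsilon>_pos by (simp add: divide_right_mono)
    then have "(\<epsilon> * (1 / (4 * R))) powr (1 / \<beta>) \<le> (?u / (4 * R)) powr (1 / \<beta>)"
      using \<epsilon>_pos R \<beta> by (intro powr_mono2) auto
    moreover have "\<epsilon> powr (1 / \<beta>) * (1 / (4 * R)) powr (1 / \<beta>) = (\<epsilon> * (1 / (4 * R))) powr (1 / \<beta>)"
      using \<epsilon>_pos R by (subst powr_mult) auto
    ultimately show ?thesis by simp
  qed
  moreover have "\<epsilon> powr (1 / \<beta>) * (1 / 2) \<le> 1 / 2"
    using powr_mono2[of "1 / \<beta>" \<epsilon> 1] \<epsilon>_pos \<epsilon>_le_1 \<beta> by simp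
  ultimately have "\<epsilon> powr (1 / \<beta>) * (2 * tail_rate \<beta> R) \<le> min ((?u / (4 * R)) powr (1 / \<beta>)) (1 / 2)"
  proof (intro min.boundedI)
    let ?e = "\<epsilon> powr (1 / \<beta>)" and ?t = "2 * tail_rate \<beta> R"
    have "?e * ?t \<le> ?e * (1 / (4 * R)) powr (1 / \<beta>)" "?e * ?t \<le> ?e * (1 / 2)"
      unfolding tail_rate_def by (intro mult_left_mono; simp)+
    then show "?e * ?t \<le> (?u / (4 * R)) powr (1 / \<beta>)" "?e * ?t \<le> 1 / 2"
      using \<open>(?u / (4 * R)) powr (1 / \<beta>) \<ge> ?e * (1 / (4 * R)) powr (1 / \<beta>)\<close> \<open>?e * (1 / 2) \<le> 1 / 2\<close>
      by (blast intro: order_trans)+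
  qed
  then have "real n * (\<epsilon> powr (1 / \<beta>) * (2 * tail_rate \<beta> R) * (?u / 2))
      \<le> real n * (min ((?u / (4 * R)) powr (1 / \<beta>)) (1 / 2) * (?u / 2))" (is "_ \<le> ?m")
    using u by (intro mult_left_mono mult_right_mono) auto
  also have "real n * (\<epsilon> powr (1 / \<beta>) * (2 * tail_rate \<beta> R) * (?u / 2))
      = tail_rate \<beta> R * real k * (real n * (\<epsilon> powr (1 / \<beta>) * \<epsilon>))" by (simp add: mult_ac)
  finally have le: "tail_rate \<beta> R * real k \<le> ?m" unfolding \<epsilon>_scale by simp
  have "measure (intensity n g) A = ?m"
    using A(2) u R by (simp add: measure_def)
  with void_probability[OF law A(1)] A(2) have "emeasure Q ?V = ennreal (exp (- ?m))"
    unfolding emeasure_eq_measure by simp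
  also have "\<dots> \<le> ennreal (exp (- (tail_rate \<beta> R * real k)))" using le by (intro ennreal_leI) simp
  finally show ?thesis using V A(3) by (intro bexI[of _ ?V]) force+
qed

text \<open>The complement of the support region has mass 0, hence void probability
  \<open>exp 0\<close>.\<close>

lemma AE_points_above: "AE S in Q. \<forall>z\<in>S. g (fst z) \<le> snd z"
proof -
  note [measurable] = sets_support_region[OF g_cont]
  have "emeasure (intensity n g) (- support_region g) = 0"
    by (subst emeasure_intensity[OF g_cont]) auto
  then have "measure Q {S \<in> configs. point_count (- support_region g) S = 0} = 1"
    using void_probability[OF law, of "- support_region g"] by (simp add: measure_def)
  moreover have "{S \<in> configs. point_count (- support_region g) S = 0} \<in> events"
  proof -
    have "{S \<in> space config_space. point_count (- support_region g) S = 0} \<in> sets config_space" by measurable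
    then show ?thesis by (simp add: sets_Q)
  qed
  ultimately have "AE S in Q. S \<in> {S \<in> configs. point_count (- support_region g) S = 0}"
    by (simp only: prob_eq_1)
  then have "AE S in Q. point_count (- support_region g) S = 0" by eventually_elim simp
  then show ?thesis
  proof eventually_elim
    case (elim S)
    then have "S \<inter> - support_region g = {}" by (simp add: point_count_def emeasure_count_space split: if_splits)
    then have "S \<subseteq> support_region g" by blast
    then show ?case unfolding support_region_def by fastforce
  qed
qed

text \<open>The plane has infinite mass, so \<open>void_probability\<close> cannot be applied to it.
  Instead, the empty configuration lies in the enclosing tail sets of all orders
  \<open>k\<close>.\<close>

lemma AE_nonempty: "AE S in Q. S \<noteq> {}"
proof (rule AE_I')
  have E: "{{}} \<in> sets Q"
  proof -
    have "{S \<in> space config_space. point_count UNIV S = 0} \<in> sets config_space" by measurable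
    moreover have "{S \<in> space config_space. point_count UNIV S = 0} = {{}}"
      by (auto simp: empty_config_iff[symmetric] configs_def)
    ultimately show ?thesis by (simp add: sets_Q)
  qed
  have le: "measure Q {{}} \<le> exp (- tail_rate \<beta> R) ^ k" for k
  proof -
    obtain A where A: "A \<in> sets config_space" "emeasure Q A \<le> ennreal (exp (- (tail_rate \<beta> R * real k)))"
      "\<forall>S\<in>configs. S = {} \<or> real k * \<epsilon> \<le> g_mle \<beta> R S 0 - g 0 \<longrightarrow> S \<in> A"
      using tail_bound[of 0 k] by auto
    have "{} \<in> configs" by (simp add: configs_def)
    then have "emeasure Q {{}} \<le> emeasure Q A" using A by (intro emeasure_mono) (auto simp: sets_Q)
    also note A(2)
    finally show ?thesis
      by (simp add: emeasure_eq_measure exp_of_nat_mult[symmetric] mult.commute)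
  qed
  have "(\<lambda>k. exp (- tail_rate \<beta> R) ^ k) \<longlonglongrightarrow> 0"
    using tail_rate_pos[OF R, of \<beta>] by (intro LIMSEQ_realpow_zero) auto
  then have "measure Q {{}} \<le> 0" by (rule LIMSEQ_le_const) (use le in auto)
  then show "{{}} \<in> null_sets Q" using E by (auto simp: null_sets_def emeasure_eq_measure measure_le_0_iff)
qed auto

lemma g_le_g_mle:
  assumes "S \<noteq> {}" "\<forall>z\<in>S. g (fst z) \<le> snd z" "S \<in> configs" "x \<in> {0..1}"
  shows "g x \<le> g_mle \<beta> R S x"
  unfolding g_mle_def
proof (rule cINF_greatest[OF assms(1)])
  fix z assume z: "z \<in> S"
  then have "fst z \<in> {0..1}" using assms(3) unfolding configs_def by auto
  then have "\<bar>g x - g (fst z)\<bar> \<le> R * \<bar>x - fst z\<bar> powr \<beta>" using g assms(4) unfolding hoelder_ball_def by blast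
  then show "g x \<le> snd z + R * \<bar>x - fst z\<bar> powr \<beta>" using assms(2) z by force
qed

text \<open>Off the unit interval \<open>g\<close> is arbitrary, in particular possibly not measurable.\<close>

definition gr :: "real \<Rightarrow> real" where "gr x = g x * indicator {0..1} x"

text \<open>The cut at 0 keeps the error nonnegative on exceptional configurations too, so that its
  powers and integrals need no case distinction.\<close>

definition \<delta> :: "(real \<times> real) set \<Rightarrow> real \<Rightarrow> real" where
  "\<delta> S x = max 0 (g_mle \<beta> R S x - gr x)"

lemma \<delta>_nonneg: "0 \<le> \<delta> S x"
  by (simp add: \<delta>_def)

text \<open>With \<open>k\<close> the integer part of the error divided by
  \<open>\<epsilon>\<close>, the configuration lies in the \<open>k\<close>-th tail set while the
  error is at most \<open>(k + 1) * \<epsilon>\<close>; summation over \<open>k\<close> gives the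
  moment.\<close>

lemma moment_bound:
  assumes x: "x \<in> {0..1}" and q: "0 \<le> q"
  shows "(\<integral>\<^sup>+S. ennreal (\<delta> S x powr q) \<partial>Q) \<le> ennreal (moment_const \<beta> R q * \<epsilon> powr q)"
proof -
  have "\<forall>k. \<exists>A. A \<in> sets config_space \<and> emeasure Q A \<le> ennreal (exp (- (tail_rate \<beta> R * real k)))
    \<and> (\<forall>S\<in>configs. S = {} \<or> real k * \<epsilon> \<le> g_mle \<beta> R S x - g x \<longrightarrow> S \<in> A)"
    using tail_bound[OF x] by blast
  then obtain A where A: "\<And>k. A k \<in> sets config_space"
    "\<And>k. emeasure Q (A k) \<le> ennreal (exp (- (tail_rate \<beta> R * real k)))"
    "\<And>k S. S \<in> configs \<Longrightarrow> S = {} \<or> real k * \<epsilon> \<le> g_mle \<beta> R S x - g x \<Longrightarrow> S \<in> A k"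
    by metis
  let ?a = "\<lambda>k::nat. ((real k + 1) * \<epsilon>) powr q"
  have "(\<integral>\<^sup>+S. ennreal (\<delta> S x powr q) \<partial>Q) \<le> (\<integral>\<^sup>+S. (\<Sum>k. ennreal (?a k) * indicator (A k) S) \<partial>Q)"
  proof (rule nn_integral_mono_AE, use AE_space AE_points_above AE_nonempty in eventually_elim)
    case (elim S)
    then have S: "S \<in> configs" by (simp add: space_Q)
    have d: "\<delta> S x = g_mle \<beta> R S x - g x" "0 \<le> \<delta> S x"
      using g_le_g_mle[OF elim(3,2) S x] x by (auto simp: \<delta>_def gr_def)
    define k where "k = nat \<lfloor>\<delta> S x / \<epsilon>\<rfloor>"
    have "0 \<le> \<delta> S x / \<epsilon>" using d \<epsilon>_pos by simp
    then have k: "real k \<le> \<delta> S x / \<epsilon>" "\<delta> S x / \<epsilon> \<le> real k + 1" unfolding k_def by linarith+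
    then have "real k * \<epsilon> \<le> g_mle \<beta> R S x - g x" "\<delta> S x \<le> (real k + 1) * \<epsilon>"
      using \<epsilon>_pos d by (simp_all add: field_simps)
    then have "S \<in> A k" "\<delta> S x powr q \<le> ?a k" using A(3)[OF S] q d by (auto intro: powr_mono2)
    then have "ennreal (\<delta> S x powr q) \<le> ennreal (?a k) * indicator (A k) S" by (simp add: ennreal_leI)
    also have "\<dots> \<le> (\<Sum>k. ennreal (?a k) * indicator (A k) S)"
    proof -
      have "f k \<le> suminf f" for f :: "nat \<Rightarrow> ennreal" using sum_le_suminf[of f "{k}"] by simp
      then show ?thesis .
    qed
    finally show ?case .
  qed
  also have "\<dots> = (\<Sum>k. \<integral>\<^sup>+S. ennreal (?a k) * indicator (A k) S \<partial>Q)"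
    using A(1) by (intro nn_integral_suminf) (auto intro!: borel_measurable_times_ennreal borel_measurable_indicator simp: sets_Q)
  also have "\<dots> = (\<Sum>k. ennreal (?a k) * emeasure Q (A k))"
    using A(1) by (intro suminf_cong nn_integral_cmult_indicator) (simp add: sets_Q)
  also have "\<dots> \<le> (\<Sum>k. ennreal (\<epsilon> powr q * ((real k + 1) powr q * exp (- (tail_rate \<beta> R * real k)))))"
  proof (rule suminf_le)
    fix k
    have "ennreal (?a k) * emeasure Q (A k) \<le> ennreal (?a k) * ennreal (exp (- (tail_rate \<beta> R * real k)))"
      by (intro mult_left_mono A(2)) auto
    also have "\<dots> = ennreal (\<epsilon> powr q * ((real k + 1) powr q * exp (- (tail_rate \<beta> R * real k))))"
      using \<epsilon>_pos by (subst ennreal_mult[symmetric]) (auto simp: powr_mult mult_ac)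
    finally show "ennreal (?a k) * emeasure Q (A k) \<le> \<dots>" .
  qed auto
  also have "\<dots> = ennreal (\<Sum>k. \<epsilon> powr q * ((real k + 1) powr q * exp (- (tail_rate \<beta> R * real k))))"
    by (intro suminf_ennreal2 summable_mult summable_powr_exp q tail_rate_pos R) auto
  also have "\<dots> = ennreal (moment_const \<beta> R q * \<epsilon> powr q)"
    unfolding moment_const_def
    by (subst suminf_mult[OF summable_powr_exp[OF q tail_rate_pos[OF R]]]) (simp add: mult.commute)
  finally show ?thesis .
qed

end

section \<open>Bias and variance of the plug-in estimator\<close>

text \<open>Up to the sign \<open>\<sigma>\<close> this is an antiderivative of
  \<open>score p \<sigma>\<close>.\<close>

definition score_primitive :: "real \<Rightarrow> real \<Rightarrow> real \<Rightarrow> real" where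
  "score_primitive p \<sigma> y = max 0 (\<sigma> * y) powr p"

lemma abs_powr_eq_score_primitive: "\<bar>y\<bar> powr p = score_primitive p 1 y + score_primitive p (-1) y"
  by (auto simp: score_primitive_def max_def)

lemma score_primitive_integral:
  assumes p: "1 \<le> p" and \<sigma>: "\<sigma> = 1 \<or> \<sigma> = -1" and ab: "a \<le> b"
  shows "(\<integral>\<^sup>+y. ennreal (score p \<sigma> y) * indicator {a..b} y \<partial>lborel)
      = ennreal (\<sigma> * (score_primitive p \<sigma> b - score_primitive p \<sigma> a))"
    and "0 \<le> \<sigma> * (score_primitive p \<sigma> b - score_primitive p \<sigma> a)"
proof -
  let ?F = "\<lambda>y. \<sigma> * score_primitive p \<sigma> y"
  have \<sigma>2: "\<sigma> * \<sigma> = 1" "\<bar>\<sigma>\<bar> = 1" using \<sigma> by auto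
  have der: "(?F has_vector_derivative score p \<sigma> y) (at y)" if "y \<noteq> 0" for y
    unfolding has_real_derivative_iff_has_vector_derivative[symmetric]
  proof (cases "0 < \<sigma> * y")
    case True
    have *: "((\<lambda>y. \<sigma> * (\<sigma> * y) powr p) has_real_derivative score p \<sigma> y) (at y)"
    proof -
      have "((\<lambda>y. \<sigma> * (\<sigma> * y) powr p) has_real_derivative \<sigma> * (p * (\<sigma> * y) powr (p - 1) * \<sigma>)) (at y)"
        using True by (auto intro!: derivative_eq_intros simp: field_simps powr_diff)
      moreover have "\<sigma> * y = \<bar>y\<bar>" using True \<sigma> by auto
      moreover have "\<sigma> * (p * t * \<sigma>) = (\<sigma> * \<sigma>) * (p * t)" for t by simp
      ultimately show ?thesis using True by (simp only: \<sigma>2 score_def if_True mult_1)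
    qed
    show "(?F has_real_derivative score p \<sigma> y) (at y)"
    proof (rule has_field_derivative_transform_within_open[OF *])
      show "open {y. 0 < \<sigma> * y}" by (intro open_Collect_less continuous_intros)
    qed (use True in \<open>auto simp: score_primitive_def\<close>)
  next
    case False
    then have neg: "\<sigma> * y < 0" using that \<sigma> by auto
    have *: "((\<lambda>y. 0) has_real_derivative score p \<sigma> y) (at y)" using False by (simp add: score_def)
    show "(?F has_real_derivative score p \<sigma> y) (at y)"
    proof (rule has_field_derivative_transform_within_open[OF *])
      show "open {y. \<sigma> * y < 0}" by (intro open_Collect_less continuous_intros)
    qed (use neg p in \<open>auto simp: score_primitive_def\<close>)
  qed
  have "continuous_on {a..b} ?F"
    unfolding score_primitive_def using p by (intro continuous_intros continuous_on_powr') auto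
  \<comment> \<open>The point 0 is exempted because for \<open>p = 1\<close> the score jumps
    there.\<close>
  then have "(score p \<sigma> has_integral ?F b - ?F a) {a..b}"
    by (intro fundamental_theorem_of_calculus_strong[of "{0}"]) (use ab der in auto)
  then have int: "((\<lambda>y. if y \<in> {a..b} then score p \<sigma> y else 0) has_integral ?F b - ?F a) UNIV"
    unfolding has_integral_restrict_UNIV .
  have nn: "0 \<le> (if y \<in> {a..b} then score p \<sigma> y else 0)" for y using p by (simp add: score_nonneg)
  have "(\<integral>\<^sup>+y. ennreal (score p \<sigma> y) * indicator {a..b} y \<partial>lborel)
      = (\<integral>\<^sup>+y. ennreal (if y \<in> {a..b} then score p \<sigma> y else 0) \<partial>lborel)"
    by (intro nn_integral_cong) (auto simp: indicator_def)
  also have "\<dots> = ennreal (?F b - ?F a)"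
    by (rule nn_integral_has_integral_lborel[OF _ nn int]) measurable
  finally show "(\<integral>\<^sup>+y. ennreal (score p \<sigma> y) * indicator {a..b} y \<partial>lborel)
      = ennreal (\<sigma> * (score_primitive p \<sigma> b - score_primitive p \<sigma> a))" by (simp add: right_diff_distrib)
  show "0 \<le> \<sigma> * (score_primitive p \<sigma> b - score_primitive p \<sigma> a)"
    using has_integral_nonneg[OF int nn] by (simp add: right_diff_distrib)
qed

lemma powr_add_le_two_powr:
  fixes a d s :: real
  assumes "0 \<le> a" "0 \<le> d" "0 \<le> s"
  shows "(a + d) powr s \<le> 2 powr s * (a powr s + d powr s)"
proof -
  have *: "(x + y) powr s \<le> 2 powr s * (x powr s + y powr s)" if "0 \<le> x" "x \<le> y" for x y
  proof -
    have "(x + y) powr s \<le> (2 * y) powr s" using that assms by (intro powr_mono2) auto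
    also have "\<dots> = 2 powr s * y powr s" using that by (simp add: powr_mult)
    also have "\<dots> \<le> 2 powr s * (x powr s + y powr s)" by (intro mult_left_mono) auto
    finally show ?thesis .
  qed
  show ?thesis using *[of a d] *[of d a] assms by (cases "a \<le> d") (auto simp: add.commute)
qed

context boundary_model
begin

lemma measurable_gr [measurable]: "gr \<in> borel_measurable borel"
  unfolding gr_def using borel_measurable_restrict_unit[OF g_cont] .

lemma measurable_\<delta> [measurable (raw)]:
  assumes [measurable]: "T \<in> M \<rightarrow>\<^sub>M config_space" "f \<in> borel_measurable M"
  shows "(\<lambda>x. \<delta> (T x) (f x)) \<in> borel_measurable M"
  unfolding \<delta>_def using R_nonneg by measurable

lemma gr_bounded: obtains M where "0 \<le> M" "\<And>x. \<bar>gr x\<bar> \<le> M"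
proof -
  obtain M where "0 \<le> M" "\<And>x. x \<in> {0..1} \<Longrightarrow> \<bar>g x\<bar> \<le> M"
    using continuous_on_unit_bounded[OF g_cont] by blast
  then show ?thesis using that[of M] by (auto simp: gr_def indicator_def)
qed

text \<open>Collects almost sure properties, so that the identities for one configuration become
  deterministic.\<close>

definition good :: "(real \<times> real) set \<Rightarrow> bool" where
  "good S \<longleftrightarrow> S \<in> configs \<and> S \<noteq> {} \<and> (\<forall>x\<in>{0..1}. g x \<le> g_mle \<beta> R S x)"

lemma AE_good: "AE S in Q. good S"
  using AE_points_above AE_nonempty AE_space
  by eventually_elim (auto simp: good_def space_Q intro: g_le_g_mle)

lemma good_g_mle:
  assumes "good S" "x \<in> {0..1}"
  shows "g x \<le> g_mle \<beta> R S x" "g_mle \<beta> R S x - g x = \<delta> S x" "gr x = g x"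
  using assms by (auto simp: good_def \<delta>_def gr_def)

lemma good_cont: "good S \<Longrightarrow> continuous_on {0..1} (g_mle \<beta> R S)"
  unfolding good_def using g_mle_hoelder[OF _ _ R_nonneg \<beta>] continuous_on_hoelder_ball[OF _ \<beta>(1)] by blast

lemma measurable_undominated_point [measurable]:
  "S \<in> configs \<Longrightarrow> (\<lambda>z. undominated (dominates \<beta> R) z S) \<in> borel_measurable borel"
  by (rule measurable_undominated[OF sets_dominates]) auto

text \<open>Over each abscissa the undominated part of the support region is the vertical segment
  from the curve to the estimator.\<close>

lemma nn_integral_undominated:
  assumes S: "good S" and [measurable]: "k \<in> borel_measurable borel"
  shows "(\<integral>\<^sup>+z. k (snd z) * undominated (dominates \<beta> R) z S \<partial>intensity n g)
    = (\<integral>\<^sup>+x. of_nat n * (\<integral>\<^sup>+y. k y * indicator {g x..g_mle \<beta> R S x} y \<partial>lborel) * indicator {0..1} x \<partial>lborel)"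
proof -
  have S': "S \<in> configs" "S \<noteq> {}" using S by (auto simp: good_def)
  note [measurable] = measurable_undominated_point[OF S'(1)]
  have "(\<integral>\<^sup>+z. k (snd z) * undominated (dominates \<beta> R) z S \<partial>intensity n g)
    = (\<integral>\<^sup>+x. (\<integral>\<^sup>+y. of_nat n * (k (snd (x, y)) * undominated (dominates \<beta> R) (x, y) S) * indicator {g x..} y \<partial>lborel)
        * indicator {0..1} x \<partial>lborel)"
    by (rule nn_integral_intensity[OF g_cont]) measurable
  also have "\<dots> = (\<integral>\<^sup>+x. of_nat n * (\<integral>\<^sup>+y. k y * indicator {g x..g_mle \<beta> R S x} y \<partial>lborel) * indicator {0..1} x \<partial>lborel)"
  proof (rule nn_integral_cong)
    fix x
    have "(\<integral>\<^sup>+y. of_nat n * (k (snd (x, y)) * undominated (dominates \<beta> R) (x, y) S) * indicator {g x..} y \<partial>lborel)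
      = (\<integral>\<^sup>+y. of_nat n * (k y * indicator {g x..g_mle \<beta> R S x} y) \<partial>lborel)"
      using undominated_eq_g_mle[OF S' R_nonneg, of \<beta> x]
      by (intro nn_integral_cong) (auto simp: indicator_def)
    also have "\<dots> = of_nat n * (\<integral>\<^sup>+y. k y * indicator {g x..g_mle \<beta> R S x} y \<partial>lborel)"
      by (rule nn_integral_cmult) measurable
    finally show "(\<integral>\<^sup>+y. of_nat n * (k (snd (x, y)) * undominated (dominates \<beta> R) (x, y) S) * indicator {g x..} y \<partial>lborel)
        * indicator {0..1} x = of_nat n * (\<integral>\<^sup>+y. k y * indicator {g x..g_mle \<beta> R S x} y \<partial>lborel) * indicator {0..1} x"
      by simp
  qed
  finally show ?thesis .
qed

lemma nn_integral_undominated_le: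
  assumes S: "good S" and [measurable]: "k \<in> borel_measurable borel"
    and K: "\<And>x y. x \<in> {0..1} \<Longrightarrow> \<bar>y\<bar> \<le> \<bar>gr x\<bar> + \<delta> S x \<Longrightarrow> k y \<le> ennreal (K x)" "\<And>x. 0 \<le> K x"
  shows "(\<integral>\<^sup>+z. k (snd z) * undominated (dominates \<beta> R) z S \<partial>intensity n g)
    \<le> (\<integral>\<^sup>+x. ennreal (real n * (K x * \<delta> S x)) * indicator {0..1} x \<partial>lborel)"
  unfolding nn_integral_undominated[OF assms(1,2)]
proof (rule nn_integral_mono)
  fix x
  show "of_nat n * (\<integral>\<^sup>+y. k y * indicator {g x..g_mle \<beta> R S x} y \<partial>lborel) * indicator {0..1} x
    \<le> ennreal (real n * (K x * \<delta> S x)) * indicator {0..1} x"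
  proof (cases "x \<in> {0..1}")
    case True
    note gd = good_g_mle[OF S True]
    have "(\<integral>\<^sup>+y. k y * indicator {g x..g_mle \<beta> R S x} y \<partial>lborel)
        \<le> (\<integral>\<^sup>+y. ennreal (K x) * indicator {g x..g_mle \<beta> R S x} y \<partial>lborel)"
    proof (rule nn_integral_mono)
      fix y
      have "k y \<le> ennreal (K x)" if "y \<in> {g x..g_mle \<beta> R S x}"
      proof (rule K(1)[OF True])
        have "0 \<le> y - g x" "y - g x \<le> \<delta> S x" using that gd(2) by auto
        then show "\<bar>y\<bar> \<le> \<bar>gr x\<bar> + \<delta> S x" unfolding gd(3) by linarith
      qed
      then show "k y * indicator {g x..g_mle \<beta> R S x} y \<le> ennreal (K x) * indicator {g x..g_mle \<beta> R S x} y"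
        by (auto simp: indicator_def)
    qed
    also have "\<dots> = ennreal (K x) * ennreal (\<delta> S x)"
      using gd by (simp add: nn_integral_cmult_indicator)
    finally have "of_nat n * (\<integral>\<^sup>+y. k y * indicator {g x..g_mle \<beta> R S x} y \<partial>lborel)
        \<le> of_nat n * (ennreal (K x) * ennreal (\<delta> S x))" by (rule mult_left_mono) simp
    also have "\<dots> = ennreal (real n * (K x * \<delta> S x))"
      using K(2) \<delta>_nonneg by (simp add: ennreal_of_nat_eq_real_of_nat ennreal_mult)
    finally show ?thesis by (rule mult_right_mono) simp
  qed simp
qed

lemma score_compensator:
  assumes S: "good S" and p: "1 \<le> p" and \<sigma>: "\<sigma> = 1 \<or> \<sigma> = -1"
  shows "enn2real (\<integral>\<^sup>+z. ennreal (score p \<sigma> (snd z)) * undominated (dominates \<beta> R) z S \<partial>intensity n g)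
    = real n * (LINT x:{0..1}|lborel. \<sigma> * (score_primitive p \<sigma> (g_mle \<beta> R S x) - score_primitive p \<sigma> (g x)))"
proof -
  let ?f = "\<lambda>x. \<sigma> * (score_primitive p \<sigma> (g_mle \<beta> R S x) - score_primitive p \<sigma> (g x))"
  have cont: "continuous_on {0..1} ?f"
    unfolding score_primitive_def using p good_cont[OF S] g_cont
    by (intro continuous_intros continuous_on_powr') auto
  have int: "integrable lborel (\<lambda>x. indicat_real {0..1} x *\<^sub>R ?f x)"
    using borel_integrable_compact[OF _ cont] by simp
  have nn: "0 \<le> ?f x" if "x \<in> {0..1}" for x
    using score_primitive_integral(2)[OF p \<sigma> good_g_mle(1)[OF S that]] .
  have "(\<integral>\<^sup>+z. ennreal (score p \<sigma> (snd z)) * undominated (dominates \<beta> R) z S \<partial>intensity n g)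
      = (\<integral>\<^sup>+x. of_nat n * (\<integral>\<^sup>+y. ennreal (score p \<sigma> y) * indicator {g x..g_mle \<beta> R S x} y \<partial>lborel) * indicator {0..1} x \<partial>lborel)"
    by (rule nn_integral_undominated[OF S]) measurable
  also have "\<dots> = (\<integral>\<^sup>+x. ennreal (real n * (indicat_real {0..1} x *\<^sub>R ?f x)) \<partial>lborel)"
  proof (rule nn_integral_cong)
    fix x
    show "of_nat n * (\<integral>\<^sup>+y. ennreal (score p \<sigma> y) * indicator {g x..g_mle \<beta> R S x} y \<partial>lborel) * indicator {0..1} x
      = ennreal (real n * (indicat_real {0..1} x *\<^sub>R ?f x))"
    proof (cases "x \<in> {0..1}")
      case True
      then show ?thesis
        using score_primitive_integral(1)[OF p \<sigma> good_g_mle(1)[OF S True]] nn[OF True]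
        by (simp add: ennreal_of_nat_eq_real_of_nat ennreal_mult')
    qed simp
  qed
  also have "\<dots> = ennreal (\<integral>x. real n * (indicat_real {0..1} x *\<^sub>R ?f x) \<partial>lborel)"
    using int nn by (intro nn_integral_eq_integral integrable_mult_right) (auto simp: indicator_def)
  also have "(\<integral>x. real n * (indicat_real {0..1} x *\<^sub>R ?f x) \<partial>lborel) = real n * (LINT x:{0..1}|lborel. ?f x)"
    unfolding set_lebesgue_integral_def by simp
  also have "enn2real \<dots> = real n * (LINT x:{0..1}|lborel. ?f x)"
  proof (rule enn2real_ennreal)
    have "0 \<le> (LINT x:{0..1}|lborel. ?f x)"
      unfolding set_lebesgue_integral_def using nn by (intro Bochner_Integration.integral_nonneg) (auto simp: indicator_def)
    then show "0 \<le> real n * (LINT x:{0..1}|lborel. ?f x)" by simp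
  qed
  finally show ?thesis .
qed

text \<open>The compensators of the two signs recombine to \<open>n\<close> times the difference
  between the power integrals of estimator and curve. The correction in \<open>F_hat\<close> thus
  removes the plug-in error exactly, up to the compensated sums; the factor 2 comes from
  \<open>(a - b)\<^sup>2 \<le> 2 * (b\<^sup>2 + a\<^sup>2)\<close>.\<close>

lemma F_hat_error:
  assumes S: "good S" and p: "1 \<le> p"
  defines "A \<equiv> \<lambda>\<sigma>. enn2real (\<integral>\<^sup>+z. ennreal (score p \<sigma> (snd z)) * undominated (dominates \<beta> R) z S \<partial>count_space S)"
    and "B \<equiv> \<lambda>\<sigma>. enn2real (\<integral>\<^sup>+z. ennreal (score p \<sigma> (snd z)) * undominated (dominates \<beta> R) z S \<partial>intensity n g)"
  shows "(F_hat \<beta> R p n S - (LINT x:{0..1}|lborel. \<bar>g x\<bar> powr p))\<^sup>2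
    \<le> 2 / (real n)\<^sup>2 * ((A 1 - B 1)\<^sup>2 + (A (-1) - B (-1))\<^sup>2)"
proof -
  let ?I = "\<lambda>f. LINT x:{0..1}|lborel. f x"
  let ?P = "score_primitive p"
  have S': "S \<in> configs" using S by (simp add: good_def)
  have int: "set_integrable lborel {0..1} f" if "continuous_on {0..1} f" for f :: "real \<Rightarrow> real"
    unfolding set_integrable_def using borel_integrable_compact[OF _ that] by simp
  have cont: "continuous_on {0..1} (\<lambda>x. ?P \<sigma> (g_mle \<beta> R S x))" "continuous_on {0..1} (\<lambda>x. ?P \<sigma> (g x))" for \<sigma>
    unfolding score_primitive_def using p good_cont[OF S] g_cont
    by (intro continuous_intros continuous_on_powr'; auto)+
  have B1: "B 1 = real n * (?I (\<lambda>x. ?P 1 (g_mle \<beta> R S x)) - ?I (\<lambda>x. ?P 1 (g x)))"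
    unfolding B_def using score_compensator[OF S p, of 1] int[OF cont(1)[of 1]] int[OF cont(2)[of 1]]
    by (simp add: set_integral_diff)
  have B2: "B (-1) = real n * (?I (\<lambda>x. ?P (-1) (g x)) - ?I (\<lambda>x. ?P (-1) (g_mle \<beta> R S x)))"
    unfolding B_def using score_compensator[OF S p, of "-1"] int[OF cont(1)[of "-1"]] int[OF cont(2)[of "-1"]]
    by (simp add: set_integral_diff)
  have "?I (\<lambda>x. \<bar>g_mle \<beta> R S x\<bar> powr p) - ?I (\<lambda>x. \<bar>g x\<bar> powr p) = (B 1 - B (-1)) / real n"
    unfolding abs_powr_eq_score_primitive B1 B2 using n int[OF cont(1)] int[OF cont(2)]
    by (simp add: set_integral_add field_simps)
  then have "F_hat \<beta> R p n S - ?I (\<lambda>x. \<bar>g x\<bar> powr p) = ((A (-1) - B (-1)) - (A 1 - B 1)) / real n"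
    using F_hat_eq[OF S' R_nonneg \<beta>, of p n] p unfolding A_def by (simp add: diff_divide_distrib)
  then have "(F_hat \<beta> R p n S - ?I (\<lambda>x. \<bar>g x\<bar> powr p))\<^sup>2 = ((A (-1) - B (-1)) - (A 1 - B 1))\<^sup>2 / (real n)\<^sup>2"
    by (simp add: power_divide)
  also have "\<dots> \<le> (2 * ((A 1 - B 1)\<^sup>2 + (A (-1) - B (-1))\<^sup>2)) / (real n)\<^sup>2"
  proof (rule divide_right_mono)
    have "(a - b)\<^sup>2 \<le> 2 * (b\<^sup>2 + a\<^sup>2)" for a b :: real
      using zero_le_power2[of "a + b"] by (simp add: power2_eq_square algebra_simps)
    then show "((A (-1) - B (-1)) - (A 1 - B 1))\<^sup>2 \<le> 2 * ((A 1 - B 1)\<^sup>2 + (A (-1) - B (-1))\<^sup>2)" .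
  qed simp
  finally show ?thesis by simp
qed

lemma expected_weighted_moment:
  assumes [measurable]: "a \<in> borel_measurable borel" and a: "\<And>x. 0 \<le> a x" and q: "0 \<le> q"
  shows "(\<integral>\<^sup>+S. \<integral>\<^sup>+x. ennreal (a x * \<delta> S x powr q) * indicator {0..1} x \<partial>lborel \<partial>Q)
    \<le> (\<integral>\<^sup>+x. ennreal (a x * (moment_const \<beta> R q * \<epsilon> powr q)) * indicator {0..1} x \<partial>lborel)"
proof -
  interpret L: pair_sigma_finite lborel Q ..
  have "(\<integral>\<^sup>+S. \<integral>\<^sup>+x. ennreal (a x * \<delta> S x powr q) * indicator {0..1} x \<partial>lborel \<partial>Q)
      = (\<integral>\<^sup>+x. \<integral>\<^sup>+S. ennreal (a x * \<delta> S x powr q) * indicator {0..1} x \<partial>Q \<partial>lborel)"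
    by (rule L.Fubini') measurable
  also have "\<dots> \<le> (\<integral>\<^sup>+x. ennreal (a x * (moment_const \<beta> R q * \<epsilon> powr q)) * indicator {0..1} x \<partial>lborel)"
  proof (rule nn_integral_mono)
    fix x
    show "(\<integral>\<^sup>+S. ennreal (a x * \<delta> S x powr q) * indicator {0..1} x \<partial>Q)
      \<le> ennreal (a x * (moment_const \<beta> R q * \<epsilon> powr q)) * indicator {0..1} x"
    proof (cases "x \<in> {0..1}")
      case True
      have "(\<integral>\<^sup>+S. ennreal (a x * \<delta> S x powr q) * indicator {0..1} x \<partial>Q)
          = (\<integral>\<^sup>+S. ennreal (a x) * ennreal (\<delta> S x powr q) \<partial>Q)"
        using True a by (simp add: ennreal_mult)
      also have "\<dots> = ennreal (a x) * (\<integral>\<^sup>+S. ennreal (\<delta> S x powr q) \<partial>Q)"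
        by (rule nn_integral_cmult) measurable
      also have "\<dots> \<le> ennreal (a x) * ennreal (moment_const \<beta> R q * \<epsilon> powr q)"
        by (intro mult_left_mono moment_bound True q) simp
      also have "\<dots> = ennreal (a x * (moment_const \<beta> R q * \<epsilon> powr q))"
        using a moment_const_nonneg[OF R q, of \<beta>] by (simp add: ennreal_mult)
      finally show ?thesis using True by simp
    qed simp
  qed
  finally show ?thesis .
qed

end

context boundary_model
begin

lemma abs_gr_powr_integrable:
  assumes "0 \<le> s"
  shows "integrable lborel (\<lambda>x. indicat_real {0..1} x * \<bar>gr x\<bar> powr s)"
proof -
  obtain M where M: "0 \<le> M" "\<And>x. \<bar>gr x\<bar> \<le> M" using gr_bounded by blast
  show ?thesis
  proof (rule integrableI_bounded_set[where A = "{0..1}" and B = "M powr s"])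
    show "AE x in lborel. x \<in> {0..1} \<longrightarrow> norm (indicat_real {0..1} x * \<bar>gr x\<bar> powr s) \<le> M powr s"
      using M assms by (intro AE_I2 impI) (auto intro: powr_mono2)
  qed auto
qed

lemma abs_g_powr_integral: "(LINT x:{0..1}|lborel. \<bar>g x\<bar> powr s) = (\<integral>x. indicat_real {0..1} x * \<bar>gr x\<bar> powr s \<partial>lborel)"
  unfolding set_lebesgue_integral_def by (intro Bochner_Integration.integral_cong) (auto simp: gr_def indicator_def)

lemma score_le:
  assumes p: "1 \<le> p" and y: "\<bar>y\<bar> \<le> b"
  shows "score p \<sigma> y \<le> p * b powr (p - 1)"
  using assms by (auto simp: score_def intro!: mult_left_mono powr_mono2)

text \<open>Purely qualitative: it supplies the finiteness with which
  \<open>undominated_sum_variance\<close> cancels the mixed terms. The bound may therefore depend on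
  the maximum of the curve.\<close>

lemma compensator_second_moment_finite:
  assumes p: "1 \<le> p"
  shows "(\<integral>\<^sup>+S. (\<integral>\<^sup>+z. ennreal (score p \<sigma> (snd z)) * undominated (dominates \<beta> R) z S \<partial>intensity n g)\<^sup>2 \<partial>Q) < \<infinity>"
proof -
  obtain M where M: "0 \<le> M" "\<And>x. \<bar>gr x\<bar> \<le> M" using gr_bounded by blast
  let ?K = "\<lambda>S x. real n * (p * (\<bar>gr x\<bar> + \<delta> S x) powr (p - 1) * \<delta> S x)"
  define c where "c = (real n * p)\<^sup>2 * 2 powr (2 * p)"
  have c: "0 \<le> c" by (simp add: c_def)
  have sq: "(?K S x)\<^sup>2 \<le> c * M powr (2 * p) + c * \<delta> S x powr (2 * p)" for S x
  proof -
    let ?b = "\<bar>gr x\<bar> + \<delta> S x"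
    have b: "0 \<le> ?b" "?b \<le> M + \<delta> S x" "\<delta> S x \<le> ?b" "0 \<le> \<delta> S x"
      using \<delta>_nonneg[of S x] M(2)[of x] by auto
    have "?b powr (p - 1) * \<delta> S x \<le> ?b powr (p - 1) * ?b powr 1" using b by (intro mult_left_mono) auto
    also have "\<dots> = ?b powr p" by (simp only: powr_add[symmetric]) simp
    also have "\<dots> \<le> (M + \<delta> S x) powr p" using b p by (intro powr_mono2) auto
    finally have le: "?b powr (p - 1) * \<delta> S x \<le> (M + \<delta> S x) powr p" .
    have "(?b powr (p - 1) * \<delta> S x)\<^sup>2 \<le> ((M + \<delta> S x) powr p)\<^sup>2"
      using b by (intro power_mono[OF le] mult_nonneg_nonneg) auto
    also have "\<dots> = (M + \<delta> S x) powr (2 * p)" by (simp add: power2_eq_square powr_add[symmetric])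
    also have "\<dots> \<le> 2 powr (2 * p) * (M powr (2 * p) + \<delta> S x powr (2 * p))"
      by (rule powr_add_le_two_powr[OF M(1) b(4)]) (use p in simp)
    finally have "(real n * p)\<^sup>2 * (?b powr (p - 1) * \<delta> S x)\<^sup>2
        \<le> (real n * p)\<^sup>2 * (2 powr (2 * p) * (M powr (2 * p) + \<delta> S x powr (2 * p)))"
      by (rule mult_left_mono) simp
    then show ?thesis by (simp add: c_def power_mult_distrib algebra_simps)
  qed
  have "(\<integral>\<^sup>+S. (\<integral>\<^sup>+z. ennreal (score p \<sigma> (snd z)) * undominated (dominates \<beta> R) z S \<partial>intensity n g)\<^sup>2 \<partial>Q)
    \<le> (\<integral>\<^sup>+S. ennreal (c * M powr (2 * p)) + (\<integral>\<^sup>+x. ennreal (c * \<delta> S x powr (2 * p)) * indicator {0..1} x \<partial>lborel) \<partial>Q)"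
  proof (rule nn_integral_mono_AE, use AE_good AE_space in eventually_elim)
    case (elim S)
    note S [measurable] = elim(2)[unfolded space_Q, folded space_config_space]
    have "(\<integral>\<^sup>+z. ennreal (score p \<sigma> (snd z)) * undominated (dominates \<beta> R) z S \<partial>intensity n g)
        \<le> (\<integral>\<^sup>+x. ennreal (real n * (p * (\<bar>gr x\<bar> + \<delta> S x) powr (p - 1) * \<delta> S x)) * indicator {0..1} x \<partial>lborel)"
      using p by (intro nn_integral_undominated_le elim(1)) (auto intro!: ennreal_leI score_le)
    \<comment> \<open>Doubling the indicator prepares Cauchy-Schwarz against the constant 1 on the
      unit interval.\<close>
    also have "\<dots> = (\<integral>\<^sup>+x. (ennreal (?K S x) * indicator {0..1} x) * indicator {0..1} x \<partial>lborel)"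
      by (intro nn_integral_cong) (auto simp: indicator_def)
    finally have "(\<integral>\<^sup>+z. ennreal (score p \<sigma> (snd z)) * undominated (dominates \<beta> R) z S \<partial>intensity n g)\<^sup>2
        \<le> (\<integral>\<^sup>+x. (ennreal (?K S x) * indicator {0..1} x) * indicator {0..1} x \<partial>lborel)\<^sup>2"
      by (rule power_mono) simp
    also have "\<dots> \<le> (\<integral>\<^sup>+x. (ennreal (?K S x) * indicator {0..1} x)\<^sup>2 \<partial>lborel) * (\<integral>\<^sup>+x. (indicator {0..1::real} x)\<^sup>2 \<partial>lborel)"
      by (rule Cauchy_Schwarz_nn_integral) measurable
    also have "(\<integral>\<^sup>+x. (indicator {0..1::real} x)\<^sup>2 \<partial>lborel) = 1"
      by (simp add: power2_eq_square flip: indicator_inter_arith)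
    also have "(\<integral>\<^sup>+x. (ennreal (?K S x) * indicator {0..1} x)\<^sup>2 \<partial>lborel)
        \<le> (\<integral>\<^sup>+x. ennreal (c * M powr (2 * p)) * indicator {0..1} x + ennreal (c * \<delta> S x powr (2 * p)) * indicator {0..1} x \<partial>lborel)"
    proof (rule nn_integral_mono)
      fix x
      have "ennreal (?K S x) ^ 2 = ennreal ((?K S x)\<^sup>2)" using p \<delta>_nonneg by (intro ennreal_power) auto
      also have "\<dots> \<le> ennreal (c * M powr (2 * p)) + ennreal (c * \<delta> S x powr (2 * p))"
      proof -
        have "0 \<le> c * M powr (2 * p)" "0 \<le> c * \<delta> S x powr (2 * p)" using c by simp_all
        from ennreal_leI[OF sq[of x S], unfolded ennreal_plus[OF this]] show ?thesis .
      qed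
      finally show "(ennreal (?K S x) * indicator {0..1} x)\<^sup>2 \<le> ennreal (c * M powr (2 * p)) * indicator {0..1} x + ennreal (c * \<delta> S x powr (2 * p)) * indicator {0..1} x"
        by (auto simp: indicator_def)
    qed
    also have "\<dots> = ennreal (c * M powr (2 * p)) + (\<integral>\<^sup>+x. ennreal (c * \<delta> S x powr (2 * p)) * indicator {0..1} x \<partial>lborel)"
      by (subst nn_integral_add) (auto simp: nn_integral_cmult_indicator)
    finally show ?case by simp
  qed
  also have "\<dots> = ennreal (c * M powr (2 * p)) + (\<integral>\<^sup>+S. \<integral>\<^sup>+x. ennreal (c * \<delta> S x powr (2 * p)) * indicator {0..1} x \<partial>lborel \<partial>Q)"
    by (subst nn_integral_add) (auto simp: emeasure_space_1)
  also have "\<dots> \<le> ennreal (c * M powr (2 * p)) + (\<integral>\<^sup>+x. ennreal (c * (moment_const \<beta> R (2 * p) * \<epsilon> powr (2 * p))) * indicator {0..1::real} x \<partial>lborel)"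
    using c p by (intro add_left_mono expected_weighted_moment) auto
  also have "\<dots> < \<infinity>"
    by (simp add: nn_integral_cmult_indicator ennreal_mult_less_top)
  finally show ?thesis .
qed

text \<open>The squared score is integrated over a segment of length \<open>\<delta> S x\<close> on
  which \<open>\<bar>y\<bar> \<le> \<bar>g x\<bar> + \<delta> S x\<close>. Splitting the power of
  this sum leaves one factor \<open>\<delta> S x\<close> beside the curve, and the power
  \<open>2 * p - 1\<close> of \<open>\<delta> S x\<close> alone.\<close>

lemma expected_squared_score:
  assumes p: "1 \<le> p"
  shows "(\<integral>\<^sup>+z. \<integral>\<^sup>+S. ennreal (score p \<sigma> (snd z)) * ennreal (score p \<sigma> (snd z)) * undominated (dominates \<beta> R) z S \<partial>Q \<partial>intensity n g)
    \<le> ennreal (real n * p\<^sup>2 * 2 powr (2 * p - 2) *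
        ((LINT x:{0..1}|lborel. \<bar>g x\<bar> powr (2 * p - 2)) * (moment_const \<beta> R 1 * \<epsilon>)
          + moment_const \<beta> R (2 * p - 1) * \<epsilon> powr (2 * p - 1)))"
proof -
  interpret I: sigma_finite_measure "intensity n g" by (rule sigma_finite_intensity[OF g_cont])
  interpret IQ: pair_sigma_finite "intensity n g" Q ..
  let ?k = "\<lambda>y. ennreal (score p \<sigma> y) * ennreal (score p \<sigma> y)"
  define c where "c = real n * p\<^sup>2 * 2 powr (2 * p - 2)"
  have c: "0 \<le> c" by (simp add: c_def)
  have [measurable]: "(\<lambda>x. undominated (dominates \<beta> R) (fst x) (snd x)) \<in> borel_measurable (borel \<Otimes>\<^sub>M config_space)"
    by (rule measurable_undominated[OF sets_dominates]) auto
  have k_le: "?k y \<le> ennreal (p\<^sup>2 * (\<bar>gr x\<bar> + \<delta> S x) powr (2 * p - 2))" if "\<bar>y\<bar> \<le> \<bar>gr x\<bar> + \<delta> S x" for y x S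
  proof -
    have "?k y = ennreal (score p \<sigma> y * score p \<sigma> y)" using p by (simp add: ennreal_mult score_nonneg)
    also have "\<dots> \<le> ennreal ((p * (\<bar>gr x\<bar> + \<delta> S x) powr (p - 1)) * (p * (\<bar>gr x\<bar> + \<delta> S x) powr (p - 1)))"
      using p that by (intro ennreal_leI mult_mono score_le) (auto simp: score_nonneg)
    also have "(p * (\<bar>gr x\<bar> + \<delta> S x) powr (p - 1)) * (p * (\<bar>gr x\<bar> + \<delta> S x) powr (p - 1))
        = p\<^sup>2 * ((\<bar>gr x\<bar> + \<delta> S x) powr (p - 1) * (\<bar>gr x\<bar> + \<delta> S x) powr (p - 1))"
      by (simp add: power2_eq_square mult_ac)
    also have "\<dots> = p\<^sup>2 * (\<bar>gr x\<bar> + \<delta> S x) powr (2 * p - 2)"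
      by (simp add: powr_add[symmetric])
    finally show ?thesis .
  qed
  have K_le: "real n * (p\<^sup>2 * (\<bar>gr x\<bar> + \<delta> S x) powr (2 * p - 2) * \<delta> S x)
      \<le> c * \<bar>gr x\<bar> powr (2 * p - 2) * \<delta> S x powr 1 + c * \<delta> S x powr (2 * p - 1)" for S x
  proof -
    have "(\<bar>gr x\<bar> + \<delta> S x) powr (2 * p - 2) \<le> 2 powr (2 * p - 2) * (\<bar>gr x\<bar> powr (2 * p - 2) + \<delta> S x powr (2 * p - 2))"
      using p \<delta>_nonneg by (intro powr_add_le_two_powr) auto
    then have "real n * p\<^sup>2 * ((\<bar>gr x\<bar> + \<delta> S x) powr (2 * p - 2) * \<delta> S x)
        \<le> real n * p\<^sup>2 * (2 powr (2 * p - 2) * (\<bar>gr x\<bar> powr (2 * p - 2) + \<delta> S x powr (2 * p - 2)) * \<delta> S x)"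
      using \<delta>_nonneg by (intro mult_left_mono mult_right_mono) auto
    also have "\<dots> = c * \<bar>gr x\<bar> powr (2 * p - 2) * \<delta> S x + c * (\<delta> S x powr (2 * p - 2) * \<delta> S x)"
      by (simp add: c_def algebra_simps)
    also have "\<delta> S x powr (2 * p - 2) * \<delta> S x = \<delta> S x powr (2 * p - 1)"
      using powr_add[of "\<delta> S x" "2 * p - 2" 1] \<delta>_nonneg[of S x] by simp
    finally show ?thesis using \<delta>_nonneg[of S x] by (simp add: mult_ac)
  qed
  have "(\<integral>\<^sup>+z. \<integral>\<^sup>+S. ?k (snd z) * undominated (dominates \<beta> R) z S \<partial>Q \<partial>intensity n g)
      = (\<integral>\<^sup>+S. \<integral>\<^sup>+z. ?k (snd z) * undominated (dominates \<beta> R) z S \<partial>intensity n g \<partial>Q)"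
    by (rule IQ.Fubini'[symmetric]) (unfold split_beta', measurable)
  also have "\<dots> \<le> (\<integral>\<^sup>+S. (\<integral>\<^sup>+x. ennreal (c * \<bar>gr x\<bar> powr (2 * p - 2) * \<delta> S x powr 1) * indicator {0..1} x \<partial>lborel)
      + (\<integral>\<^sup>+x. ennreal (c * \<delta> S x powr (2 * p - 1)) * indicator {0..1} x \<partial>lborel) \<partial>Q)"
  proof (rule nn_integral_mono_AE, use AE_good AE_space in eventually_elim)
    case (elim S)
    note S [measurable] = elim(2)[unfolded space_Q, folded space_config_space]
    have "(\<integral>\<^sup>+z. ?k (snd z) * undominated (dominates \<beta> R) z S \<partial>intensity n g)
        \<le> (\<integral>\<^sup>+x. ennreal (real n * (p\<^sup>2 * (\<bar>gr x\<bar> + \<delta> S x) powr (2 * p - 2) * \<delta> S x)) * indicator {0..1} x \<partial>lborel)"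
      by (rule nn_integral_undominated_le[OF elim(1)]) (auto intro: k_le)
    also have "\<dots> \<le> (\<integral>\<^sup>+x. ennreal (c * \<bar>gr x\<bar> powr (2 * p - 2) * \<delta> S x powr 1) * indicator {0..1} x
        + ennreal (c * \<delta> S x powr (2 * p - 1)) * indicator {0..1} x \<partial>lborel)"
    proof (rule nn_integral_mono)
      fix x
      have "ennreal (real n * (p\<^sup>2 * (\<bar>gr x\<bar> + \<delta> S x) powr (2 * p - 2) * \<delta> S x))
          \<le> ennreal (c * \<bar>gr x\<bar> powr (2 * p - 2) * \<delta> S x powr 1) + ennreal (c * \<delta> S x powr (2 * p - 1))"
      proof -
        have "0 \<le> c * \<bar>gr x\<bar> powr (2 * p - 2) * \<delta> S x powr 1" "0 \<le> c * \<delta> S x powr (2 * p - 1)"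
          using c by simp_all
        from ennreal_leI[OF K_le[of x S], unfolded ennreal_plus[OF this]] show ?thesis .
      qed
      then show "ennreal (real n * (p\<^sup>2 * (\<bar>gr x\<bar> + \<delta> S x) powr (2 * p - 2) * \<delta> S x)) * indicator {0..1} x
          \<le> ennreal (c * \<bar>gr x\<bar> powr (2 * p - 2) * \<delta> S x powr 1) * indicator {0..1} x
            + ennreal (c * \<delta> S x powr (2 * p - 1)) * indicator {0..1} x"
        by (auto simp: indicator_def)
    qed
    also have "\<dots> = (\<integral>\<^sup>+x. ennreal (c * \<bar>gr x\<bar> powr (2 * p - 2) * \<delta> S x powr 1) * indicator {0..1} x \<partial>lborel)
        + (\<integral>\<^sup>+x. ennreal (c * \<delta> S x powr (2 * p - 1)) * indicator {0..1} x \<partial>lborel)"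
      by (rule nn_integral_add) measurable
    finally show ?case .
  qed
  also have "\<dots> = (\<integral>\<^sup>+S. \<integral>\<^sup>+x. ennreal (c * \<bar>gr x\<bar> powr (2 * p - 2) * \<delta> S x powr 1) * indicator {0..1} x \<partial>lborel \<partial>Q)
      + (\<integral>\<^sup>+S. \<integral>\<^sup>+x. ennreal (c * \<delta> S x powr (2 * p - 1)) * indicator {0..1} x \<partial>lborel \<partial>Q)"
    by (rule nn_integral_add) measurable
  also have "\<dots> \<le> (\<integral>\<^sup>+x. ennreal (c * \<bar>gr x\<bar> powr (2 * p - 2) * (moment_const \<beta> R 1 * \<epsilon> powr 1)) * indicator {0..1} x \<partial>lborel)
      + (\<integral>\<^sup>+x. ennreal (c * (moment_const \<beta> R (2 * p - 1) * \<epsilon> powr (2 * p - 1))) * indicator {0..1::real} x \<partial>lborel)"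
    using c p by (intro add_mono expected_weighted_moment) auto
  also have "(\<integral>\<^sup>+x. ennreal (c * \<bar>gr x\<bar> powr (2 * p - 2) * (moment_const \<beta> R 1 * \<epsilon> powr 1)) * indicator {0..1} x \<partial>lborel)
      = ennreal (c * (LINT x:{0..1}|lborel. \<bar>g x\<bar> powr (2 * p - 2)) * (moment_const \<beta> R 1 * \<epsilon>))"
  proof -
    let ?m = "c * (moment_const \<beta> R 1 * \<epsilon>)"
    have m: "0 \<le> ?m" using c moment_const_nonneg[OF R, of 1 \<beta>] \<epsilon>_pos by simp
    have "(\<integral>\<^sup>+x. ennreal (c * \<bar>gr x\<bar> powr (2 * p - 2) * (moment_const \<beta> R 1 * \<epsilon> powr 1)) * indicator {0..1} x \<partial>lborel)
        = (\<integral>\<^sup>+x. ennreal (?m * (indicat_real {0..1} x * \<bar>gr x\<bar> powr (2 * p - 2))) \<partial>lborel)"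
      using \<epsilon>_pos by (intro nn_integral_cong) (auto simp: indicator_def mult_ac)
    also have "\<dots> = ennreal (\<integral>x. ?m * (indicat_real {0..1} x * \<bar>gr x\<bar> powr (2 * p - 2)) \<partial>lborel)"
      using abs_gr_powr_integrable[of "2 * p - 2"] p m
      by (intro nn_integral_eq_integral integrable_mult_right AE_I2 mult_nonneg_nonneg[OF m]) auto
    also have "\<dots> = ennreal (?m * (LINT x:{0..1}|lborel. \<bar>g x\<bar> powr (2 * p - 2)))"
      unfolding abs_g_powr_integral by simp
    finally show ?thesis by (simp add: mult_ac)
  qed
  also have "(\<integral>\<^sup>+x. ennreal (c * (moment_const \<beta> R (2 * p - 1) * \<epsilon> powr (2 * p - 1))) * indicator {0..1::real} x \<partial>lborel)
      = ennreal (c * (moment_const \<beta> R (2 * p - 1) * \<epsilon> powr (2 * p - 1)))"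
    by (simp add: nn_integral_cmult_indicator)
  also have "ennreal (c * (LINT x:{0..1}|lborel. \<bar>g x\<bar> powr (2 * p - 2)) * (moment_const \<beta> R 1 * \<epsilon>)) + \<dots>
      = ennreal (c * ((LINT x:{0..1}|lborel. \<bar>g x\<bar> powr (2 * p - 2)) * (moment_const \<beta> R 1 * \<epsilon>)
          + moment_const \<beta> R (2 * p - 1) * \<epsilon> powr (2 * p - 1)))"
  proof (subst ennreal_plus[symmetric])
    show "0 \<le> c * (LINT x:{0..1}|lborel. \<bar>g x\<bar> powr (2 * p - 2)) * (moment_const \<beta> R 1 * \<epsilon>)"
      using c moment_const_nonneg[OF R, of 1 \<beta>] \<epsilon>_pos unfolding abs_g_powr_integral
      by (intro mult_nonneg_nonneg Bochner_Integration.integral_nonneg) auto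
    show "0 \<le> c * (moment_const \<beta> R (2 * p - 1) * \<epsilon> powr (2 * p - 1))"
      using c moment_const_nonneg[OF R, of "2 * p - 1" \<beta>] p by auto
  qed (simp add: algebra_simps)
  finally show ?thesis unfolding c_def .
qed

theorem F_hat_mean_square:
  assumes p: "1 \<le> p"
  shows "(\<integral>\<^sup>+S. ennreal ((F_hat \<beta> R p n S - (LINT x:{0..1}|lborel. \<bar>g x\<bar> powr p))\<^sup>2) \<partial>Q)
    \<le> ennreal (4 * p\<^sup>2 * 2 powr (2 * p - 2) / real n *
        ((LINT x:{0..1}|lborel. \<bar>g x\<bar> powr (2 * p - 2)) * (moment_const \<beta> R 1 * \<epsilon>)
          + moment_const \<beta> R (2 * p - 1) * \<epsilon> powr (2 * p - 1)))"
proof -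
  interpret I: sigma_finite_measure "intensity n g" by (rule sigma_finite_intensity[OF g_cont])
  let ?u = "undominated (dominates \<beta> R)"
  let ?A = "\<lambda>\<sigma> S. enn2real (\<integral>\<^sup>+z. ennreal (score p \<sigma> (snd z)) * ?u z S \<partial>count_space S)"
  let ?B = "\<lambda>\<sigma> S. enn2real (\<integral>\<^sup>+z. ennreal (score p \<sigma> (snd z)) * ?u z S \<partial>intensity n g)"
  let ?X = "\<lambda>\<sigma> S. ennreal ((?A \<sigma> S - ?B \<sigma> S)\<^sup>2)"
  define t where "t = (LINT x:{0..1}|lborel. \<bar>g x\<bar> powr (2 * p - 2)) * (moment_const \<beta> R 1 * \<epsilon>)
          + moment_const \<beta> R (2 * p - 1) * \<epsilon> powr (2 * p - 1)"
  define v where "v = real n * p\<^sup>2 * 2 powr (2 * p - 2) * t"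
  have t: "0 \<le> t"
    unfolding t_def abs_g_powr_integral
    using moment_const_nonneg[OF R, of 1 \<beta>] moment_const_nonneg[OF R, of "2 * p - 1" \<beta>] \<epsilon>_pos p
    by (intro add_nonneg_nonneg mult_nonneg_nonneg Bochner_Integration.integral_nonneg) auto
  have [measurable]: "(\<lambda>x. ?u (snd x) (fst x)) \<in> borel_measurable (config_space \<Otimes>\<^sub>M borel)"
    by (rule measurable_undominated[OF sets_dominates]) measurable
  have X_meas [measurable]: "?X \<sigma> \<in> borel_measurable config_space" for \<sigma>
    by measurable
  have var: "(\<integral>\<^sup>+S. ?X \<sigma> S \<partial>Q) \<le> ennreal v" for \<sigma>
  proof -
    have "(\<integral>\<^sup>+S. ?X \<sigma> S \<partial>Q)
        \<le> (\<integral>\<^sup>+z. \<integral>\<^sup>+S. ennreal (score p \<sigma> (snd z)) * ennreal (score p \<sigma> (snd z)) * ?u z S \<partial>Q \<partial>intensity n g)"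
      by (rule undominated_sum_variance[OF law sets_intensity I.sigma_finite_measure_axioms
            emeasure_intensity_dyad[OF g_cont] sets_dominates dominates_asym[OF R_nonneg] _
            compensator_second_moment_finite[OF p]]) measurable
    also have "\<dots> \<le> ennreal v" unfolding v_def t_def by (rule expected_squared_score[OF p])
    finally show ?thesis .
  qed
  have "(\<integral>\<^sup>+S. ennreal ((F_hat \<beta> R p n S - (LINT x:{0..1}|lborel. \<bar>g x\<bar> powr p))\<^sup>2) \<partial>Q)
      \<le> (\<integral>\<^sup>+S. ennreal (2 / (real n)\<^sup>2) * (?X 1 S + ?X (-1) S) \<partial>Q)"
  proof (rule nn_integral_mono_AE, use AE_good in eventually_elim)
    case (elim S)
    have "ennreal ((F_hat \<beta> R p n S - (LINT x:{0..1}|lborel. \<bar>g x\<bar> powr p))\<^sup>2)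
        \<le> ennreal (2 / (real n)\<^sup>2 * ((?A 1 S - ?B 1 S)\<^sup>2 + (?A (-1) S - ?B (-1) S)\<^sup>2))"
      by (rule ennreal_leI[OF F_hat_error[OF elim p]])
    also have "\<dots> = ennreal (2 / (real n)\<^sup>2) * (?X 1 S + ?X (-1) S)"
      by (subst ennreal_mult) auto
    finally show ?case .
  qed
  also have "\<dots> = ennreal (2 / (real n)\<^sup>2) * ((\<integral>\<^sup>+S. ?X 1 S \<partial>Q) + (\<integral>\<^sup>+S. ?X (-1) S \<partial>Q))"
    by (subst nn_integral_cmult, measurable, subst nn_integral_add, measurable)
  also have "\<dots> \<le> ennreal (2 / (real n)\<^sup>2) * (ennreal v + ennreal v)"
    by (intro mult_left_mono add_mono var) simp
  also have "\<dots> = ennreal (2 / (real n)\<^sup>2 * (v + v))"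
    using t by (simp add: v_def flip: ennreal_plus ennreal_mult)
  \<comment> \<open>Of the factor 4, one 2 stems from \<open>F_hat_error\<close>, the other from the
    two signs.\<close>
  also have "2 / (real n)\<^sup>2 * (v + v) = 4 * p\<^sup>2 * 2 powr (2 * p - 2) / real n * t"
    using n by (simp add: v_def power2_eq_square)
  finally show ?thesis unfolding t_def .
qed

end

section \<open>The upper bound\<close>

lemma powr_le_one_plus:
  fixes y a :: real
  assumes "0 \<le> y" "0 \<le> a" "a \<le> 1"
  shows "y powr a \<le> 1 + y"
proof (cases "y \<le> 1")
  case True
  then have "y powr a \<le> 1" using assms powr_mono2[of a y 1] by simp
  then show ?thesis using assms by simp
next
  case False
  then have "y powr a \<le> y powr 1" using assms by (intro powr_mono) auto
  then show ?thesis using False by simp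
qed

text \<open>After division by \<open>b\<close> this says that \<open>s powr t\<close> lies between 1
  and \<open>s\<close>.\<close>

lemma abs_powr_diff_le_linear:
  fixes a b t :: real
  assumes a: "0 \<le> a" and b: "0 < b" and t: "0 < t" "t \<le> 1"
  shows "\<bar>a powr t - b powr t\<bar> \<le> \<bar>a - b\<bar> * b powr (t - 1)"
proof -
  define s where "s = a / b"
  have s: "0 \<le> s" "a = s * b" using a b by (auto simp: s_def)
  have "\<bar>s powr t - 1\<bar> \<le> \<bar>s - 1\<bar>"
  proof (cases "s \<le> 1")
    case True
    then show ?thesis using s t powr_mono'[of t 1 s] powr_mono2[of t s 1] by auto
  next
    case False
    then show ?thesis using s t powr_mono[of t 1 s] powr_mono2[of t 1 s] by auto
  qed
  then have "\<bar>s powr t - 1\<bar> * b powr t \<le> \<bar>s - 1\<bar> * b powr t" by (rule mult_right_mono) simp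
  moreover have "\<bar>a powr t - b powr t\<bar> = \<bar>s powr t - 1\<bar> * b powr t"
  proof -
    have "a powr t - b powr t = (s powr t - 1) * b powr t"
      using s b by (simp add: powr_mult algebra_simps)
    then show ?thesis by (simp add: abs_mult)
  qed
  moreover have "\<bar>a - b\<bar> * b powr (t - 1) = \<bar>s - 1\<bar> * b powr t"
  proof -
    have "a - b = (s - 1) * b" using s by (simp add: algebra_simps)
    moreover have "b * b powr (t - 1) = b powr t" using b powr_add[of b 1 "t - 1"] by simp
    ultimately show ?thesis using b by (simp add: abs_mult mult.assoc)
  qed
  ultimately show ?thesis by simp
qed

text \<open>Takes the place of Jensen's inequality at the price of a factor 2:
  \<open>y powr t \<le> 1 + y\<close> is applied to \<open>y = (X s)\<^sup>2 / V\<close>, where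
  \<open>V\<close> may be any positive bound on the second moment.\<close>

lemma (in prob_space) moment_interpolation:
  fixes X :: "'a \<Rightarrow> real"
  assumes [measurable]: "X \<in> borel_measurable M"
    and V: "0 < V" "(\<integral>\<^sup>+s. ennreal ((X s)\<^sup>2) \<partial>M) \<le> ennreal V" and t: "0 < t" "t \<le> 1"
  shows "(\<integral>\<^sup>+s. ennreal (\<bar>X s\<bar> powr (2 * t)) \<partial>M) \<le> ennreal (2 * V powr t)"
proof -
  have "(\<integral>\<^sup>+s. ennreal (\<bar>X s\<bar> powr (2 * t)) \<partial>M)
      \<le> (\<integral>\<^sup>+s. ennreal (V powr t) + ennreal (V powr t / V) * ennreal ((X s)\<^sup>2) \<partial>M)"
  proof (rule nn_integral_mono)
    fix s
    have "\<bar>X s\<bar> powr (2 * t) = ((X s)\<^sup>2) powr t"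
    proof (cases "X s = 0")
      case False
      then have "(X s)\<^sup>2 = \<bar>X s\<bar> powr 2" by simp
      then show ?thesis by (simp only: powr_powr)
    qed simp
    also have "\<dots> = V powr t * ((X s)\<^sup>2 / V) powr t" using V(1) by (simp add: powr_divide)
    also have "\<dots> \<le> V powr t * (1 + (X s)\<^sup>2 / V)"
      using V(1) t by (intro mult_left_mono powr_le_one_plus) auto
    finally have "ennreal (\<bar>X s\<bar> powr (2 * t)) \<le> ennreal (V powr t + V powr t / V * (X s)\<^sup>2)"
      by (intro ennreal_leI) (simp add: distrib_left)
    also have "\<dots> = ennreal (V powr t) + ennreal (V powr t / V) * ennreal ((X s)\<^sup>2)"
      using V(1) by (subst ennreal_mult[symmetric]) (auto intro!: ennreal_plus)
    finally show "ennreal (\<bar>X s\<bar> powr (2 * t)) \<le> \<dots>" .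
  qed
  also have "\<dots> = ennreal (V powr t) + ennreal (V powr t / V) * (\<integral>\<^sup>+s. ennreal ((X s)\<^sup>2) \<partial>M)"
    by (simp add: nn_integral_add nn_integral_cmult emeasure_space_1)
  also have "\<dots> \<le> ennreal (V powr t) + ennreal (V powr t / V) * ennreal V"
    by (intro add_left_mono mult_left_mono V) simp
  also have "\<dots> = ennreal (2 * V powr t)"
    using V(1) by (simp flip: ennreal_mult ennreal_plus)
  finally show ?thesis .
qed

section \<open>From the power integral to the norm\<close>

context boundary_model
begin

definition rate :: "real \<Rightarrow> real" where "rate p = real n powr (- ((\<beta> + 1 / (2 * p)) / (\<beta> + 1)))"

lemma n_eq: "1 / real n = \<epsilon> powr (1 / \<beta> + 1)"
proof -
  have "real n * \<epsilon> powr (1 / \<beta> + 1) = 1" using \<epsilon>_scale \<epsilon>_pos by (simp add: powr_add)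
  then show ?thesis using n by (simp add: field_simps)
qed

lemma rate_eq: "1 \<le> p \<Longrightarrow> rate p = \<epsilon> powr (1 + 1 / (2 * p * \<beta>))"
proof -
  assume p: "1 \<le> p"
  have "\<beta> * (1 + 1 / (2 * p * \<beta>)) = \<beta> + 1 / (2 * p)" using \<beta> p by (simp add: field_simps)
  moreover have "- (\<beta> / (\<beta> + 1)) * t = - (\<beta> * t / (\<beta> + 1))" for t by simp
  ultimately have "- (\<beta> / (\<beta> + 1)) * (1 + 1 / (2 * p * \<beta>)) = - ((\<beta> + 1 / (2 * p)) / (\<beta> + 1))"
    by (simp only:)
  then show ?thesis unfolding rate_def \<epsilon>_def by (simp only: powr_powr)
qed

lemma rate_pos: "0 < rate p"
  using n by (simp add: rate_def)

definition power_integral :: "real \<Rightarrow> real" where "power_integral q = (LINT x:{0..1}|lborel. \<bar>g x\<bar> powr q)"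

lemma power_integral_nonneg: "0 \<le> power_integral q"
  unfolding power_integral_def abs_g_powr_integral by (intro Bochner_Integration.integral_nonneg) auto

lemma power_integral_le:
  assumes q: "0 \<le> q" "0 \<le> q'" and b: "0 \<le> a" "0 \<le> b"
    and le: "\<And>x. x \<in> {0..1} \<Longrightarrow> \<bar>g x\<bar> powr q \<le> a + b * \<bar>g x\<bar> powr q'"
  shows "power_integral q \<le> a + b * power_integral q'"
proof -
  have "power_integral q \<le> (\<integral>x. a * indicat_real {0..1} x + b * (indicat_real {0..1} x * \<bar>gr x\<bar> powr q') \<partial>lborel)"
    unfolding power_integral_def abs_g_powr_integral
  proof (rule integral_mono)
    show "integrable lborel (\<lambda>x. a * indicat_real {0..1} x + b * (indicat_real {0..1} x * \<bar>gr x\<bar> powr q'))"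
      by (intro Bochner_Integration.integrable_add integrable_mult_right abs_gr_powr_integrable q) simp
    fix x
    show "indicat_real {0..1} x * \<bar>gr x\<bar> powr q
        \<le> a * indicat_real {0..1} x + b * (indicat_real {0..1} x * \<bar>gr x\<bar> powr q')"
    proof (cases "x \<in> {0..1}")
      case True
      with le[OF True] show ?thesis by (simp add: gr_def)
    qed simp
  qed (rule abs_gr_powr_integrable[OF q(1)])
  also have "\<dots> = a + b * power_integral q'"
    unfolding power_integral_def abs_g_powr_integral using abs_gr_powr_integrable[OF q(2)] by simp
  finally show ?thesis .
qed

text \<open>A curve reaching the level \<open>M\<close> stays above \<open>M / 2\<close> on an interval of length
  of order \<open>min 1 (M powr (1 / \<beta>))\<close>.\<close>

lemma power_integral_ge_peak:
  assumes p: "1 \<le> p" and x0: "x0 \<in> {0..1}" and M: "\<epsilon> \<le> \<bar>g x0\<bar>"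
  shows "min ((1 / (2 * R)) powr (1 / \<beta>)) (1 / 2) * \<epsilon> powr (1 / \<beta>) * (\<bar>g x0\<bar> / 2) powr p \<le> power_integral p"
proof -
  let ?M = "\<bar>g x0\<bar>" and ?c = "min ((1 / (2 * R)) powr (1 / \<beta>)) (1 / 2)"
  \<comment> \<open>The length is measured by \<open>\<epsilon>\<close> rather than by the larger
    height of the peak. This is enough: the oscillation is at most \<open>\<epsilon> / 2\<close>,
    hence at most half of the height.\<close>
  define l where "l = ?c * \<epsilon> powr (1 / \<beta>)"
  have e1: "\<epsilon> powr (1 / \<beta>) \<le> 1" using powr_mono2[of "1 / \<beta>" \<epsilon> 1] \<epsilon>_pos \<epsilon>_le_1 \<beta> by simp
  have c: "0 < ?c" using R by simp
  have l: "0 \<le> l" "l \<le> 1 / 2"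
  proof -
    show "0 \<le> l" using c by (simp add: l_def)
    have "l \<le> 1 / 2 * 1" unfolding l_def using e1 c by (intro mult_mono) auto
    then show "l \<le> 1 / 2" by simp
  qed
  have "l powr \<beta> \<le> ((1 / (2 * R)) powr (1 / \<beta>) * \<epsilon> powr (1 / \<beta>)) powr \<beta>"
    using l \<beta> unfolding l_def by (intro powr_mono2 mult_right_mono) auto
  also have "\<dots> = \<epsilon> / (2 * R)" using \<beta> R \<epsilon>_pos by (simp add: powr_mult powr_powr)
  finally have lb: "R * l powr \<beta> \<le> \<epsilon> / 2" using R by (simp add: field_simps)
  define a where "a = (if x0 \<le> 1 / 2 then x0 else x0 - l)"
  have sub: "{a..a + l} \<subseteq> {0..1}" using x0 l by (auto simp: a_def)
  have ge: "?M / 2 \<le> \<bar>g x\<bar>" if x: "x \<in> {a..a + l}" for x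
  proof -
    have "\<bar>x0 - x\<bar> \<le> l" using x by (auto simp: a_def split: if_splits)
    then have "R * \<bar>x0 - x\<bar> powr \<beta> \<le> R * l powr \<beta>" using \<beta> R by (intro mult_left_mono powr_mono2) auto
    moreover have "\<bar>g x0 - g x\<bar> \<le> R * \<bar>x0 - x\<bar> powr \<beta>"
      using g x0 sub x unfolding hoelder_ball_def by blast
    ultimately show ?thesis using lb M by linarith
  qed
  have "l * (?M / 2) powr p = (\<integral>x. (?M / 2) powr p * indicat_real {a..a + l} x \<partial>lborel)"
    using l by simp
  also have "\<dots> \<le> power_integral p"
    unfolding power_integral_def abs_g_powr_integral
  proof (rule integral_mono)
    show "integrable lborel (\<lambda>x. (?M / 2) powr p * indicat_real {a..a + l} x)"
      by (intro integrable_mult_right integrable_real_indicator) (auto simp: emeasure_lborel_Icc_eq)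
    show "integrable lborel (\<lambda>x. indicat_real {0..1} x * \<bar>gr x\<bar> powr p)"
      using abs_gr_powr_integrable[of p] p by simp
    fix x
    show "(?M / 2) powr p * indicat_real {a..a + l} x \<le> indicat_real {0..1} x * \<bar>gr x\<bar> powr p"
    proof (cases "x \<in> {a..a + l}")
      case True
      then have "x \<in> {0..1}" using sub by auto
      then show ?thesis using True ge[OF True] p by (auto simp: gr_def intro!: powr_mono2)
    qed auto
  qed
  finally show ?thesis unfolding l_def by (simp add: mult.assoc)
qed

text \<open>In the first case the bound \<open>\<bar>a powr (1 / p) - b powr (1 / p)\<bar> \<le> \<bar>a - b\<bar> powr (1 / p)\<close> gives the rate, in the
  second case the linearisation of the root at \<open>power_integral p\<close>.\<close>

lemma variance_dichotomy:
  assumes p: "1 \<le> p"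
  defines "V1 \<equiv> \<epsilon> * power_integral (2 * p - 2) / real n"
    and "K \<equiv> max 2 ((min ((1 / (2 * R)) powr (1 / \<beta>)) (1 / 2) * (1 / 2) powr p) powr (2 / p - 1))"
  shows "V1 \<le> rate p powr (2 * p) \<or> (0 < power_integral p \<and> V1 \<le> K * (rate p)\<^sup>2 * power_integral p powr (2 - 2 / p))"
proof -
  have V1: "V1 = \<epsilon> powr (2 + 1 / \<beta>) * power_integral (2 * p - 2)"
  proof -
    have "V1 = \<epsilon> powr 1 * (1 / real n) * power_integral (2 * p - 2)" using \<epsilon>_pos by (simp add: V1_def)
    also have "\<epsilon> powr 1 * (1 / real n) = \<epsilon> powr (1 + (1 / \<beta> + 1))" unfolding n_eq by (simp only: powr_add)
    finally show ?thesis by (simp add: add_ac)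
  qed
  have r2p: "rate p powr (2 * p) = \<epsilon> powr (2 + 1 / \<beta>) * \<epsilon> powr (2 * p - 2)"
  proof -
    have "rate p powr (2 * p) = \<epsilon> powr ((1 + 1 / (2 * p * \<beta>)) * (2 * p))" unfolding rate_eq[OF p] by (rule powr_powr)
    also have "(1 + 1 / (2 * p * \<beta>)) * (2 * p) = (2 + 1 / \<beta>) + (2 * p - 2)" using p \<beta> by (simp add: field_simps)
    finally show ?thesis by (simp only: powr_add)
  qed
  have r2: "(rate p)\<^sup>2 = \<epsilon> powr (2 + 1 / (p * \<beta>))"
  proof -
    have "(rate p)\<^sup>2 = rate p powr 2" using rate_pos[of p] by simp
    also have "\<dots> = \<epsilon> powr ((1 + 1 / (2 * p * \<beta>)) * 2)" unfolding rate_eq[OF p] by (rule powr_powr)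
    also have "(1 + 1 / (2 * p * \<beta>)) * 2 = 2 + 1 / (p * \<beta>)" using p \<beta> by (simp add: field_simps)
    finally show ?thesis .
  qed
  have small: "V1 \<le> rate p powr (2 * p)" if "power_integral (2 * p - 2) \<le> \<epsilon> powr (2 * p - 2)"
    unfolding V1 r2p using that by (intro mult_left_mono) auto
  show ?thesis
  proof (cases "p < 2")
    case True
    \<comment> \<open>Here \<open>2 * p - 2 < p\<close>, and a Young-type inequality with a free
      scale \<open>s\<close> compares the power integrals. The scale is \<open>\<epsilon>\<close>
      for a curve of norm 0, and otherwise the norm itself, which balances the two terms.\<close>
    have G: "power_integral (2 * p - 2) \<le> s powr (2 * p - 2) + s powr (2 * p - 2) / s powr p * power_integral p" if s: "0 < s" for s
    proof (rule power_integral_le)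
      fix x
      have "(\<bar>g x\<bar> / s) powr (2 * p - 2) \<le> 1 + (\<bar>g x\<bar> / s) powr p"
      proof -
        have "(\<bar>g x\<bar> / s) powr (2 * p - 2) = ((\<bar>g x\<bar> / s) powr p) powr ((2 * p - 2) / p)"
          using p by (simp add: powr_powr)
        also have "\<dots> \<le> 1 + (\<bar>g x\<bar> / s) powr p"
          using p True by (intro powr_le_one_plus) (auto simp: divide_le_eq)
        finally show ?thesis .
      qed
      then have "s powr (2 * p - 2) * (\<bar>g x\<bar> / s) powr (2 * p - 2) \<le> s powr (2 * p - 2) * (1 + (\<bar>g x\<bar> / s) powr p)"
        by (rule mult_left_mono) simp
      then show "\<bar>g x\<bar> powr (2 * p - 2) \<le> s powr (2 * p - 2) + s powr (2 * p - 2) / s powr p * \<bar>g x\<bar> powr p"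
        using s by (simp add: powr_divide distrib_left)
    qed (use p in auto)
    show ?thesis
    proof (cases "power_integral p = 0")
      case True
      then show ?thesis using small G[OF \<epsilon>_pos] by simp
    next
      case False
      then have F: "0 < power_integral p" using power_integral_nonneg[of p] by simp
      define s where "s = power_integral p powr (1 / p)"
      have s: "0 < s" using F by (simp add: s_def)
      have sp: "s powr p = power_integral p" using F p by (simp add: s_def powr_powr)
      have s2: "s powr (2 * p - 2) = power_integral p powr (2 - 2 / p)"
        unfolding s_def powr_powr using p by (simp add: field_simps)
      have "power_integral (2 * p - 2) \<le> 2 * power_integral p powr (2 - 2 / p)"
        using G[OF s] F unfolding sp s2 by simp
      then have "V1 \<le> \<epsilon> powr (2 + 1 / \<beta>) * (2 * power_integral p powr (2 - 2 / p))"
        unfolding V1 by (intro mult_left_mono) auto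
      also have "\<epsilon> powr (2 + 1 / \<beta>) \<le> (rate p)\<^sup>2"
        unfolding r2 using \<epsilon>_pos \<epsilon>_le_1 p \<beta> by (intro powr_mono') (auto simp: field_simps)
      then have "\<epsilon> powr (2 + 1 / \<beta>) * (2 * power_integral p powr (2 - 2 / p)) \<le> (rate p)\<^sup>2 * (K * power_integral p powr (2 - 2 / p))"
        by (intro mult_mono) (auto simp: K_def)
      finally have "V1 \<le> K * (rate p)\<^sup>2 * power_integral p powr (2 - 2 / p)" by (simp add: mult_ac)
      then show ?thesis using F by simp
    qed
  next
    case False
    then have p2: "2 \<le> p" by simp
    have "continuous_on {0..1} (\<lambda>x. \<bar>g x\<bar>)" using g_cont by (intro continuous_intros)
    from continuous_attains_sup[OF compact_Icc _ this]
    obtain x0 where x0: "x0 \<in> {0..1}" "\<And>x. x \<in> {0..1} \<Longrightarrow> \<bar>g x\<bar> \<le> \<bar>g x0\<bar>" by auto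
    define M where "M = \<bar>g x0\<bar>"
    show ?thesis
    proof (cases "M \<le> \<epsilon>")
      case True
      \<comment> \<open>A curve that stays below \<open>\<epsilon>\<close> falls under the first
        alternative; the term with coefficient 0 only fits the shape of
        \<open>power_integral_le\<close>.\<close>
      have "power_integral (2 * p - 2) \<le> \<epsilon> powr (2 * p - 2) + 0 * power_integral 0"
        using p x0(2) True unfolding M_def
        by (intro power_integral_le) (auto intro!: powr_mono2 intro: order_trans)
      then show ?thesis using small by simp
    next
      case False
      then have M: "\<epsilon> \<le> M" "0 < M" using \<epsilon>_pos by auto
      define c where "c = min ((1 / (2 * R)) powr (1 / \<beta>)) (1 / 2)"
      define k where "k = c * (1 / 2) powr p"
      have c: "0 < c" using R by (simp add: c_def)
      have k: "0 < k" using c by (simp add: k_def)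
      have "c * \<epsilon> powr (1 / \<beta>) * (M / 2) powr p \<le> power_integral p"
        unfolding c_def M_def by (rule power_integral_ge_peak[OF p x0(1)]) (use M in \<open>simp add: M_def\<close>)
      also have "c * \<epsilon> powr (1 / \<beta>) * (M / 2) powr p = k * (\<epsilon> powr (1 / \<beta>) * M powr p)"
        unfolding k_def using M by (simp add: powr_divide mult_ac)
      finally have F: "k * (\<epsilon> powr (1 / \<beta>) * M powr p) \<le> power_integral p" .
      have pos: "0 < k * (\<epsilon> powr (1 / \<beta>) * M powr p)" using k \<epsilon>_pos M by simp
      then have Fpos: "0 < power_integral p" using F by linarith
      \<comment> \<open>The height of the peak comes in as \<open>M powr (p - 2)\<close>; the peak
        bound \<open>F\<close> will trade it, together with a power of \<open>\<epsilon>\<close>,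
        for a power of \<open>power_integral p\<close>.\<close>
      have "power_integral (2 * p - 2) \<le> 0 + M powr (p - 2) * power_integral p"
      proof (rule power_integral_le)
        fix x :: real assume x: "x \<in> {0..1}"
        have "\<bar>g x\<bar> powr (2 * p - 2) = \<bar>g x\<bar> powr (p - 2) * \<bar>g x\<bar> powr p" by (simp flip: powr_add)
        also have "\<dots> \<le> M powr (p - 2) * \<bar>g x\<bar> powr p"
          using x0(2)[OF x] p2 unfolding M_def by (intro mult_right_mono powr_mono2) auto
        finally show "\<bar>g x\<bar> powr (2 * p - 2) \<le> 0 + M powr (p - 2) * \<bar>g x\<bar> powr p" by simp
      qed (use p p2 in auto)
      then have "V1 \<le> \<epsilon> powr (2 + 1 / \<beta>) * (M powr (p - 2) * power_integral p)"
        unfolding V1 by (intro mult_left_mono) auto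
      also have "\<epsilon> powr (2 + 1 / \<beta>) = \<epsilon> powr (2 + 1 / (p * \<beta>)) * \<epsilon> powr (1 / \<beta> - 1 / (p * \<beta>))"
        by (simp flip: powr_add)
      \<comment> \<open>A factor \<open>\<epsilon> powr (1 / (p * \<beta>))\<close>, at most 1, is
        given away so that \<open>\<epsilon> powr (1 / \<beta>)\<close> and \<open>M powr p\<close>
        get the common exponent \<open>1 - 2 / p\<close> and \<open>F\<close> applies to their
        product.\<close>
      also have "\<epsilon> powr (1 / \<beta> - 1 / (p * \<beta>)) \<le> \<epsilon> powr ((1 / \<beta>) * (1 - 2 / p))"
        using \<epsilon>_pos \<epsilon>_le_1 p \<beta> by (intro powr_mono') (auto simp: field_simps)
      then have "\<epsilon> powr (2 + 1 / (p * \<beta>)) * \<epsilon> powr (1 / \<beta> - 1 / (p * \<beta>)) * (M powr (p - 2) * power_integral p)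
          \<le> \<epsilon> powr (2 + 1 / (p * \<beta>)) * \<epsilon> powr ((1 / \<beta>) * (1 - 2 / p)) * (M powr (p - 2) * power_integral p)"
        using Fpos by (intro mult_right_mono mult_left_mono) auto
      also have "\<dots> = (rate p)\<^sup>2 * (\<epsilon> powr ((1 / \<beta>) * (1 - 2 / p)) * M powr (p - 2)) * power_integral p"
        unfolding r2 by (simp add: mult_ac)
      also have "\<epsilon> powr ((1 / \<beta>) * (1 - 2 / p)) * M powr (p - 2) = (\<epsilon> powr (1 / \<beta>) * M powr p) powr (1 - 2 / p)"
      proof -
        have "p * (1 - 2 / p) = p - 2" using p by (simp add: field_simps)
        then show ?thesis using \<epsilon>_pos M by (simp only: powr_mult powr_powr powr_ge_zero)
      qed
      also have "(\<epsilon> powr (1 / \<beta>) * M powr p) powr (1 - 2 / p) \<le> k powr (2 / p - 1) * power_integral p powr (1 - 2 / p)"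
      proof -
        have "(\<epsilon> powr (1 / \<beta>) * M powr p) powr (1 - 2 / p)
            = k powr (2 / p - 1) * (k * (\<epsilon> powr (1 / \<beta>) * M powr p)) powr (1 - 2 / p)"
        proof -
          have "k powr (2 / p - 1) * k powr (1 - 2 / p) = 1" using k by (simp flip: powr_add)
          then show ?thesis using k by (simp add: powr_mult mult.assoc[symmetric])
        qed
        also have "\<dots> \<le> k powr (2 / p - 1) * power_integral p powr (1 - 2 / p)"
          using F pos p2 by (intro mult_left_mono powr_mono2) auto
        finally show ?thesis .
      qed
      then have "(rate p)\<^sup>2 * (\<epsilon> powr (1 / \<beta>) * M powr p) powr (1 - 2 / p) * power_integral p
          \<le> (rate p)\<^sup>2 * (k powr (2 / p - 1) * power_integral p powr (1 - 2 / p)) * power_integral p"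
        using Fpos by (intro mult_right_mono mult_left_mono) auto
      also have "\<dots> = k powr (2 / p - 1) * (rate p)\<^sup>2 * power_integral p powr (2 - 2 / p)"
      proof -
        have "power_integral p powr (1 - 2 / p) * power_integral p powr 1 = power_integral p powr (2 - 2 / p)" by (simp only: powr_add[symmetric]) simp
        then show ?thesis using Fpos by (simp add: mult_ac)
      qed
      also have "\<dots> \<le> K * (rate p)\<^sup>2 * power_integral p powr (2 - 2 / p)"
        unfolding K_def k_def c_def by (intro mult_right_mono) auto
      finally show ?thesis using Fpos by simp
    qed
  qed
qed

text \<open>Cutting \<open>F_hat\<close> at 0 only moves it closer to the nonnegative target. The
  second bound is the better one when the error of \<open>F_hat\<close> is below
  \<open>power_integral p\<close>.\<close>

lemma T_hat_error:
  assumes p: "1 \<le> p"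
  shows "\<bar>T_hat \<beta> R p n S - Lp_norm p g\<bar> \<le> \<bar>F_hat \<beta> R p n S - power_integral p\<bar> powr (1 / p)"
    and "0 < power_integral p \<Longrightarrow> \<bar>T_hat \<beta> R p n S - Lp_norm p g\<bar> \<le> \<bar>F_hat \<beta> R p n S - power_integral p\<bar> * power_integral p powr (1 / p - 1)"
proof -
  let ?a = "max (F_hat \<beta> R p n S) 0"
  have le: "\<bar>?a - power_integral p\<bar> \<le> \<bar>F_hat \<beta> R p n S - power_integral p\<bar>" using power_integral_nonneg[of p] by auto
  have eq: "T_hat \<beta> R p n S - Lp_norm p g = ?a powr (1 / p) - power_integral p powr (1 / p)"
    by (simp add: T_hat_def Lp_norm_def power_integral_def)
  have "\<bar>?a powr (1 / p) - power_integral p powr (1 / p)\<bar> \<le> \<bar>?a - power_integral p\<bar> powr (1 / p)"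
    using p power_integral_nonneg[of p] by (intro abs_powr_diff_le) auto
  also have "\<dots> \<le> \<bar>F_hat \<beta> R p n S - power_integral p\<bar> powr (1 / p)" using le p by (intro powr_mono2) auto
  finally show "\<bar>T_hat \<beta> R p n S - Lp_norm p g\<bar> \<le> \<bar>F_hat \<beta> R p n S - power_integral p\<bar> powr (1 / p)" unfolding eq .
  assume F: "0 < power_integral p"
  have "\<bar>?a powr (1 / p) - power_integral p powr (1 / p)\<bar> \<le> \<bar>?a - power_integral p\<bar> * power_integral p powr (1 / p - 1)"
    using p F by (intro abs_powr_diff_le_linear) auto
  also have "\<dots> \<le> \<bar>F_hat \<beta> R p n S - power_integral p\<bar> * power_integral p powr (1 / p - 1)" using le by (intro mult_right_mono) auto
  finally show "\<bar>T_hat \<beta> R p n S - Lp_norm p g\<bar> \<le> \<bar>F_hat \<beta> R p n S - power_integral p\<bar> * power_integral p powr (1 / p - 1)" unfolding eq .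
qed

text \<open>\<open>V1\<close> is the part of the variance due to the size of the curve,
  \<open>V2\<close> the part due to the estimation error alone, and the \<open>2 * p\<close>-th root
  of \<open>V2\<close> is the rate. If \<open>V1\<close> is the larger one,
  \<open>variance_dichotomy\<close> leaves only its second alternative. The summand 1 in
  \<open>m\<close> makes the variance bound positive, as the interpolation demands.\<close>

lemma T_hat_risk:
  assumes p: "1 \<le> p"
  defines "K \<equiv> max 2 ((min ((1 / (2 * R)) powr (1 / \<beta>)) (1 / 2) * (1 / 2) powr p) powr (2 / p - 1))"
    and "m \<equiv> 4 * p\<^sup>2 * 2 powr (2 * p - 2) * (moment_const \<beta> R 1 + moment_const \<beta> R (2 * p - 1)) + 1"
  shows "(\<integral>\<^sup>+S. ennreal \<bar>T_hat \<beta> R p n S - Lp_norm p g\<bar> \<partial>Q)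
    \<le> ennreal ((2 * (2 * m) powr (1 / (2 * p)) + 2 * sqrt (2 * m * K)) * rate p)"
proof -
  define V1 where "V1 = \<epsilon> * power_integral (2 * p - 2) / real n"
  define V2 where "V2 = rate p powr (2 * p)"
  let ?X = "\<lambda>S. F_hat \<beta> R p n S - power_integral p"
  have mom: "0 \<le> moment_const \<beta> R 1" "0 \<le> moment_const \<beta> R (2 * p - 1)"
    using moment_const_nonneg[OF R] p by auto
  have m: "0 < m" unfolding m_def using mom by (intro add_nonneg_pos mult_nonneg_nonneg add_nonneg_nonneg) auto
  have K: "2 \<le> K" by (simp add: K_def)
  have V1: "0 \<le> V1" unfolding V1_def using \<epsilon>_pos power_integral_nonneg by (intro divide_nonneg_nonneg mult_nonneg_nonneg) auto
  have V2: "0 < V2" using rate_pos[of p] by (simp add: V2_def)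
  have V2': "V2 = \<epsilon> powr (2 * p - 1) / real n"
  proof -
    have "V2 = \<epsilon> powr ((1 + 1 / (2 * p * \<beta>)) * (2 * p))" unfolding V2_def rate_eq[OF p] by (rule powr_powr)
    also have "(1 + 1 / (2 * p * \<beta>)) * (2 * p) = (2 * p - 1) + (1 / \<beta> + 1)" using p \<beta> by (simp add: field_simps)
    also have "\<epsilon> powr \<dots> = \<epsilon> powr (2 * p - 1) * (1 / real n)" unfolding n_eq by (rule powr_add)
    finally show ?thesis by simp
  qed
  have X_meas [measurable]: "?X \<in> borel_measurable Q"
    using F_hat_measurable[OF R_nonneg \<beta>, of p n] p by (simp cong: measurable_cong_sets add: sets_Q)
  have "(\<integral>\<^sup>+S. ennreal ((?X S)\<^sup>2) \<partial>Q) \<le> ennreal (4 * p\<^sup>2 * 2 powr (2 * p - 2) / real n *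
        (power_integral (2 * p - 2) * (moment_const \<beta> R 1 * \<epsilon>) + moment_const \<beta> R (2 * p - 1) * \<epsilon> powr (2 * p - 1)))"
    using F_hat_mean_square[OF p] unfolding power_integral_def .
  also have "4 * p\<^sup>2 * 2 powr (2 * p - 2) / real n *
        (power_integral (2 * p - 2) * (moment_const \<beta> R 1 * \<epsilon>) + moment_const \<beta> R (2 * p - 1) * \<epsilon> powr (2 * p - 1))
      = 4 * p\<^sup>2 * 2 powr (2 * p - 2) * (moment_const \<beta> R 1 * V1 + moment_const \<beta> R (2 * p - 1) * V2)"
    unfolding V1_def V2' by (simp add: algebra_simps add_divide_distrib)
  also have "\<dots> \<le> m * (V1 + V2)"
  proof -
    have "moment_const \<beta> R 1 * V1 + moment_const \<beta> R (2 * p - 1) * V2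
        \<le> (moment_const \<beta> R 1 + moment_const \<beta> R (2 * p - 1)) * (V1 + V2)"
      using mom V1 V2 by (simp add: algebra_simps)
    then have "4 * p\<^sup>2 * 2 powr (2 * p - 2) * (moment_const \<beta> R 1 * V1 + moment_const \<beta> R (2 * p - 1) * V2)
        \<le> 4 * p\<^sup>2 * 2 powr (2 * p - 2) * ((moment_const \<beta> R 1 + moment_const \<beta> R (2 * p - 1)) * (V1 + V2))"
      by (rule mult_left_mono) simp
    also have "\<dots> = (m - 1) * (V1 + V2)" by (simp add: m_def mult.assoc)
    also have "\<dots> \<le> m * (V1 + V2)" using V1 V2 by (intro mult_right_mono) auto
    finally show ?thesis .
  qed
  finally have var: "(\<integral>\<^sup>+S. ennreal ((?X S)\<^sup>2) \<partial>Q) \<le> ennreal (m * (V1 + V2))" by (simp add: ennreal_leI)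
  have C: "0 \<le> 2 * (2 * m) powr (1 / (2 * p)) * rate p" "0 \<le> 2 * sqrt (2 * m * K) * rate p"
    using rate_pos[of p] m K by auto
  show ?thesis
  proof (cases "V1 \<le> V2")
    case True
    have le: "(\<integral>\<^sup>+S. ennreal ((?X S)\<^sup>2) \<partial>Q) \<le> ennreal (2 * m * V2)"
      by (rule order_trans[OF var], rule ennreal_leI) (use True m in \<open>simp add: algebra_simps\<close>)
    have "(\<integral>\<^sup>+S. ennreal \<bar>T_hat \<beta> R p n S - Lp_norm p g\<bar> \<partial>Q) \<le> (\<integral>\<^sup>+S. ennreal (\<bar>?X S\<bar> powr (2 * (1 / (2 * p)))) \<partial>Q)"
      using T_hat_error(1)[OF p] by (intro nn_integral_mono ennreal_leI) simp
    also have "\<dots> \<le> ennreal (2 * (2 * m * V2) powr (1 / (2 * p)))"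
      using m V2 p le by (intro moment_interpolation) (auto simp: divide_le_eq)
    also have "(2 * m * V2) powr (1 / (2 * p)) = (2 * m) powr (1 / (2 * p)) * rate p"
      using m V2 p rate_pos[of p] unfolding V2_def by (subst powr_mult) (auto simp: powr_powr)
    finally show ?thesis
      by (rule order_trans) (use C in \<open>auto intro!: ennreal_leI simp: algebra_simps\<close>)
  next
    case False
    from variance_dichotomy[OF p] False have F: "0 < power_integral p" and V1_le: "V1 \<le> K * (rate p)\<^sup>2 * power_integral p powr (2 - 2 / p)"
      unfolding V1_def V2_def K_def by auto
    let ?W = "2 * m * (K * (rate p)\<^sup>2 * power_integral p powr (2 - 2 / p))"
    have W: "0 < ?W" using m K rate_pos[of p] F by auto
    have le: "(\<integral>\<^sup>+S. ennreal ((?X S)\<^sup>2) \<partial>Q) \<le> ennreal ?W"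
    proof (rule order_trans[OF var], rule ennreal_leI)
      have "m * (V1 + V2) \<le> 2 * m * V1" using False m by (simp add: algebra_simps)
      also have "\<dots> \<le> ?W" using V1_le m by (intro mult_left_mono) auto
      finally show "m * (V1 + V2) \<le> ?W" .
    qed
    have "(\<integral>\<^sup>+S. ennreal \<bar>T_hat \<beta> R p n S - Lp_norm p g\<bar> \<partial>Q)
        \<le> (\<integral>\<^sup>+S. ennreal (power_integral p powr (1 / p - 1)) * ennreal (\<bar>?X S\<bar> powr (2 * (1 / 2))) \<partial>Q)"
    proof (rule nn_integral_mono)
      fix S
      show "ennreal \<bar>T_hat \<beta> R p n S - Lp_norm p g\<bar> \<le> ennreal (power_integral p powr (1 / p - 1)) * ennreal (\<bar>?X S\<bar> powr (2 * (1 / 2)))"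
        using T_hat_error(2)[OF p F, of S] by (simp add: mult.commute ennreal_leI flip: ennreal_mult)
    qed
    also have "\<dots> = ennreal (power_integral p powr (1 / p - 1)) * (\<integral>\<^sup>+S. ennreal (\<bar>?X S\<bar> powr (2 * (1 / 2))) \<partial>Q)"
      by (rule nn_integral_cmult) measurable
    also have "\<dots> \<le> ennreal (power_integral p powr (1 / p - 1)) * ennreal (2 * ?W powr (1 / 2))"
      by (intro mult_left_mono moment_interpolation W le X_meas) auto
    also have "\<dots> = ennreal (power_integral p powr (1 / p - 1) * (2 * ?W powr (1 / 2)))"
      by (rule ennreal_mult[symmetric]) auto
    \<comment> \<open>The slope of the root is a power of \<open>power_integral p\<close> with
      exponent \<open>1 / p - 1\<close>, and the bound on the standard deviation carries the
      opposite exponent, so the size of the curve drops out.\<close>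
    also have "power_integral p powr (1 / p - 1) * (2 * ?W powr (1 / 2)) = 2 * sqrt (2 * m * K) * rate p"
    proof -
      have "?W powr (1 / 2) = (2 * m * K * (rate p)\<^sup>2 * power_integral p powr (2 - 2 / p)) powr (1 / 2)" by (simp add: mult_ac)
      also have "\<dots> = (2 * m * K) powr (1 / 2) * ((rate p)\<^sup>2) powr (1 / 2) * (power_integral p powr (2 - 2 / p)) powr (1 / 2)"
        using m K by (simp add: powr_mult)
      also have "(2 * m * K) powr (1 / 2) = sqrt (2 * m * K)" using m K by (intro powr_half_sqrt) auto
      also have "((rate p)\<^sup>2) powr (1 / 2) = rate p"
        using rate_pos[of p] by (simp add: powr_half_sqrt)
      also have "(power_integral p powr (2 - 2 / p)) powr (1 / 2) = power_integral p powr (1 - 1 / p)"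
        by (simp add: powr_powr diff_divide_distrib)
      finally have "power_integral p powr (1 / p - 1) * (2 * ?W powr (1 / 2))
          = 2 * sqrt (2 * m * K) * rate p * (power_integral p powr (1 / p - 1) * power_integral p powr (1 - 1 / p))"
        by (simp only: mult_ac)
      also have "power_integral p powr (1 / p - 1) * power_integral p powr (1 - 1 / p) = 1"
        using F by (simp flip: powr_add)
      finally show ?thesis by simp
    qed
    finally show ?thesis
      by (rule order_trans) (use C in \<open>auto intro!: ennreal_leI simp: algebra_simps\<close>)
  qed
qed

end

section \<open>Uniformity over the curves and the minimax rate\<close>

theorem T_hat_max_risk:
  fixes \<beta> R p :: real
  assumes \<beta>: "0 < \<beta>" "\<beta> \<le> 1" and R: "0 < R" and p: "1 \<le> p"
  shows "\<exists>C>0. \<forall>P. ppp_model \<beta> R P \<longrightarrow> (\<forall>n\<ge>1. max_risk \<beta> R p (P n) (T_hat \<beta> R p n)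
    \<le> ennreal (C * real n powr (- ((\<beta> + 1 / (2 * p)) / (\<beta> + 1)))))"
proof -
  define K where "K = max 2 ((min ((1 / (2 * R)) powr (1 / \<beta>)) (1 / 2) * (1 / 2) powr p) powr (2 / p - 1))"
  define m where "m = 4 * p\<^sup>2 * 2 powr (2 * p - 2) * (moment_const \<beta> R 1 + moment_const \<beta> R (2 * p - 1)) + 1"
  define C where "C = 2 * (2 * m) powr (1 / (2 * p)) + 2 * sqrt (2 * m * K)"
  have "0 < m"
    unfolding m_def using moment_const_nonneg[OF R, of _ \<beta>] p
    by (intro add_nonneg_pos mult_nonneg_nonneg add_nonneg_nonneg) auto
  moreover have "0 < K" by (simp add: K_def)
  ultimately have "0 < C" unfolding C_def by (intro add_pos_pos) auto
  moreover have "max_risk \<beta> R p (P n) (T_hat \<beta> R p n) \<le> ennreal (C * real n powr (- ((\<beta> + 1 / (2 * p)) / (\<beta> + 1))))"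
    if P: "ppp_model \<beta> R P" and n: "1 \<le> n" for P n
    unfolding max_risk_def
  proof (rule SUP_least)
    fix g assume g: "g \<in> hoelder_ball \<beta> R"
    interpret boundary_model \<beta> R n g "P n g"
      using P n g \<beta> R by unfold_locales (auto simp: ppp_model_def)
    show "(\<integral>\<^sup>+S. ennreal \<bar>T_hat \<beta> R p n S - Lp_norm p g\<bar> \<partial>P n g)
      \<le> ennreal (C * real n powr (- ((\<beta> + 1 / (2 * p)) / (\<beta> + 1))))"
      using T_hat_risk[OF p] unfolding C_def K_def m_def rate_def .
  qed
  ultimately show ?thesis by blast
qed

theorem theorem4p1:
  fixes \<beta> R p :: real
  assumes "0 < \<beta>" and "\<beta> \<le> 1" and "0 < R" and "1 \<le> p"
  shows
    "(\<forall>n\<ge>1. T_hat \<beta> R p n \<in> borel_measurable config_space) \<and>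
     (\<exists>C>0. \<forall>P. ppp_model \<beta> R P \<longrightarrow>
        (\<forall>n\<ge>1. max_risk \<beta> R p (P n) (T_hat \<beta> R p n)
                 \<le> ennreal (C * real n powr (- ((\<beta> + 1 / (2 * p)) / (\<beta> + 1)))))) \<and>
     (\<forall>P. ppp_model \<beta> R P \<longrightarrow>
        liminf (\<lambda>n. ennreal (real n powr ((\<beta> + 1 / (2 * p)) / (\<beta> + 1)))
                      * minimax_risk \<beta> R p (P n)) > 0) \<and>
     (\<forall>P. ppp_model \<beta> R P \<longrightarrow>
        is_rate (\<lambda>n. minimax_risk \<beta> R p (P n))
                (\<lambda>n. real n powr (- ((\<beta> + 1 / (2 * p)) / (\<beta> + 1)))))"
proof (intro conjI allI impI)
  let ?e = "(\<beta> + 1 / (2 * p)) / (\<beta> + 1)"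
  obtain c where c: "0 < c" and lower: "\<And>P n. ppp_model \<beta> R P \<Longrightarrow> 1 \<le> n \<Longrightarrow>
      ennreal (c * real n powr (- ?e)) \<le> minimax_risk \<beta> R p (P n)"
    using minimax_risk_lower[OF assms] by blast
  obtain C where C: "0 < C" and upper: "\<And>P n. ppp_model \<beta> R P \<Longrightarrow> 1 \<le> n \<Longrightarrow>
      max_risk \<beta> R p (P n) (T_hat \<beta> R p n) \<le> ennreal (C * real n powr (- ?e))"
    using T_hat_max_risk[OF assms] by blast
  show meas: "T_hat \<beta> R p n \<in> borel_measurable config_space" for n
    using assms by (intro T_hat_measurable) auto
  show "\<exists>C>0. \<forall>P. ppp_model \<beta> R P \<longrightarrow> (\<forall>n\<ge>1. max_risk \<beta> R p (P n) (T_hat \<beta> R p n)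
      \<le> ennreal (C * real n powr (- ?e)))"
    by (rule T_hat_max_risk[OF assms])
  fix P assume P: "ppp_model \<beta> R P"
  have "\<forall>\<^sub>F n in sequentially. ennreal c \<le> ennreal (real n powr ?e) * minimax_risk \<beta> R p (P n)"
    using eventually_ge_at_top[of 1]
  proof eventually_elim
    case (elim n)
    have "ennreal c = ennreal (real n powr ?e) * ennreal (c * real n powr (- ?e))"
      using elim c by (simp add: powr_minus flip: ennreal_mult)
    also have "\<dots> \<le> ennreal (real n powr ?e) * minimax_risk \<beta> R p (P n)"
      by (intro mult_left_mono lower P elim) simp
    finally show ?case .
  qed
  then have le: "ennreal c \<le> liminf (\<lambda>n. ennreal (real n powr ?e) * minimax_risk \<beta> R p (P n))"
    by (rule Liminf_bounded)
  have "0 < ennreal c" using c by simp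
  from less_le_trans[OF this le] show "0 < liminf (\<lambda>n. ennreal (real n powr ?e) * minimax_risk \<beta> R p (P n))" .
  have "\<forall>\<^sub>F n in sequentially. ennreal (c * real n powr (- ?e)) \<le> minimax_risk \<beta> R p (P n)
      \<and> minimax_risk \<beta> R p (P n) \<le> ennreal (C * real n powr (- ?e))"
    using eventually_ge_at_top[of 1]
  proof eventually_elim
    case (elim n)
    \<comment> \<open>Measurability makes \<open>T_hat\<close> a competitor in the infimum.\<close>
    have "minimax_risk \<beta> R p (P n) \<le> max_risk \<beta> R p (P n) (T_hat \<beta> R p n)"
      unfolding minimax_risk_def by (rule INF_lower[OF meas])
    with lower[OF P elim] upper[OF P elim] show ?case by (auto intro: order_trans)
  qed
  then show "is_rate (\<lambda>n. minimax_risk \<beta> R p (P n)) (\<lambda>n. real n powr (- ?e))"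
    unfolding is_rate_def using c C by (intro exI[of _ c] conjI exI[of _ C])
qed

end
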